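(* Let $n=2m+s$ with $m\in\mathbb N$, $s\in\{0,1\}$. Suppose that $\mathcal T\in\mathfrak T_n^0$ and $F,\tilde F\in\mathfrak F(\mathcal T)$, and let $M(\lambda)$ and $\tilde M(\lambda)$ be the Weyl–Yurko matrices defined by means of $F$ and $\tilde F$, respectively. Then $M(\lambda)=L\tilde M(\lambda)$ for some constant matrix $L\in\mathfrak L_n$, where $$\mathfrak L_n=\bigl\{L=[l_{j,k}]_{j,k=1}^n\in\mathbb C^{n\times n}:\ l_{j,k}=\delta_{j,k}\ \text{ for } j\le n-m\ \text{ or }\ k>m\bigr\}.$$
   Context: All functions are complex-valued; $\delta_{j,k}$ is the Kronecker delta. $n=2m+s$, $m\in\mathbb N$, $s\in\{0,1\}$. $\mathfrak D=C_0^\infty(0,1)$, $\mathfrak D'$ is the space of distributions on $(0,1)$. For $p\in\{1,2\}$, $i\ge 0$, $W_p^{-i}[0,1]$ is the set of distributions $\sigma^{(i)}$ with $\sigma\in L_p[0,1]$. Singularity orders: $i_{2k+j}:=m-k-j$ for $k\ge 0$, $j\in\{0,1\}$. $\mathfrak T_n:=\{\mathcal T=(\tau_\nu)_{\nu=0}^{n-1}:\tau_\nu\in W_{2-s}^{-i_\nu}[0,1]\}$, $\mathfrak T_n^0:=\{\mathcal T\in\mathfrak T_n:\tau_{n-1}=0\}$. Differential expression with coefficients $\mathcal T$: $$\ell_n(y)=y^{(n)}+\sum_{k=0}^{m-1+s}(-1)^k(\tau_{2k}y^{(k)})^{(k)}+\sum_{k=0}^{m-1}(-1)^{k+1}\Bigl((\tau_{2k+1}y^{(k)})^{(k+1)}+(\tau_{2k+1}y^{(k+1)})^{(k)}\Bigr),$$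 understood in $\mathfrak D'$, where the product of $\tau=\sigma^{(i)}$, $\sigma\in L_{2-s}[0,1]$, and a function $g\in W_{2-s}^{i+s}[0,1]$ is $(\tau g,z)=(-1)^i\int_0^1\sigma\,(gz)^{(i)}\,dx$, $z\in\mathfrak D$. Class $\mathfrak F_n$. If $n=2m$: the $n\times n$ matrix functions $F=[f_{k,j}]_{k,j=1}^n$ on $[0,1]$ such that for $k=m+1,\dots,n$, $j=1,\dots,m$: $f_{k,j}\in L_1[0,1]$, $f_{m,j}\in L_2[0,1]$, $f_{k,m+1}\in L_2[0,1]$; and $f_{k,j}=0$ if $k<m$ or $j>m+1$ or $(k,j)=(m,m+1)$. If $n=2m+1$: $f_{k,j}\in L_1[0,1]$ for $k=m+1,\dots,2m+1$, $j=1,\dots,m+1$, and $f_{k,j}=0$ if $k<m+1$ or $j>m+1$. For $F\in\mathfrak F_n$: quasi-derivatives $y^{[0]}:=y$, $y^{[k]}:=(y^{[k-1]})'-\sum_{j=1}^kf_{k,j}y^{[j-1]}$, $k=1,\dots,n$; domain $\mathcal D_F:=\{y:y^{[k]}\in W_1^1[0,1],\ k=0,\dots,n-1\}$. $F\in\mathfrak F_n$ is associated with $\ell_n$ if $\ell_n(y)=y^{[n]}$ for all $y\in\mathcal D_F$; $\mathfrak F(\mathcal T)$ is the set of all $F\in\mathfrak F_n$ associated with the expression $\ell_n$ having coefficients $\mathcal T$. Weyl–Yurko matrix. Fix $F\in\mathfrak F(\mathcal T)$. A solution of $\ell_n(y)=\lambda y$ on $(0,1)$ is a function $y\in\mathcal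 D_F$ satisfying the equation a.e. on $(0,1)$. Let $C_k(x,\lambda)$, $k=1,\dots,n$, be the solutions with $C_k^{[j-1]}(0,\lambda)=\delta_{k,j}$, $j=1,\dots,n$, and $\Phi_k(x,\lambda)$, $k=1,\dots,n$, the solutions with $$\Phi_k^{[j-1]}(0,\lambda)=\delta_{k,j},\ j=1,\dots,k,\qquad \Phi_k^{[n-r]}(1,\lambda)=0,\ r=k+1,\dots,n$$ (quasi-derivatives with respect to $F$). The $C_k^{[j-1]}(x,\cdot)$ are entire; the $\Phi_k$ are uniquely defined for all $\lambda\in\mathbb C$ except a countable set and $\Phi_k^{[j-1]}(x,\cdot)$ are meromorphic. With $C(x,\lambda)=[C_k^{[j-1]}(x,\lambda)]_{j,k=1}^n$ and $\Phi(x,\lambda)=[\Phi_k^{[j-1]}(x,\lambda)]_{j,k=1}^n$, the Weyl–Yurko matrix $M(\lambda)=[M_{j,k}(\lambda)]_{j,k=1}^n$ (depending on $F$) is defined by $\Phi(x,\lambda)=C(x,\lambda)M(\lambda)$; it is meromorphic in $\lambda$ and unit lower-triangular. *)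

theory Defs
  imports "HOL-Analysis.Analysis" "Jordan_Normal_Form.Matrix"
begin

text \<open>
  Elements of \<open>L\<^sub>p[0,1]\<close> are represented by functions \<open>real \<Rightarrow> complex\<close>; only their values on
  \<open>[0,1]\<close> matter. All notions below are insensitive to changes on null sets, except where a
  function has to be evaluated at a point; there the continuous representative is used.
\<close>

abbreviation leb01 :: "real measure" where
  "leb01 \<equiv> lebesgue_on {0..1}"

definition Lp01 :: "nat \<Rightarrow> (real \<Rightarrow> complex) set" where
  "Lp01 p = {f \<in> borel_measurable leb01. integrable leb01 (\<lambda>x. cmod (f x) ^ p)}"

text \<open>The members of \<open>W\<^sub>1\<^sup>1[0,1]\<close> are taken to be the absolutely continuous functions, i.e. the
  indefinite integrals of functions in \<open>L\<^sub>1[0,1]\<close>.\<close>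

definition W11 :: "(real \<Rightarrow> complex) set" where
  "W11 = {u. \<exists>v \<in> Lp01 1. \<forall>x \<in> {0..1}. u x = u 0 + (LINT t|lebesgue_on {0..x}. v t)}"

text \<open>\<open>v\<close> is the generalized derivative of (the class of) \<open>u\<close>: the latter has an absolutely
  continuous representative, whose derivative is \<open>v\<close>. It determines \<open>v\<close> up to null sets, and
  \<open>(sderiv ^^ i) u\<close> is the i-th derivative of \<open>u\<close> in \<open>W\<^sub>1\<^sup>i[0,1]\<close>.\<close>

definition has_sderiv :: "(real \<Rightarrow> complex) \<Rightarrow> (real \<Rightarrow> complex) \<Rightarrow> bool" where
  "has_sderiv u v \<longleftrightarrow>
     v \<in> Lp01 1 \<and> (\<exists>c. AE x in leb01. u x = c + (LINT t|lebesgue_on {0..x}. v t))"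

definition sderiv :: "(real \<Rightarrow> complex) \<Rightarrow> real \<Rightarrow> complex" where
  "sderiv u = (SOME v. has_sderiv u v)"

definition cont_rep :: "(real \<Rightarrow> complex) \<Rightarrow> real \<Rightarrow> complex" where
  "cont_rep h =
     (if \<exists>u. continuous_on {0..1} u \<and> (AE x in leb01. u x = h x)
      then SOME u. continuous_on {0..1} u \<and> (AE x in leb01. u x = h x)
      else h)"

subsection \<open>Distributions on the open unit interval\<close>

definition cderiv :: "(real \<Rightarrow> complex) \<Rightarrow> real \<Rightarrow> complex" where
  "cderiv z = (\<lambda>x. vector_derivative z (at x))"

definition test_functions :: "(real \<Rightarrow> complex) set" where
  "test_functions =
     {z. (\<forall>k x. (cderiv ^^ k) z differentiable (at x)) \<and>
         (\<exists>K. compact K \<and> K \<subseteq> {0<..<1} \<and> (\<forall>x. x \<notin> K \<longrightarrow> z x = 0))}"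

text \<open>Distributions are functionals restricted to the test functions (undefined elsewhere), so
  that equality in the space of distributions is HOL equality.\<close>

type_synonym distrib = "(real \<Rightarrow> complex) \<Rightarrow> complex"

definition regular_distrib :: "(real \<Rightarrow> complex) \<Rightarrow> distrib" where
  "regular_distrib f = (\<lambda>z \<in> test_functions. LINT x|leb01. f x * z x)"

definition zero_distrib :: distrib where
  "zero_distrib = (\<lambda>z \<in> test_functions. 0)"

definition distrib_deriv :: "nat \<Rightarrow> distrib \<Rightarrow> distrib" where
  "distrib_deriv i T = (\<lambda>z \<in> test_functions. (- 1) ^ i * T ((cderiv ^^ i) z))"

text \<open>\<open>W_neg p i\<close> is the space \<open>W\<^sub>p\<^sup>-\<^sup>i[0,1]\<close>.\<close>

definition W_neg :: "nat \<Rightarrow> nat \<Rightarrow> distrib set" where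
  "W_neg p i = {distrib_deriv i (regular_distrib \<sigma>) | \<sigma>. \<sigma> \<in> Lp01 p}"

text \<open>The product of \<open>\<tau> = \<sigma>\<^sup>(\<^sup>i\<^sup>)\<close>, \<open>\<sigma> \<in> L\<^sub>p[0,1]\<close>, with a function \<open>g\<close>. It does not depend on
  the choice of \<open>\<sigma>\<close> (which is determined up to polynomials of degree less than \<open>i\<close>) as long as
  \<open>g\<close> belongs to the Sobolev space for which the product is intended.\<close>

definition distrib_mult :: "nat \<Rightarrow> nat \<Rightarrow> distrib \<Rightarrow> (real \<Rightarrow> complex) \<Rightarrow> distrib" where
  "distrib_mult p i \<tau> g =
     (let \<sigma> = (SOME \<sigma>. \<sigma> \<in> Lp01 p \<and> \<tau> = distrib_deriv i (regular_distrib \<sigma>))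
      in (\<lambda>z \<in> test_functions.
            (- 1) ^ i * (LINT x|leb01. \<sigma> x * (sderiv ^^ i) (\<lambda>t. g t * z t) x)))"

subsection \<open>The differential expression\<close>

text \<open>Throughout, the order of the expression is \<open>n = 2 * m + s\<close> with \<open>s \<in> {0, 1}\<close>.
  \<open>sing_order m (2 * k + j) = m - k - j\<close> for \<open>j \<in> {0, 1}\<close>; the subtraction does not truncate for
  indices less than \<open>n\<close>.\<close>

definition sing_order :: "nat \<Rightarrow> nat \<Rightarrow> nat" where
  "sing_order m \<nu> = m - \<nu> div 2 - \<nu> mod 2"

definition coeffs_class :: "nat \<Rightarrow> nat \<Rightarrow> (nat \<Rightarrow> distrib) set" where
  "coeffs_class m s = {\<tau>. \<forall>\<nu> < 2 * m + s. \<tau> \<nu> \<in> W_neg (2 - s) (sing_order m \<nu>)}"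

definition coeffs_class0 :: "nat \<Rightarrow> nat \<Rightarrow> (nat \<Rightarrow> distrib) set" where
  "coeffs_class0 m s = {\<tau> \<in> coeffs_class m s. \<tau> (2 * m + s - 1) = zero_distrib}"

definition diff_expr ::
  "nat \<Rightarrow> nat \<Rightarrow> (nat \<Rightarrow> distrib) \<Rightarrow> (real \<Rightarrow> complex) \<Rightarrow> distrib" where
  "diff_expr m s \<tau> y =
     (let P = (\<lambda>\<nu> g. distrib_mult (2 - s) (sing_order m \<nu>) (\<tau> \<nu>) g)
      in (\<lambda>z \<in> test_functions.
        distrib_deriv (2 * m + s) (regular_distrib y) z
        + (\<Sum>k<m + s. (- 1) ^ k * distrib_deriv k (P (2 * k) ((sderiv ^^ k) y)) z)
        + (\<Sum>k<m. (- 1) ^ (k + 1) *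
             (distrib_deriv (k + 1) (P (2 * k + 1) ((sderiv ^^ k) y)) z
              + distrib_deriv k (P (2 * k + 1) ((sderiv ^^ (k + 1)) y)) z))))"

subsection \<open>Associated matrices and quasi-derivatives\<close>

text \<open>\<open>F k j x\<close> is the entry \<open>f\<^sub>k\<^sub>,\<^sub>j(x)\<close>, \<open>k, j = 1, \<dots>, n\<close>, of a matrix function; other indices are
  irrelevant.\<close>

type_synonym matfun = "nat \<Rightarrow> nat \<Rightarrow> real \<Rightarrow> complex"

definition matfun_class :: "nat \<Rightarrow> nat \<Rightarrow> matfun set" where
  "matfun_class m s =
     (let n = 2 * m + s in
      if s = 0 then
        {F. (\<forall>k \<in> {m+1..n}. \<forall>j \<in> {1..m}.
               F k j \<in> Lp01 1 \<and> F m j \<in> Lp01 2 \<and> F k (m+1) \<in> Lp01 2) \<and>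
            (\<forall>k \<in> {1..n}. \<forall>j \<in> {1..n}. k < m \<or> j > m + 1 \<or> (k, j) = (m, m+1) \<longrightarrow>
               (AE x in leb01. F k j x = 0))}
      else
        {F. (\<forall>k \<in> {m+1..n}. \<forall>j \<in> {1..m+1}. F k j \<in> Lp01 1) \<and>
            (\<forall>k \<in> {1..n}. \<forall>j \<in> {1..n}. k < m + 1 \<or> j > m + 1 \<longrightarrow>
               (AE x in leb01. F k j x = 0))})"

text \<open>\<open>quasi F y k\<close> is \<open>y\<^sup>[\<^sup>k\<^sup>]\<close>, realized by its continuous representative whenever there is one,
  so that the boundary values at 0 and 1 are meaningful.\<close>

fun quasi :: "matfun \<Rightarrow> (real \<Rightarrow> complex) \<Rightarrow> nat \<Rightarrow> real \<Rightarrow> complex" where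
  "quasi F y 0 = y"
| "quasi F y (Suc k) =
     cont_rep (\<lambda>x. sderiv (quasi F y k) x - (\<Sum>j\<in>{1..Suc k}. F (Suc k) j x * quasi F y (j - 1) x))"

definition qdomain :: "nat \<Rightarrow> matfun \<Rightarrow> (real \<Rightarrow> complex) set" where
  "qdomain n F = {y. \<forall>k<n. quasi F y k \<in> W11}"

definition associated :: "nat \<Rightarrow> nat \<Rightarrow> (nat \<Rightarrow> distrib) \<Rightarrow> matfun set" where
  "associated m s \<tau> =
     {F \<in> matfun_class m s.
        \<forall>y \<in> qdomain (2 * m + s) F. diff_expr m s \<tau> y = regular_distrib (quasi F y (2 * m + s))}"

subsection \<open>The Weyl--Yurko matrix\<close>

definition is_solution ::
  "nat \<Rightarrow> nat \<Rightarrow> (nat \<Rightarrow> distrib) \<Rightarrow> matfun \<Rightarrow> complex \<Rightarrow> (real \<Rightarrow> complex) \<Rightarrow> bool" where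
  "is_solution m s \<tau> F \<mu> y \<longleftrightarrow>
     y \<in> qdomain (2 * m + s) F \<and>
     (\<exists>h \<in> Lp01 1. diff_expr m s \<tau> y = regular_distrib h \<and> (AE x in leb01. h x = \<mu> * y x))"

definition is_C ::
  "nat \<Rightarrow> nat \<Rightarrow> (nat \<Rightarrow> distrib) \<Rightarrow> matfun \<Rightarrow> nat \<Rightarrow> complex \<Rightarrow> (real \<Rightarrow> complex) \<Rightarrow> bool" where
  "is_C m s \<tau> F k \<mu> y \<longleftrightarrow>
     is_solution m s \<tau> F \<mu> y \<and>
     (\<forall>j \<in> {1..2 * m + s}. quasi F y (j - 1) 0 = (if k = j then 1 else 0))"

definition is_Phi ::
  "nat \<Rightarrow> nat \<Rightarrow> (nat \<Rightarrow> distrib) \<Rightarrow> matfun \<Rightarrow> nat \<Rightarrow> complex \<Rightarrow> (real \<Rightarrow> complex) \<Rightarrow> bool" where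
  "is_Phi m s \<tau> F k \<mu> y \<longleftrightarrow>
     is_solution m s \<tau> F \<mu> y \<and>
     (\<forall>j \<in> {1..k}. quasi F y (j - 1) 0 = (if k = j then 1 else 0)) \<and>
     (\<forall>r \<in> {k+1..2 * m + s}. quasi F y (2 * m + s - r) 1 = 0)"

definition C_sol ::
  "nat \<Rightarrow> nat \<Rightarrow> (nat \<Rightarrow> distrib) \<Rightarrow> matfun \<Rightarrow> nat \<Rightarrow> complex \<Rightarrow> real \<Rightarrow> complex" where
  "C_sol m s \<tau> F k \<mu> = (SOME y. is_C m s \<tau> F k \<mu> y)"

definition Phi_sol ::
  "nat \<Rightarrow> nat \<Rightarrow> (nat \<Rightarrow> distrib) \<Rightarrow> matfun \<Rightarrow> nat \<Rightarrow> complex \<Rightarrow> real \<Rightarrow> complex" where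
  "Phi_sol m s \<tau> F k \<mu> = (SOME y. is_Phi m s \<tau> F k \<mu> y)"

text \<open>The (countable) set of spectral parameters for which some Weyl solution fails to exist or to
  be unique as a function on \<open>[0,1]\<close>. It contains all poles of the Weyl--Yurko matrix.\<close>

definition exceptional :: "nat \<Rightarrow> nat \<Rightarrow> (nat \<Rightarrow> distrib) \<Rightarrow> matfun \<Rightarrow> complex set" where
  "exceptional m s \<tau> F =
     {\<mu>. \<not> (\<forall>k \<in> {1..2 * m + s}.
              (\<exists>y. is_Phi m s \<tau> F k \<mu> y) \<and>
              (\<forall>y y'. is_Phi m s \<tau> F k \<mu> y \<longrightarrow> is_Phi m s \<tau> F k \<mu> y' \<longrightarrow>
                      (\<forall>x \<in> {0..1}. y x = y' x)))}"

text \<open>The rows and columns of a matrix of type \<open>complex mat\<close> are numbered from 0.\<close>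

definition C_mat ::
  "nat \<Rightarrow> nat \<Rightarrow> (nat \<Rightarrow> distrib) \<Rightarrow> matfun \<Rightarrow> complex \<Rightarrow> real \<Rightarrow> complex mat" where
  "C_mat m s \<tau> F \<mu> x =
     mat (2 * m + s) (2 * m + s) (\<lambda>(j, k). quasi F (C_sol m s \<tau> F (k + 1) \<mu>) j x)"

definition Phi_mat ::
  "nat \<Rightarrow> nat \<Rightarrow> (nat \<Rightarrow> distrib) \<Rightarrow> matfun \<Rightarrow> complex \<Rightarrow> real \<Rightarrow> complex mat" where
  "Phi_mat m s \<tau> F \<mu> x =
     mat (2 * m + s) (2 * m + s) (\<lambda>(j, k). quasi F (Phi_sol m s \<tau> F (k + 1) \<mu>) j x)"

text \<open>Meaningful for \<open>\<mu> \<notin> exceptional m s \<tau> F\<close>.\<close>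

definition weyl_yurko ::
  "nat \<Rightarrow> nat \<Rightarrow> (nat \<Rightarrow> distrib) \<Rightarrow> matfun \<Rightarrow> complex \<Rightarrow> complex mat" where
  "weyl_yurko m s \<tau> F \<mu> =
     (THE M. M \<in> carrier_mat (2 * m + s) (2 * m + s) \<and>
             (\<forall>x \<in> {0..1}. Phi_mat m s \<tau> F \<mu> x = C_mat m s \<tau> F \<mu> x * M))"

definition L_class :: "nat \<Rightarrow> nat \<Rightarrow> complex mat set" where
  "L_class n m =
     {L \<in> carrier_mat n n. \<forall>j \<in> {1..n}. \<forall>k \<in> {1..n}.
        j \<le> n - m \<or> k > m \<longrightarrow> L $$ (j - 1, k - 1) = (if j = k then 1 else 0)}"

end

theory Submission
  imports Defs "Jordan_Normal_Form.Determinant"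
begin

text \<open>
  Write the quasi-derivatives of \<open>y\<close> as a vector \<open>Y\<close>, so that \<open>y\<^sup>[\<^sup>n\<^sup>] = f\<close> becomes a first-order system
  \<open>Y' = A Y + f e\<^sub>n\<close> with integrable coefficients. Apart from its leading term, the expression is
  a bilinear form in the derivatives of \<open>y\<close> and of the test function up to order \<open>m\<close>, and
  regularizing it step by step (du Bois-Reymond) yields a canonical system \<open>Z' = A\<^sub>0 Z + f e\<^sub>n\<close>
  depending only on the coefficients, with \<open>Z\<^sub>1 = y\<close>, for every \<open>y\<close> in the domain of any associated
  matrix. If \<open>C\<close> is
  a fundamental matrix of \<open>Y' = A Y\<close> and \<open>C\<^sub>0\<close> consists of the canonical vectors of the same functions,
  then \<open>V = C\<^sub>0 C\<^sup>-\<^sup>1\<close> satisfies \<open>V' = A\<^sub>0 V - V A\<close> and has first row \<open>e\<^sub>1\<close>; the companion structure of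
  \<open>A\<close> and \<open>A\<^sub>0\<close> then forces \<open>V(x)\<close> to lie in the class \<open>L\<^sub>n\<close> for every \<open>x\<close>. Hence the
  quasi-derivatives for two associated matrices differ by a factor in this class. Such a factor
  preserves the conditions defining the Weyl solutions, so these coincide, and evaluation at 0 gives
  the claim, as the Weyl--Yurko matrix is the matrix of quasi-derivatives of the Weyl solutions at 0.
\<close>

section \<open>Absolutely continuous functions and their derivatives\<close>

text \<open>The domains of two associated matrices are not known to coincide, so their
  quasi-derivatives cannot be compared directly. The canonical system is a common target for both,
  and the equality of the solutions comes out as a consequence. Lying in the class means being the
  identity plus a block in the rows of index at least n-m (counted from 0) and the first m columns.
  Since n-m >= m, two such blocks multiply to zero, so the quotient of two intertwining matrices
  V_1, V_2 is explicit: V_2^-1 V_1 = I + (V_1 - V_2), and nothing has to be inverted. The shape also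
  fixes the first row e_1 and the last column e_n. Hence V carries the extra term \<mu> y of the
  last row along, although it is built at \<mu> = 0, and the factor does not depend on \<mu>. The
  boundary conditions survive for a triangular reason: a component of index k >= n-m changes only by
  components of index below m <= k, and whenever a Weyl condition prescribes component k, it
  prescribes zero for all lower ones at the same endpoint.\<close>

abbreviation aeq :: "(real \<Rightarrow> complex) \<Rightarrow> (real \<Rightarrow> complex) \<Rightarrow> bool" where
  "aeq u v \<equiv> AE x in leb01. u x = v x"

definition primitive :: "(real \<Rightarrow> complex) \<Rightarrow> real \<Rightarrow> complex" where
  "primitive v x = (LINT t|lebesgue_on {0..x}. v t)"

text \<open>The first argument is taken pointwise on all of [0,1], the second only through its
  integral. This keeps the boundary values meaningful and a concrete derivative in hand, in place of
  the chosen one behind \<open>sderiv\<close>.\<close>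

definition acd :: "(real \<Rightarrow> complex) \<Rightarrow> (real \<Rightarrow> complex) \<Rightarrow> bool" where
  "acd u v \<longleftrightarrow> integrable leb01 v \<and> (\<forall>x\<in>{0..1}. u x = u 0 + primitive v x)"

lemma Lp01_1_iff: "v \<in> Lp01 1 \<longleftrightarrow> integrable leb01 v"
  by (auto simp: Lp01_def integrable_norm_iff intro: integrable_norm)

lemma primitive_indicator:
  assumes "x \<in> {0..1}"
  shows "primitive v x = (LINT t|leb01. indicat_real {0..x} t *\<^sub>R v t)"
proof -
  have "lebesgue_on {0..x} = restrict_space leb01 {0..x}"
    using assms by (simp add: restrict_restrict_space Int_absorb1)
  then show ?thesis using assms
    by (simp add: primitive_def integral_restrict_space sets_restrict_space_iff)
qed

lemma integrable_indicator_01: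
  fixes v :: "real \<Rightarrow> complex"
  assumes "integrable leb01 v" "{a..b} \<subseteq> {0..1}"
  shows "integrable leb01 (\<lambda>t. indicat_real {a..b} t *\<^sub>R v t)"
  using assms by (intro integrable_mult_indicator) (auto simp: sets_restrict_space_iff)

lemma integrable_sub:
  fixes v :: "real \<Rightarrow> complex"
  assumes "integrable leb01 v" "x \<in> {0..1}"
  shows "integrable (lebesgue_on {0..x}) v"
proof -
  have "lebesgue_on {0..x} = restrict_space leb01 {0..x}"
    using assms by (simp add: restrict_restrict_space Int_absorb1)
  then show ?thesis using integrable_indicator_01[of v 0 x] assms
    by (simp add: integrable_restrict_space sets_restrict_space_iff)
qed

text \<open>Passage to the gauge integral, where continuity of the indefinite integral and Lebesgue
  differentiation are at hand.\<close>

lemma primitive_HK: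
  assumes "integrable leb01 v" "x \<in> {0..1}"
  shows "primitive v x = integral {0..x} v"
  unfolding primitive_def
  by (rule lebesgue_integral_eq_integral[OF integrable_sub[OF assms]]) simp

lemma primitive_0 [simp]: "primitive v 0 = 0"
proof -
  have "AE t in leb01. indicat_real {0..0} t *\<^sub>R v t = 0"
  proof -
    have "AE t in lebesgue. t \<noteq> (0::real)"
      by (simp add: AE_completion_iff AE_lborel_singleton)
    then have "AE t in leb01. t \<noteq> 0" by (simp add: AE_restrict_space_iff) (erule eventually_mono, simp)
    then show ?thesis by eventually_elim auto
  qed
  then show ?thesis using primitive_indicator[of 0 v]
    by (simp add: integral_eq_zero_AE)
qed

lemma primitive_1: "primitive v 1 = (LINT t|leb01. v t)"
  by (simp add: primitive_def)

lemma primitive_cong: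
  assumes "\<And>t. t \<in> {0..x} \<Longrightarrow> v t = w t"
  shows "primitive v x = primitive w x"
  unfolding primitive_def using assms by (intro Bochner_Integration.integral_cong) auto

lemma primitive_cong_AE:
  assumes "aeq v w" "v \<in> borel_measurable leb01" "w \<in> borel_measurable leb01" "x \<in> {0..1}"
  shows "primitive v x = primitive w x"
proof -
  have m: "(\<lambda>t. indicat_real {0..x} t *\<^sub>R f t) \<in> borel_measurable leb01"
    if "f \<in> borel_measurable leb01" for f :: "real \<Rightarrow> complex"
    using that assms(4) by (intro borel_measurable_scaleR borel_measurable_indicator) (auto simp: sets_restrict_space_iff)
  show ?thesis unfolding primitive_indicator[OF assms(4)]
    by (rule integral_cong_AE[OF m m]) (use assms in \<open>auto elim!: eventually_mono\<close>)
qed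

lemma primitive_add:
  assumes "integrable leb01 v" "integrable leb01 w" "x \<in> {0..1}"
  shows "primitive (\<lambda>t. v t + w t) x = primitive v x + primitive w x"
  using assms by (simp add: primitive_def integrable_sub)

lemma primitive_mult:
  assumes "integrable leb01 v" "x \<in> {0..1}"
  shows "primitive (\<lambda>t. c * v t) x = c * primitive v x"
  using assms by (simp add: primitive_def integrable_sub)

lemma continuous_primitive:
  assumes "integrable leb01 v"
  shows "continuous_on {0..1} (primitive v)"
proof -
  have "v integrable_on {0..1}" by (rule integrable_on_lebesgue_on[OF assms]) simp
  then have "continuous_on {0..1} (\<lambda>x. integral {0..x} v)"
    by (rule indefinite_integral_continuous_1)
  then show ?thesis
    using continuous_on_cong[of "{0..1}" "{0..1}" "primitive v" "\<lambda>x. integral {0..x} v"] primitive_HK[OF assms]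
    by blast
qed

text \<open>Integrals over intervals are differences of primitives, so they all vanish, and by
  Lebesgue differentiation \<open>v\<close> is a.e. the limit of its averages over [x, x+h]. The
  extension \<open>f\<close> by zero is there because these intervals may leave [0,1].\<close>

lemma primitive_zero_AE:
  assumes "integrable leb01 v" and z: "\<And>x. x \<in> {0..1} \<Longrightarrow> primitive v x = 0"
  shows "aeq v (\<lambda>_. 0)"
proof -
  have v: "v integrable_on {0..1}" by (rule integrable_on_lebesgue_on[OF assms(1)]) simp
  define f where "f = (\<lambda>x. if x \<in> {0..1} then v x else 0)"
  have fi: "f integrable_on cbox a b" for a b
  proof -
    have "f integrable_on UNIV"
      using v unfolding f_def by (simp only: Henstock_Kurzweil_Integration.integrable_restrict_UNIV)
    then show ?thesis by (rule integrable_on_subcbox) simp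
  qed
  have f0: "integral (cbox a b) f = 0" for a b
  proof -
    have e: "integral (cbox a b) f = integral ({max a 0..min b 1}) v"
      unfolding f_def using integral_restrict_Int[of "{a..b}" "{0..1}" v] by (simp add: Int_commute max.commute min.commute)
    show ?thesis
    proof (cases "max a 0 \<le> min b 1")
      case True
      then have m: "min b 1 \<in> {0..1}" "max a 0 \<in> {0..1}" by auto
      have "integral {0..max a 0} v + integral {max a 0..min b 1} v = integral {0..min b 1} v"
        by (rule Henstock_Kurzweil_Integration.integral_combine)
          (use True m in \<open>auto intro!: integrable_on_subinterval[OF v]\<close>)
      moreover have "integral {0..max a 0} v = 0" "integral {0..min b 1} v = 0"
        using primitive_HK[OF assms(1)] z m by metis+
      ultimately show ?thesis using e by simp
    next
      case False
      then have "{max a 0..min b 1} = {}" by auto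
      then show ?thesis using e by simp
    qed
  qed
  obtain N where N: "negligible N"
    "\<And>x e. \<lbrakk>x \<notin> N; 0 < e\<rbrakk> \<Longrightarrow> \<exists>d>0. \<forall>h. 0 < h \<and> h < d \<longrightarrow>
                         norm(integral (cbox x (x + h *\<^sub>R One)) f /\<^sub>R h ^ DIM(real) - f x) < e"
    by (rule integrable_ccontinuous_explicit[of f, OF fi]) blast
  have fz: "f x = 0" if x: "x \<notin> N" for x
  proof (rule ccontr)
    assume "f x \<noteq> 0"
    then obtain d where d: "d > 0"
      "\<forall>h. 0 < h \<and> h < d \<longrightarrow> norm (integral (cbox x (x + h *\<^sub>R One)) f /\<^sub>R h ^ DIM(real) - f x) < norm (f x)"
      using N(2)[OF x, of "norm (f x)"] by auto
    from dense[OF d(1)] d(2) show False unfolding f0 by auto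
  qed
  have "N \<in> null_sets lebesgue" using N(1) negligible_iff_null_sets by blast
  then have "AE x in lebesgue. x \<notin> N" by (rule AE_not_in)
  then have "AE x in lebesgue. x \<in> {0..1} \<longrightarrow> v x = 0"
  proof eventually_elim
    case (elim x)
    then show ?case using fz[of x] by (auto simp: f_def)
  qed
  then show ?thesis by (simp add: AE_restrict_space_iff)
qed

lemma continuous_integrable_01:
  fixes u :: "real \<Rightarrow> complex"
  assumes "continuous_on {0..1} u"
  shows "integrable leb01 u"
proof -
  have "u absolutely_integrable_on {0..1}"
    by (rule absolutely_integrable_continuous_real[OF assms])
  then show ?thesis
    by (simp add: set_integrable_def integrable_restrict_space)
qed

text \<open>The points of (0,1) where the functions differ form an open null set, hence there are
  none; continuity reaches the endpoints. This turns a.e. identities into pointwise ones, also at 0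
  and 1.\<close>

lemma continuous_aeq_eq:
  assumes "continuous_on {0..1} u" "continuous_on {0..1} w" "aeq u w" "x \<in> {0..1}"
  shows "u x = w x"
proof -
  define v where "v = (\<lambda>x. u x - w x)"
  have c: "continuous_on {0..1} v" unfolding v_def by (intro continuous_intros assms)
  have "AE x in lebesgue. x \<in> {0..1} \<longrightarrow> v x = 0"
    using assms(3) by (auto simp: AE_restrict_space_iff v_def elim!: eventually_mono)
  then obtain N where N: "N \<in> null_sets lebesgue" "{x. \<not> (x \<in> {0..1} \<longrightarrow> v x = 0)} \<subseteq> N"
    by (auto elim!: AE_E3 simp: eventually_ae_filter)
  have "v y = 0" if "y \<in> {0<..<1}" for y
  proof (rule ccontr)
    assume "v y \<noteq> 0"
    have cc: "continuous_on {0<..<1} v" by (rule continuous_on_subset[OF c]) auto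
    have o: "open {t\<in>{0<..<1}. v t \<noteq> 0}"
      using continuous_open_preimage[OF cc _ open_Compl[OF closed_singleton[of 0]]]
      by (simp add: vimage_def Int_def)
    have "{t\<in>{0<..<1}. v t \<noteq> 0} \<subseteq> N" using N by auto
    then have "negligible {t\<in>{0<..<1}. v t \<noteq> 0}"
      using N(1) negligible_iff_null_sets negligible_subset by blast
    then show False using open_not_negligible[OF o] that \<open>v y \<noteq> 0\<close> by blast
  qed
  then have "v y = 0" if "y \<in> {0..1}" for y
    using continuous_constant_on_closure[of "{0<..<1}" v 0 y] c that by simp
  then show ?thesis using assms(4) by (simp add: v_def)
qed

section \<open>Calculus of absolutely continuous functions\<close>

lemma acd_integrable: "acd u v \<Longrightarrow> integrable leb01 v"
  by (simp add: acd_def)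

lemma acdD: "acd u v \<Longrightarrow> x \<in> {0..1} \<Longrightarrow> u x = u 0 + primitive v x"
  unfolding acd_def by blast

lemma acd_continuous: "acd u v \<Longrightarrow> continuous_on {0..1} u"
proof -
  assume uv: "acd u v"
  have "continuous_on {0..1} (\<lambda>x. u 0 + primitive v x)"
    by (intro continuous_on_add continuous_on_const continuous_primitive acd_integrable[OF uv])
  moreover have "\<And>x. x \<in> {0..1} \<Longrightarrow> u x = u 0 + primitive v x" by (rule acdD[OF uv])
  ultimately show ?thesis by (metis (mono_tags, lifting) continuous_on_cong)
qed

lemma continuous_times_integrable:
  fixes u v :: "real \<Rightarrow> complex"
  assumes "continuous_on {0..1} u" "integrable leb01 v"
  shows "integrable leb01 (\<lambda>x. u x * v x)"
proof -
  obtain B where B: "\<And>x. x \<in> {0..1} \<Longrightarrow> norm (u x) \<le> B"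
    using compact_imp_bounded[OF compact_continuous_image[OF assms(1) compact_Icc]]
    unfolding bounded_iff by (metis imageI)
  have um: "u \<in> borel_measurable leb01"
    using continuous_integrable_01[OF assms(1)] by auto
  show ?thesis
  proof (rule Bochner_Integration.integrable_bound[where f="\<lambda>x. of_real B * v x"])
    show "integrable leb01 (\<lambda>x. complex_of_real B * v x)" using assms(2) by auto
    show "AE x in leb01. norm (u x * v x) \<le> norm (complex_of_real B * v x)"
    proof (rule AE_I2)
      fix x assume "x \<in> space leb01"
      then have "norm (u x) \<le> B" using B by auto
      then show "norm (u x * v x) \<le> norm (complex_of_real B * v x)"
        by (simp add: norm_mult mult_right_mono)
    qed
  qed (use um assms(2) in auto)
qed

lemma acd_cong:
  assumes "acd u v" "\<And>x. x \<in> {0..1} \<Longrightarrow> u x = u' x" "aeq v v'" "v' \<in> borel_measurable leb01"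
  shows "acd u' v'"
  unfolding acd_def
proof (intro conjI ballI)
  have iv: "integrable leb01 v" using assms(1) by (rule acd_integrable)
  then show "integrable leb01 v'"
    using integrable_cong_AE[OF borel_measurable_integrable[OF iv] assms(4,3)] by simp
  fix x :: real assume x: "x \<in> {0..1}"
  have "u' x = u x" using assms(2)[OF x] ..
  also have "u x = u 0 + primitive v x" using assms(1) x unfolding acd_def by blast
  also have "primitive v x = primitive v' x"
    by (rule primitive_cong_AE[OF assms(3) borel_measurable_integrable[OF iv] assms(4) x])
  also have "u 0 = u' 0" by (rule assms(2)) simp
  finally show "u' x = u' 0 + primitive v' x" .
qed

lemma acd_unique:
  assumes "acd u v" "acd u w"
  shows "aeq v w"
proof -
  note i = acd_integrable[OF assms(1)] acd_integrable[OF assms(2)]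
  have "aeq (\<lambda>x. v x - w x) (\<lambda>_. 0)"
  proof (rule primitive_zero_AE)
    show "integrable leb01 (\<lambda>x. v x - w x)" using i by (rule Bochner_Integration.integrable_diff)
    fix x :: real assume x: "x \<in> {0..1}"
    have "u x = u 0 + primitive v x" "u x = u 0 + primitive w x"
      using assms x unfolding acd_def by blast+
    then have "primitive v x = primitive w x" by (metis add_left_cancel)
    then show "primitive (\<lambda>x. v x - w x) x = 0"
      unfolding primitive_def using i[THEN integrable_sub[OF _ x]] by simp
  qed
  then show ?thesis by simp
qed

lemma acdI:
  "integrable leb01 v \<Longrightarrow> (\<And>x. x \<in> {0..1} \<Longrightarrow> u x = c + primitive v x) \<Longrightarrow> acd u v"
proof -
  assume v: "integrable leb01 v" and u: "\<And>x. x \<in> {0..1} \<Longrightarrow> u x = c + primitive v x"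
  have "u 0 = c" using u[of 0] by simp
  then show ?thesis unfolding acd_def using u v by blast
qed

lemma acd_const: "acd (\<lambda>_. c) (\<lambda>_. 0)"
  by (rule acdI[where c=c]) (simp_all add: primitive_def)

lemma acd_add:
  assumes "acd u v" "acd u' v'"
  shows "acd (\<lambda>x. u x + u' x) (\<lambda>x. v x + v' x)"
proof (rule acdI[where c = "u 0 + u' 0"])
  note i = acd_integrable[OF assms(1)] acd_integrable[OF assms(2)]
  show "integrable leb01 (\<lambda>x. v x + v' x)" using i by simp
  show "u x + u' x = u 0 + u' 0 + primitive (\<lambda>x. v x + v' x) x" if "x \<in> {0..1}" for x
    using acdD[OF assms(1) that] acdD[OF assms(2) that] primitive_add[OF i that] by (simp add: algebra_simps)
qed

lemma acd_cmult:
  assumes "acd u v"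
  shows "acd (\<lambda>x. c * u x) (\<lambda>x. c * v x)"
proof (rule acdI[where c = "c * u 0"])
  note i = acd_integrable[OF assms(1)]
  show "integrable leb01 (\<lambda>x. c * v x)" using i by simp
  show "c * u x = c * u 0 + primitive (\<lambda>x. c * v x) x" if "x \<in> {0..1}" for x
    using acdD[OF assms(1) that] primitive_mult[OF i that] by (metis distrib_left)
qed

lemma acd_sum:
  assumes "\<And>i. i \<in> I \<Longrightarrow> acd (u i) (v i)"
  shows "acd (\<lambda>x. \<Sum>i\<in>I. u i x) (\<lambda>x. \<Sum>i\<in>I. v i x)"
  using assms
proof (induction I rule: infinite_finite_induct)
  case (insert i I)
  then show ?case by (auto intro!: acd_add)
qed (auto intro: acd_const)

lemma acd_primitive: "integrable leb01 v \<Longrightarrow> acd (\<lambda>x. c + primitive v x) v"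
  by (rule acdI) simp_all

lemma acd_zero_const:
  assumes "acd u v" "aeq v (\<lambda>_. 0)" "x \<in> {0..1}"
  shows "u x = u 0"
proof -
  have "primitive v x = primitive (\<lambda>_. 0) x"
    by (rule primitive_cong_AE[OF assms(2) _ _ assms(3)]) (use acd_integrable[OF assms(1)] in auto)
  then show ?thesis using acdD[OF assms(1,3)] by (simp add: primitive_def)
qed

text \<open>Fubini: the product of the primitives of u' and v' is the integral of u'(s) v'(t) over
  the square [0,x]^2, and the triangles on the two sides of the diagonal yield the two terms of the
  product rule.\<close>

lemma acd_mult:
  assumes "acd u u'" "acd v v'"
  shows "acd (\<lambda>x. u x * v x) (\<lambda>x. u' x * v x + u x * v' x)"
proof -
  note i = acd_integrable[OF assms(1)] acd_integrable[OF assms(2)]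
  have ci: "continuous_on {0..1} u" "continuous_on {0..1} v" using assms by (auto intro: acd_continuous)
  have i1: "integrable leb01 (\<lambda>x. u' x * v x)"
    using continuous_times_integrable[OF ci(2) i(1)] by (simp add: mult.commute)
  have i2: "integrable leb01 (\<lambda>x. u x * v' x)"
    using continuous_times_integrable[OF ci(1) i(2)] .
  have key: "u x * v x = u 0 * v 0 + primitive (\<lambda>x. u' x * v x + u x * v' x) x" if x: "x \<in> {0..1}" for x
  proof -
    define a where "a = (\<lambda>t. indicat_real {0..x} t *\<^sub>R u' t)"
    define b where "b = (\<lambda>t. indicat_real {0..x} t *\<^sub>R v' t)"
    have ia: "integrable leb01 a" unfolding a_def by (rule integrable_indicator_01) (use i x in auto)
    have ib: "integrable leb01 b" unfolding b_def by (rule integrable_indicator_01) (use i x in auto)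
    have sf: "sigma_finite_measure leb01"
      by (intro finite_measure.axioms finite_measure_lebesgue_on) auto
    have P: "pair_sigma_finite leb01 leb01"
      by (rule pair_sigma_finite.intro[OF sf sf])
    have [measurable]: "a \<in> borel_measurable leb01" "b \<in> borel_measurable leb01" using ia ib by auto
    define g where "g = (\<lambda>p. a (fst p) * b (snd p))"
    have gm: "g \<in> borel_measurable (leb01 \<Otimes>\<^sub>M leb01)" unfolding g_def by measurable
    have iab: "integrable (leb01 \<Otimes>\<^sub>M leb01) g"
    proof (rule pair_sigma_finite.Fubini_integrable[OF P gm])
      show "integrable leb01 (\<lambda>s. LINT t|leb01. norm (g (s, t)))"
        using ia by (simp add: norm_mult g_def)
      show "AE s in leb01. integrable leb01 (\<lambda>t. g (s, t))"
        using ib by (simp add: g_def)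
    qed
    have mid: "(\<lambda>t. t) \<in> borel_measurable leb01"
      using id_borel_measurable_lebesgue_on by (simp add: id_def)
    have lm: "{p \<in> space (leb01 \<Otimes>\<^sub>M leb01). snd p \<le> fst p} \<in> sets (leb01 \<Otimes>\<^sub>M leb01)"
      by (rule borel_measurable_le[OF measurable_compose[OF measurable_snd mid] measurable_compose[OF measurable_fst mid]])
    \<comment> \<open>\<open>h\<close> is carried by t <= s and gets integrated in t first;
      \<open>k\<close> is carried by s < t and gets integrated in s first.\<close>
    define h where "h = (\<lambda>p. if snd p \<le> fst p then g p else 0)"
    define k where "k = (\<lambda>p. if snd p \<le> fst p then 0 else g p)"
    have hm: "h \<in> borel_measurable (leb01 \<Otimes>\<^sub>M leb01)" "k \<in> borel_measurable (leb01 \<Otimes>\<^sub>M leb01)"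
      unfolding h_def k_def by (rule measurable_If[OF _ _ lm], use gm in simp_all)+
    have ih: "integrable (leb01 \<Otimes>\<^sub>M leb01) h"
      by (rule Bochner_Integration.integrable_bound[OF iab hm(1)]) (simp add: h_def)
    have ik: "integrable (leb01 \<Otimes>\<^sub>M leb01) k"
      by (rule Bochner_Integration.integrable_bound[OF iab hm(2)]) (simp add: k_def)
    have "primitive u' x = (LINT s|leb01. a s)" "primitive v' x = (LINT s|leb01. b s)"
      unfolding primitive_indicator[OF x] a_def b_def by (rule refl)+
    then have "primitive u' x * primitive v' x = (LINT s|leb01. LINT t|leb01. g (s, t))"
      by (simp add: g_def)
    also have "\<dots> = integral\<^sup>L (leb01 \<Otimes>\<^sub>M leb01) g"
      by (rule pair_sigma_finite.integral_fst'[OF P iab])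
    also have "\<dots> = integral\<^sup>L (leb01 \<Otimes>\<^sub>M leb01) (\<lambda>p. h p + k p)"
      by (rule arg_cong[where f="integral\<^sup>L (leb01 \<Otimes>\<^sub>M leb01)"]) (auto simp: h_def k_def)
    also have "\<dots> = integral\<^sup>L (leb01 \<Otimes>\<^sub>M leb01) h + integral\<^sup>L (leb01 \<Otimes>\<^sub>M leb01) k"
      by (rule Bochner_Integration.integral_add[OF ih ik])
    finally have pp0: "primitive u' x * primitive v' x = integral\<^sup>L (leb01 \<Otimes>\<^sub>M leb01) h + integral\<^sup>L (leb01 \<Otimes>\<^sub>M leb01) k" .
    have "integral\<^sup>L (leb01 \<Otimes>\<^sub>M leb01) h = (LINT s|leb01. LINT t|leb01. h (s, t))"
      by (rule pair_sigma_finite.integral_fst'[OF P ih, symmetric])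
    also have "\<dots> = (LINT s|leb01. indicat_real {0..x} s *\<^sub>R (u' s * primitive v' s))"
    proof (rule Bochner_Integration.integral_cong[OF refl])
      fix s assume "s \<in> space leb01"
      then have s: "s \<in> {0..1}" by simp
      have "(LINT t|leb01. h (s, t)) = (LINT t|leb01. indicat_real {0..x} s *\<^sub>R (u' s * (indicat_real {0..s} t *\<^sub>R v' t)))"
        by (rule Bochner_Integration.integral_cong[OF refl]) (use s in \<open>auto simp: h_def g_def a_def b_def indicator_def\<close>)
      then show "(LINT t|leb01. h (s, t)) = indicat_real {0..x} s *\<^sub>R (u' s * primitive v' s)"
        unfolding primitive_indicator[OF s]
        by (simp only: integral_scaleR_right integral_mult_right_zero)
    qed
    also have "\<dots> = primitive (\<lambda>s. u' s * primitive v' s) x"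
      by (rule primitive_indicator[OF x, symmetric])
    finally have ph: "integral\<^sup>L (leb01 \<Otimes>\<^sub>M leb01) h = primitive (\<lambda>s. u' s * primitive v' s) x" .
    have "integral\<^sup>L (leb01 \<Otimes>\<^sub>M leb01) k = (LINT t|leb01. LINT s|leb01. k (s, t))"
      using pair_sigma_finite.integral_snd[OF P, of "\<lambda>s t. k (s, t)"] ik by simp
    also have "\<dots> = (LINT t|leb01. indicat_real {0..x} t *\<^sub>R (primitive u' t * v' t))"
    proof (rule Bochner_Integration.integral_cong[OF refl])
      fix t assume "t \<in> space leb01"
      then have t: "t \<in> {0..1}" by simp
      \<comment> \<open>The diagonal belongs to \<open>h\<close>, whereas the primitive of
        \<open>u'\<close> runs up to t inclusive; the difference is one point.\<close>
      have n: "AE s in leb01. s \<noteq> t"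
        using AE_lborel_singleton[of t] by (simp add: AE_restrict_space_iff AE_completion_iff) (erule eventually_mono, simp)
      have "(LINT s|leb01. k (s, t)) = (LINT s|leb01. indicat_real {0..x} t *\<^sub>R ((indicat_real {0..t} s *\<^sub>R u' s) * v' t))"
      proof (rule integral_cong_AE)
        show "AE s in leb01. k (s, t) = indicat_real {0..x} t *\<^sub>R ((indicat_real {0..t} s *\<^sub>R u' s) * v' t)"
          using n AE_space by eventually_elim (use t in \<open>auto simp: k_def g_def a_def b_def indicator_def\<close>)
      next
        have "{s \<in> space leb01. t \<le> s} \<in> sets leb01"
          by (rule borel_measurable_le[OF _ mid]) simp
        then show "(\<lambda>s. k (s, t)) \<in> borel_measurable leb01"
          unfolding k_def g_def fst_conv snd_conv
          by (rule measurable_If[rotated 2]) simp_all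
        show "(\<lambda>s. indicat_real {0..x} t *\<^sub>R ((indicat_real {0..t} s *\<^sub>R u' s) * v' t)) \<in> borel_measurable leb01"
          by (intro borel_measurable_scaleR borel_measurable_times borel_measurable_const
              borel_measurable_integrable[OF integrable_indicator_01[OF i(1)]]) (use t in auto)
      qed
      then show "(LINT s|leb01. k (s, t)) = indicat_real {0..x} t *\<^sub>R (primitive u' t * v' t)"
        unfolding primitive_indicator[OF t]
        by (simp only: integral_scaleR_right integral_mult_left_zero)
    qed
    also have "\<dots> = primitive (\<lambda>s. primitive u' s * v' s) x"
      by (rule primitive_indicator[OF x, symmetric])
    finally have pp: "primitive u' x * primitive v' x = primitive (\<lambda>s. u' s * primitive v' s) x + primitive (\<lambda>s. primitive u' s * v' s) x"
      unfolding pp0 ph by simp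
    have j: "integrable leb01 (\<lambda>s. u' s * primitive v' s)" "integrable leb01 (\<lambda>s. primitive u' s * v' s)"
      using continuous_times_integrable[OF continuous_primitive i(1)] continuous_times_integrable[OF continuous_primitive i(2)] i
      by (auto simp: mult.commute)
    have uv: "u t = u 0 + primitive u' t" "v t = v 0 + primitive v' t" if "t \<in> {0..1}" for t
      using acdD[OF assms(1) that] acdD[OF assms(2) that] by auto
    have "primitive (\<lambda>x. u' x * v x + u x * v' x) x
      = primitive (\<lambda>s. (v 0 * u' s + u' s * primitive v' s) + (u 0 * v' s + primitive u' s * v' s)) x"
    proof (rule primitive_cong)
      fix t assume "t \<in> {0..x}"
      then have "t \<in> {0..1}" using x by auto
      then show "u' t * v t + u t * v' t = v 0 * u' t + u' t * primitive v' t + (u 0 * v' t + primitive u' t * v' t)"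
        unfolding uv[OF \<open>t \<in> {0..1}\<close>] by (simp add: algebra_simps)
    qed
    also have "\<dots> = v 0 * primitive u' x + primitive (\<lambda>s. u' s * primitive v' s) x + (u 0 * primitive v' x + primitive (\<lambda>s. primitive u' s * v' s) x)"
      using i j x by (simp add: primitive_add primitive_mult)
    also have "\<dots> = v 0 * primitive u' x + u 0 * primitive v' x + primitive u' x * primitive v' x"
      by (simp add: pp)
    finally show ?thesis unfolding uv[OF x] by (simp add: algebra_simps)
  qed
  then show ?thesis by (rule acdI[OF Bochner_Integration.integrable_add[OF i1 i2]])
qed

section \<open>Linear systems with integrable coefficients\<close>

lemma acd_power:
  assumes "acd u v"
  shows "acd (\<lambda>x. u x ^ Suc r) (\<lambda>x. of_nat (Suc r) * (u x ^ r * v x))"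
proof (induction r)
  case 0
  then show ?case using assms by simp
next
  case (Suc r)
  have "acd (\<lambda>x. u x * u x ^ Suc r) (\<lambda>x. v x * u x ^ Suc r + u x * (of_nat (Suc r) * (u x ^ r * v x)))"
    by (rule acd_mult[OF assms Suc])
  moreover have "(\<lambda>x. v x * u x ^ Suc r + u x * (of_nat (Suc r) * (u x ^ r * v x)))
      = (\<lambda>x. of_nat (Suc (Suc r)) * (u x ^ Suc r * v x))"
    by (rule ext) (simp add: algebra_simps)
  ultimately show ?case by simp
qed

lemma primitive_of_real:
  "primitive (\<lambda>t. complex_of_real (h t)) x = complex_of_real (LINT t|lebesgue_on {0..x}. h t)"
  by (simp add: primitive_def)

text \<open>Since \<open>a\<close> is the derivative of \<open>\<alpha>\<close>, the majorant a
  \<alpha>^r / r! is the derivative of \<alpha>^(r+1) / (r+1)!. The factorial decay of the Picard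
  terms thus needs only integrable coefficients.\<close>

lemma primitive_power_bound:
  fixes a :: "real \<Rightarrow> real" and C :: real
  defines "\<alpha> \<equiv> \<lambda>x. LINT t|lebesgue_on {0..x}. a t"
  assumes a: "integrable leb01 a" and g: "integrable leb01 g"
    and le: "\<And>t. t \<in> {0..1} \<Longrightarrow> norm (g t) \<le> a t * (C * \<alpha> t ^ r / fact r)"
    and x: "x \<in> {0..1}"
  shows "norm (primitive g x) \<le> C * \<alpha> x ^ Suc r / fact (Suc r)"
proof -
  have ac: "acd (\<lambda>x. complex_of_real (\<alpha> x)) (\<lambda>x. complex_of_real (a x))"
    using acd_primitive[of "\<lambda>x. complex_of_real (a x)" 0] a
    by (simp add: primitive_of_real \<alpha>_def)
  define h where "h = (\<lambda>t. C / fact (Suc r) * (real (Suc r) * (\<alpha> t ^ r * a t)))"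
  have hc: "acd (\<lambda>x. of_real (C / fact (Suc r)) * complex_of_real (\<alpha> x) ^ Suc r) (\<lambda>t. complex_of_real (h t))"
    using acd_cmult[OF acd_power[OF ac, of r], of "of_real (C / fact (Suc r))"]
    unfolding h_def of_real_mult of_real_power of_real_of_nat_eq .
  have h0: "\<alpha> 0 = 0"
    using primitive_0[of "\<lambda>t. complex_of_real (a t)"] by (simp add: primitive_of_real \<alpha>_def)
  have "complex_of_real (C / fact (Suc r) * \<alpha> x ^ Suc r) = primitive (\<lambda>t. complex_of_real (h t)) x"
    using acdD[OF hc x] h0 by (simp del: fact_Suc)
  then have e: "(LINT t|lebesgue_on {0..x}. h t) = C / fact (Suc r) * \<alpha> x ^ Suc r"
    unfolding primitive_of_real of_real_eq_iff by (rule sym)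
  have hi: "integrable leb01 h"
    using acd_integrable[OF hc] by (simp only: complex_of_real_integrable_eq)
  then have hi': "integrable (lebesgue_on {0..x}) h"
    using integrable_sub[of "\<lambda>t. complex_of_real (h t)" x] x
    unfolding complex_of_real_integrable_eq by simp
  have "norm (primitive g x) \<le> (LINT t|lebesgue_on {0..x}. norm (g t))"
    unfolding primitive_def by (rule integral_norm_bound)
  also have "\<dots> \<le> (LINT t|lebesgue_on {0..x}. h t)"
  proof (rule integral_mono[OF _ hi'])
    show "integrable (lebesgue_on {0..x}) (\<lambda>t. norm (g t))"
      using integrable_sub[OF g x] by simp
    fix t assume "t \<in> space (lebesgue_on {0..x})"
    then have "norm (g t) \<le> a t * (C * \<alpha> t ^ r / fact r)" using x by (intro le) auto
    also have "\<dots> = h t" by (simp add: h_def fact_Suc del: of_nat_Suc)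
    finally show "norm (g t) \<le> h t" .
  qed
  also have "\<dots> = C * \<alpha> x ^ Suc r / fact (Suc r)" unfolding e by (simp del: fact_Suc)
  finally show ?thesis .
qed

text \<open>The r-th term of the Neumann series of the integral equation, not the r-th Picard
  iterate; the iterates are the partial sums.\<close>

primrec picard :: "nat \<Rightarrow> (nat \<Rightarrow> nat \<Rightarrow> real \<Rightarrow> complex) \<Rightarrow> (nat \<Rightarrow> complex) \<Rightarrow> nat \<Rightarrow> nat \<Rightarrow> real \<Rightarrow> complex" where
  "picard n A c 0 = (\<lambda>k x. c k)"
| "picard n A c (Suc r) = (\<lambda>k. primitive (\<lambda>t. \<Sum>j<n. A k j t * picard n A c r j t))"

text \<open>With \<open>a\<close> the sum of all coefficient norms and \<open>\<alpha>\<close> its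
  primitive, the r-th term is bounded by C \<alpha>^r / r!. The series converges, and its partial
  sums satisfy the integral equation with the index shifted by one, which passes to the limit by
  dominated convergence.\<close>

lemma linear_ode_exists:
  fixes A :: "nat \<Rightarrow> nat \<Rightarrow> real \<Rightarrow> complex" and c :: "nat \<Rightarrow> complex"
  assumes A: "\<And>k j. k < n \<Longrightarrow> j < n \<Longrightarrow> integrable leb01 (A k j)"
  obtains Y where "\<And>k. k < n \<Longrightarrow> acd (Y k) (\<lambda>x. \<Sum>j<n. A k j x * Y j x)" "\<And>k. k < n \<Longrightarrow> Y k 0 = c k"
proof -
  let ?T = "picard n A c"
  define g where "g = (\<lambda>r k t. \<Sum>j<n. A k j t * ?T r j t)"
  have both: "continuous_on {0..1} (?T r k) \<and> integrable leb01 (g r k)" if "k < n" for r k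
    using that
  proof (induction r arbitrary: k)
    case 0
    have "integrable leb01 (g 0 k)" unfolding g_def
      by (intro Bochner_Integration.integrable_sum) (simp add: A 0)
    then show ?case by simp
  next
    case (Suc r)
    have c: "continuous_on {0..1} (?T (Suc r) k)" if "k < n" for k
      using continuous_primitive[of "g r k"] Suc.IH[OF that] by (simp add: g_def)
    have "integrable leb01 (g (Suc r) k)" unfolding g_def
    proof (intro Bochner_Integration.integrable_sum)
      fix j assume "j \<in> {..<n}"
      then show "integrable leb01 (\<lambda>t. A k j t * ?T (Suc r) j t)"
        using continuous_times_integrable[OF c A, of j k j] Suc.prems by (simp add: mult.commute)
    qed
    then show ?case using c[OF Suc.prems] by simp
  qed
  define a where "a = (\<lambda>t. \<Sum>k<n. \<Sum>j<n. norm (A k j t))"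
  have ai: "integrable leb01 a" unfolding a_def
    by (intro Bochner_Integration.integrable_sum integrable_norm A) auto
  have a0: "0 \<le> a t" for t unfolding a_def by (intro sum_nonneg) auto
  have ak: "(\<Sum>j<n. norm (A k j t)) \<le> a t" if "k < n" for k t
    unfolding a_def using that by (intro member_le_sum) (auto intro: sum_nonneg)
  define \<alpha> where "\<alpha> = (\<lambda>x. LINT t|lebesgue_on {0..x}. a t)"
  have \<alpha>0: "0 \<le> \<alpha> x" for x unfolding \<alpha>_def by (simp add: a0)
  have \<alpha>1: "\<alpha> x \<le> \<alpha> 1" if "x \<in> {0..1}" for x
    unfolding \<alpha>_def by (rule integral_mono_lebesgue_on_AE) (use that ai a0 in auto)
  define C where "C = (\<Sum>k<n. norm (c k))"
  have C0: "0 \<le> C" unfolding C_def by (intro sum_nonneg) auto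
  have Tb: "norm (?T r k x) \<le> C * \<alpha> x ^ r / fact r" if "k < n" "x \<in> {0..1}" for r k x
    using that
  proof (induction r arbitrary: k x)
    case 0
    then show ?case unfolding C_def by (auto intro: member_le_sum)
  next
    case (Suc r)
    have "norm (primitive (g r k) x) \<le> C * \<alpha> x ^ Suc r / fact (Suc r)"
      unfolding \<alpha>_def
    proof (rule primitive_power_bound[OF ai])
      show "integrable leb01 (g r k)" using both Suc by auto
      show "x \<in> {0..1}" by fact
      fix t :: real assume t: "t \<in> {0..1}"
      have "norm (g r k t) \<le> (\<Sum>j<n. norm (A k j t) * norm (?T r j t))"
        unfolding g_def by (rule order_trans[OF norm_sum]) (simp add: norm_mult)
      also have "\<dots> \<le> (\<Sum>j<n. norm (A k j t) * (C * \<alpha> t ^ r / fact r))"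
        by (intro sum_mono mult_left_mono Suc.IH) (use t in auto)
      also have "\<dots> = (\<Sum>j<n. norm (A k j t)) * (C * \<alpha> t ^ r / fact r)"
        by (rule sum_distrib_right[symmetric])
      also have "\<dots> \<le> a t * (C * \<alpha> t ^ r / fact r)"
        by (intro mult_right_mono ak Suc.prems) (use C0 \<alpha>0 in auto)
      finally show "norm (g r k t) \<le> a t * (C * (LINT t|lebesgue_on {0..t}. a t) ^ r / fact r)"
        unfolding \<alpha>_def .
    qed
    then show ?case by (simp add: g_def)
  qed
  define b where "b = (\<lambda>r. C * (\<alpha> 1 ^ r / fact r))"
  have bs: "summable b" unfolding b_def
    by (intro summable_mult) (use summable_exp_generic[of "\<alpha> 1"] in \<open>simp add: divide_inverse mult.commute\<close>)
  have Tb': "norm (?T r k x) \<le> b r" if "k < n" "x \<in> {0..1}" for r k x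
  proof -
    have "C * \<alpha> x ^ r / fact r \<le> C * \<alpha> 1 ^ r / fact r"
      by (intro divide_right_mono mult_left_mono power_mono \<alpha>1 \<alpha>0 C0 that) auto
    then show ?thesis using Tb[OF that, of r] unfolding b_def by simp
  qed
  define Y where "Y = (\<lambda>k x. \<Sum>r. ?T r k x)"
  define S where "S = (\<lambda>R k x. \<Sum>r<R. ?T r k x)"
  have SY: "(\<lambda>R. S R k x) \<longlonglongrightarrow> Y k x" if "k < n" "x \<in> {0..1}" for k x
    unfolding S_def Y_def
    by (rule summable_LIMSEQ) (rule summable_comparison_test'[OF bs Tb'[OF that]])
  have Sb: "norm (S R k x) \<le> suminf b" if "k < n" "x \<in> {0..1}" for R k x
  proof -
    have "norm (S R k x) \<le> (\<Sum>r<R. b r)" unfolding S_def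
      by (rule order_trans[OF norm_sum]) (intro sum_mono Tb' that)
    also have "\<dots> \<le> suminf b"
      by (rule sum_le_suminf[OF bs]) (use C0 \<alpha>0 in \<open>auto simp: b_def\<close>)
    finally show ?thesis .
  qed
  define G where "G = (\<lambda>R k t. \<Sum>r<R. g r k t)"
  have GS: "G R k t = (\<Sum>j<n. A k j t * S R j t)" for R k t
    unfolding G_def S_def g_def by (subst sum.swap) (simp add: sum_distrib_left)
  have SG: "S (Suc R) k x = c k + primitive (G R k) x" if "k < n" "x \<in> {0..1}" for R k x
  proof -
    have "primitive (G R k) x = (\<Sum>r<R. primitive (g r k) x)"
      unfolding primitive_def G_def
      by (rule Bochner_Integration.integral_sum) (use integrable_sub both that in auto)
    moreover have "?T (Suc r) k x = primitive (g r k) x" for r by (simp add: g_def)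
    ultimately show ?thesis unfolding S_def sum.lessThan_Suc_shift by simp
  qed
  have lim: "integrable (lebesgue_on {0..x}) (\<lambda>t. \<Sum>j<n. A k j t * Y j t) \<and>
      (\<lambda>R. primitive (G R k) x) \<longlonglongrightarrow> primitive (\<lambda>t. \<Sum>j<n. A k j t * Y j t) x"
    if k: "k < n" and x: "x \<in> {0..1}" for k x
  proof -
    have Gi: "integrable (lebesgue_on {0..x}) (G R k)" for R
      unfolding G_def by (intro Bochner_Integration.integrable_sum integrable_sub[OF _ x]) (use both k in auto)
    have lp: "(\<lambda>R. G R k t) \<longlonglongrightarrow> (\<Sum>j<n. A k j t * Y j t)" if "t \<in> {0..x}" for t
      unfolding GS by (intro tendsto_sum tendsto_mult tendsto_const SY) (use that x in auto)
    have m: "(\<lambda>t. \<Sum>j<n. A k j t * Y j t) \<in> borel_measurable (lebesgue_on {0..x})"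
    proof (rule borel_measurable_LIMSEQ_metric[OF borel_measurable_integrable[OF Gi]])
      show "(\<lambda>R. G R k t) \<longlonglongrightarrow> (\<Sum>j<n. A k j t * Y j t)" if "t \<in> space (lebesgue_on {0..x})" for t
        by (rule lp) (use that in simp)
    qed
    \<comment> \<open>All partial sums are bounded by \<open>suminf b\<close>, so this multiple of
      \<open>a\<close> dominates all the integrands \<open>G R k\<close>.\<close>
    have w: "integrable (lebesgue_on {0..x}) (\<lambda>t. norm (of_real (suminf b) * complex_of_real (a t)))"
      by (intro integrable_norm integrable_mult_right integrable_sub[OF _ x]) (use ai in auto)
    have bd: "AE t in lebesgue_on {0..x}. norm (G R k t) \<le> norm (of_real (suminf b) * complex_of_real (a t))" for R
    proof (rule AE_I2)
      fix t assume "t \<in> space (lebesgue_on {0..x})"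
      then have t: "t \<in> {0..1}" using x by auto
      have "norm (G R k t) \<le> (\<Sum>j<n. norm (A k j t) * norm (S R j t))"
        unfolding GS by (rule order_trans[OF norm_sum]) (simp add: norm_mult)
      also have "\<dots> \<le> (\<Sum>j<n. norm (A k j t) * suminf b)"
        by (intro sum_mono mult_left_mono Sb) (use t in auto)
      also have "\<dots> = (\<Sum>j<n. norm (A k j t)) * suminf b" by (rule sum_distrib_right[symmetric])
      also have "\<dots> \<le> a t * suminf b"
        by (intro mult_right_mono ak k suminf_nonneg[OF bs]) (use C0 \<alpha>0 in \<open>auto simp: b_def\<close>)
      also have "\<dots> \<le> norm (of_real (suminf b) * complex_of_real (a t))"
        unfolding of_real_mult[symmetric] norm_of_real mult.commute[of "a t"] by (rule abs_ge_self)
      finally show "norm (G R k t) \<le> norm (of_real (suminf b) * complex_of_real (a t))" .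
    qed
    have lpAE: "AE t in lebesgue_on {0..x}. (\<lambda>R. G R k t) \<longlonglongrightarrow> (\<Sum>j<n. A k j t * Y j t)"
      by (rule AE_I2) (use lp in auto)
    note Gm = borel_measurable_integrable[OF Gi]
    show ?thesis unfolding primitive_def
      using integrable_dominated_convergence[OF m Gm w lpAE bd] integral_dominated_convergence[OF m Gm w lpAE bd]
      by (rule conjI)
  qed
  show ?thesis
  proof (rule that[of Y])
    fix k assume k: "k < n"
    have e: "Y k x = c k + primitive (\<lambda>t. \<Sum>j<n. A k j t * Y j t) x" if "x \<in> {0..1}" for x
    proof (rule LIMSEQ_unique)
      show "(\<lambda>R. S (Suc R) k x) \<longlonglongrightarrow> Y k x" using SY[OF k that] by (rule LIMSEQ_Suc)
      show "(\<lambda>R. S (Suc R) k x) \<longlonglongrightarrow> c k + primitive (\<lambda>t. \<Sum>j<n. A k j t * Y j t) x"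
        unfolding SG[OF k that] by (intro tendsto_add tendsto_const) (rule lim[OF k that, THEN conjunct2])
    qed
    show "acd (Y k) (\<lambda>x. \<Sum>j<n. A k j x * Y j x)"
      by (rule acdI[OF _ e]) (rule lim[OF k, of 1, simplified, THEN conjunct1])
    show "Y k 0 = c k" using e[of 0] by simp
  qed
qed

lemma sum_delta_left:
  fixes j n :: nat
  shows "j < n \<Longrightarrow> (\<Sum>l<n. (if l = j then 1 else 0) * f l) = (f j :: complex)"
  by (subst sum.mono_neutral_right[of "{..<n}" "{j}"]) auto

lemma matrix_left_right_inverse:
  fixes C D :: "nat \<Rightarrow> nat \<Rightarrow> complex"
  assumes "\<And>i j. i < n \<Longrightarrow> j < n \<Longrightarrow> (\<Sum>l<n. D i l * C l j) = (if i = j then 1 else 0)"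
    and "i < n" "j < n"
  shows "(\<Sum>l<n. C i l * D l j) = (if i = j then 1 else 0)"
proof -
  define MC where "MC = mat n n (\<lambda>(i, j). C i j)"
  define MD where "MD = mat n n (\<lambda>(i, j). D i j)"
  have "MD * MC = 1\<^sub>m n"
    by (rule eq_matI) (use assms(1) in \<open>auto simp: MC_def MD_def scalar_prod_def atLeast0LessThan\<close>)
  then have "MC * MD = 1\<^sub>m n"
    by (rule mat_mult_left_right_inverse[rotated 2]) (auto simp: MC_def MD_def)
  then have "(MC * MD) $$ (i, j) = 1\<^sub>m n $$ (i, j)" by simp
  then show ?thesis using assms(2,3)
    by (simp add: MC_def MD_def scalar_prod_def atLeast0LessThan)
qed

text \<open>Lagrange's identity: the row vector \<open>D\<close> solves D' = -DA, so the derivative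
  of DY is -DAY + DAY = 0.\<close>

lemma adjoint_pairing:
  fixes A :: "nat \<Rightarrow> nat \<Rightarrow> real \<Rightarrow> complex" and D Y :: "nat \<Rightarrow> real \<Rightarrow> complex"
  assumes D: "\<And>l. l < n \<Longrightarrow> acd (D l) (\<lambda>x. \<Sum>p<n. - A p l x * D p x)"
    and Y: "\<And>l. l < n \<Longrightarrow> acd (Y l) (\<lambda>x. \<Sum>p<n. A l p x * Y p x)" and x: "x \<in> {0..1}"
  shows "(\<Sum>l<n. D l x * Y l x) = (\<Sum>l<n. D l 0 * Y l 0)"
proof -
  have "acd (\<lambda>x. \<Sum>l<n. D l x * Y l x)
     (\<lambda>x. \<Sum>l<n. (\<Sum>p<n. - A p l x * D p x) * Y l x + D l x * (\<Sum>p<n. A l p x * Y p x))"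
    by (rule acd_sum, rule acd_mult) (use D Y in auto)
  moreover have "(\<Sum>l<n. (\<Sum>p<n. - A p l x * D p x) * Y l x + D l x * (\<Sum>p<n. A l p x * Y p x)) = 0" for x
  proof -
    have "(\<Sum>l<n. (\<Sum>p<n. - A p l x * D p x) * Y l x) = (\<Sum>p<n. \<Sum>l<n. - A p l x * D p x * Y l x)"
      by (subst sum.swap) (simp add: sum_distrib_right)
    also have "\<dots> = - (\<Sum>l<n. D l x * (\<Sum>p<n. A l p x * Y p x))"
      by (simp add: sum_distrib_left sum_negf algebra_simps)
    finally show ?thesis by (simp add: sum.distrib)
  qed
  ultimately have "acd (\<lambda>x. \<Sum>l<n. D l x * Y l x) (\<lambda>_. 0)" by simp
  then show ?thesis using acd_zero_const[OF _ _ x] by blast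
qed

text \<open>The inverse is not computed from \<open>C\<close>. It is the solution \<open>D\<close>
  of the adjoint system, absolutely continuous with a known derivative by construction, and DC keeps
  its initial value I.\<close>

lemma fundamental_matrix:
  fixes A :: "nat \<Rightarrow> nat \<Rightarrow> real \<Rightarrow> complex"
  assumes A: "\<And>k j. k < n \<Longrightarrow> j < n \<Longrightarrow> integrable leb01 (A k j)"
  obtains C D where
    "\<And>i j. i < n \<Longrightarrow> j < n \<Longrightarrow> acd (C i j) (\<lambda>x. \<Sum>l<n. A i l x * C l j x)"
    "\<And>i j. i < n \<Longrightarrow> j < n \<Longrightarrow> C i j 0 = (if i = j then 1 else 0)"
    "\<And>i j. i < n \<Longrightarrow> j < n \<Longrightarrow> acd (D i j) (\<lambda>x. \<Sum>l<n. - A l j x * D i l x)"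
    "\<And>i j. i < n \<Longrightarrow> j < n \<Longrightarrow> D i j 0 = (if i = j then 1 else 0)"
    "\<And>i j x. i < n \<Longrightarrow> j < n \<Longrightarrow> x \<in> {0..1} \<Longrightarrow> (\<Sum>l<n. C i l x * D l j x) = (if i = j then 1 else 0)"
proof -
  have "\<exists>Y. \<forall>k<n. acd (Y k) (\<lambda>x. \<Sum>l<n. A k l x * Y l x) \<and> Y k 0 = (if k = j then 1 else 0)" for j
    by (rule linear_ode_exists[of n A "\<lambda>k. if k = j then 1 else 0"]) (use A in blast)+
  then have "\<forall>j. \<exists>Y. \<forall>k<n. acd (Y k) (\<lambda>x. \<Sum>l<n. A k l x * Y l x) \<and> Y k 0 = (if k = j then 1 else 0)" by (rule allI)
  from choice[OF this] obtain Cf where Cf': "\<forall>j. \<forall>k<n. acd (Cf j k) (\<lambda>x. \<Sum>l<n. A k l x * Cf j l x) \<and> Cf j k 0 = (if k = j then 1 else 0)"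
    by blast
  have Cf: "\<And>j k. k < n \<Longrightarrow> acd (Cf j k) (\<lambda>x. \<Sum>l<n. A k l x * Cf j l x)"
      "\<And>j k. k < n \<Longrightarrow> Cf j k 0 = (if k = j then 1 else 0)" using Cf' by blast+
  have "\<exists>Y. \<forall>k<n. acd (Y k) (\<lambda>x. \<Sum>l<n. - A l k x * Y l x) \<and> Y k 0 = (if k = j then 1 else 0)" for j
    by (rule linear_ode_exists[of n "\<lambda>k l x. - A l k x" "\<lambda>k. if k = j then 1 else 0"])
      (use A in \<open>blast intro: Bochner_Integration.integrable_minus\<close>)+
  then have "\<forall>j. \<exists>Y. \<forall>k<n. acd (Y k) (\<lambda>x. \<Sum>l<n. - A l k x * Y l x) \<and> Y k 0 = (if k = j then 1 else 0)" by (rule allI)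
  from choice[OF this] obtain D where D': "\<forall>j. \<forall>k<n. acd (D j k) (\<lambda>x. \<Sum>l<n. - A l k x * D j l x) \<and> D j k 0 = (if k = j then 1 else 0)"
    by blast
  have D: "\<And>j k. k < n \<Longrightarrow> acd (D j k) (\<lambda>x. \<Sum>l<n. - A l k x * D j l x)"
      "\<And>j k. k < n \<Longrightarrow> D j k 0 = (if k = j then 1 else 0)" using D' by blast+
  define C where "C = (\<lambda>i j. Cf j i)"
  have DC: "(\<Sum>l<n. D i l x * C l j x) = (if i = j then 1 else 0)" if ij: "i < n" "j < n" and x: "x \<in> {0..1}" for i j x
  proof -
    have "(\<Sum>l<n. D i l x * C l j x) = (\<Sum>l<n. D i l 0 * C l j 0)"
      unfolding C_def by (rule adjoint_pairing[OF D(1) Cf(1) x])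
    also have "\<dots> = (\<Sum>l<n. (if l = i then 1 else 0) * C l j 0)"
      by (intro sum.cong) (use D in auto)
    also have "\<dots> = C i j 0" by (rule sum_delta_left[OF ij(1)])
    also have "\<dots> = (if i = j then 1 else 0)" using Cf(2) ij by (simp add: C_def)
    finally show ?thesis .
  qed
  show ?thesis
  proof (rule that[of C D])
    fix i j x assume ij: "i < n" "j < n" and x: "x \<in> {0..1::real}"
    show "(\<Sum>l<n. C i l x * D l j x) = (if i = j then 1 else 0)"
      by (rule matrix_left_right_inverse[OF DC[OF _ _ x] ij])
  next
    fix i j assume ij: "i < n" "j < n"
    show "D i j 0 = (if i = j then 1 else 0)" using D(2)[OF ij(2), of i] by (simp add: eq_commute)
    show "acd (D i j) (\<lambda>x. \<Sum>l<n. - A l j x * D i l x)" by (rule D(1)[OF ij(2)])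
    show "acd (C i j) (\<lambda>x. \<Sum>l<n. A i l x * C l j x)" unfolding C_def by (rule Cf(1)[OF ij(1)])
    show "C i j 0 = (if i = j then 1 else 0)" unfolding C_def by (rule Cf(2)[OF ij(1)])
  qed
qed

text \<open>The coordinates DY of a solution with respect to the fundamental matrix are constant, so
  the values at 0 determine them.\<close>

lemma linear_ode_unique:
  fixes A :: "nat \<Rightarrow> nat \<Rightarrow> real \<Rightarrow> complex" and Y Z :: "nat \<Rightarrow> real \<Rightarrow> complex"
  assumes A: "\<And>k j. k < n \<Longrightarrow> j < n \<Longrightarrow> integrable leb01 (A k j)"
    and Y: "\<And>k. k < n \<Longrightarrow> acd (Y k) (\<lambda>x. \<Sum>j<n. A k j x * Y j x)"
    and Z: "\<And>k. k < n \<Longrightarrow> acd (Z k) (\<lambda>x. \<Sum>j<n. A k j x * Z j x)"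
    and YZ: "\<And>k. k < n \<Longrightarrow> Y k 0 = Z k 0" and k: "k < n" and x: "x \<in> {0..1}"
  shows "Y k x = Z k x"
proof -
  obtain C D where
    "\<And>i j. i < n \<Longrightarrow> j < n \<Longrightarrow> acd (C i j) (\<lambda>x. \<Sum>l<n. A i l x * C l j x)"
    "\<And>i j. i < n \<Longrightarrow> j < n \<Longrightarrow> C i j 0 = (if i = j then 1 else 0)"
    and CD1: "\<And>i j. i < n \<Longrightarrow> j < n \<Longrightarrow> acd (D i j) (\<lambda>x. \<Sum>l<n. - A l j x * D i l x)"
    and "\<And>i j. i < n \<Longrightarrow> j < n \<Longrightarrow> D i j 0 = (if i = j then 1 else 0)"
    and CD2: "\<And>i j x. i < n \<Longrightarrow> j < n \<Longrightarrow> x \<in> {0..1} \<Longrightarrow> (\<Sum>l<n. C i l x * D l j x) = (if i = j then 1 else 0)"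
    by (rule fundamental_matrix[of n A, OF A]) (assumption+, rule that, assumption+)
  note CD = CD1 CD2[OF _ _ x]
  have rec: "Y k x = (\<Sum>i<n. C k i x * (\<Sum>l<n. D i l x * Y l x))" for Y :: "nat \<Rightarrow> real \<Rightarrow> complex"
  proof -
    have "(\<Sum>i<n. C k i x * (\<Sum>l<n. D i l x * Y l x)) = (\<Sum>l<n. (\<Sum>i<n. C k i x * D i l x) * Y l x)"
      by (simp add: sum_distrib_left sum_distrib_right mult.assoc) (rule sum.swap)
    also have "\<dots> = (\<Sum>l<n. (if l = k then 1 else 0) * Y l x)"
      by (intro sum.cong) (use CD(2) k in auto)
    also have "\<dots> = Y k x" by (rule sum_delta_left[OF k])
    finally show ?thesis by simp
  qed
  have "(\<Sum>l<n. D i l x * Y l x) = (\<Sum>l<n. D i l x * Z l x)" if "i < n" for i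
  proof -
    have "(\<Sum>l<n. D i l x * Y l x) = (\<Sum>l<n. D i l 0 * Y l 0)" by (rule adjoint_pairing[OF CD(1)[OF that] Y x])
    also have "\<dots> = (\<Sum>l<n. D i l 0 * Z l 0)" by (intro sum.cong refl) (use YZ in auto)
    also have "\<dots> = (\<Sum>l<n. D i l x * Z l x)" by (rule adjoint_pairing[OF CD(1)[OF that] Z x, symmetric])
    finally show ?thesis .
  qed
  then have "(\<Sum>i<n. C k i x * (\<Sum>l<n. D i l x * Y l x)) = (\<Sum>i<n. C k i x * (\<Sum>l<n. D i l x * Z l x))"
    by (intro sum.cong) auto
  then show ?thesis using rec[of Y] rec[of Z] by (simp only:)
qed

section \<open>Test functions and distributional derivatives\<close>

text \<open>Order 0 already means differentiable, so order k asks for k + 1 derivatives. The finite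
  order allows induction for products and affine substitutions.\<close>

definition smooth_upto :: "nat \<Rightarrow> (real \<Rightarrow> complex) \<Rightarrow> bool" where
  "smooth_upto k u \<longleftrightarrow> (\<forall>j\<le>k. \<forall>x. (cderiv ^^ j) u differentiable (at x))"

lemma smooth_upto_0: "smooth_upto 0 u \<longleftrightarrow> (\<forall>x. u differentiable (at x))"
  by (simp add: smooth_upto_def)

lemma smooth_upto_Suc:
  "smooth_upto (Suc k) u \<longleftrightarrow> (\<forall>x. u differentiable (at x)) \<and> smooth_upto k (cderiv u)"
  unfolding smooth_upto_def
proof (intro iffI conjI allI impI; (elim conjE)?)
  fix j x assume a: "\<forall>j\<le>Suc k. \<forall>x. (cderiv ^^ j) u differentiable at x"
  show "u differentiable at x" using a[rule_format, of 0 x] by simp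
  show "(cderiv ^^ j) (cderiv u) differentiable at x" if "j \<le> k"
    using a[rule_format, of "Suc j" x] that by (simp add: funpow_swap1)
next
  fix j x assume a: "j \<le> Suc k" "\<forall>x. u differentiable at x"
    "\<forall>j\<le>k. \<forall>x. (cderiv ^^ j) (cderiv u) differentiable at x"
  then show "(cderiv ^^ j) u differentiable at x"
    by (cases j) (auto simp: funpow_swap1)
qed

lemma smooth_upto_le: "smooth_upto k u \<Longrightarrow> j \<le> k \<Longrightarrow> smooth_upto j u"
  by (simp add: smooth_upto_def)

lemma cderivI: "(\<And>x. (u has_vector_derivative v x) (at x)) \<Longrightarrow> cderiv u = v"
  by (rule ext) (simp add: cderiv_def vector_derivative_at)

lemma has_cderiv: "u differentiable (at x) \<Longrightarrow> (u has_vector_derivative cderiv u x) (at x)"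
  by (simp add: cderiv_def vector_derivative_works)

lemma smooth_uptoI:
  assumes "\<And>x. (u has_vector_derivative v x) (at x)" "smooth_upto k v"
  shows "smooth_upto (Suc k) u"
  using assms cderivI[of u v] by (auto simp: smooth_upto_Suc intro: differentiableI_vector)

lemma smooth_uptoD:
  assumes "smooth_upto (Suc k) u"
  shows "(u has_vector_derivative cderiv u x) (at x)" "smooth_upto k (cderiv u)"
  using assms by (auto simp: smooth_upto_Suc intro: has_cderiv)

lemma smooth_upto_add: "smooth_upto k u \<Longrightarrow> smooth_upto k v \<Longrightarrow> smooth_upto k (\<lambda>x. u x + v x)"
proof (induction k arbitrary: u v)
  case (Suc k)
  note u = smooth_uptoD[OF Suc.prems(1)] and v = smooth_uptoD[OF Suc.prems(2)]
  show ?case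
    by (rule smooth_uptoI[OF has_vector_derivative_add[OF u(1) v(1)] Suc.IH[OF u(2) v(2)]])
qed (auto simp: smooth_upto_0)

lemma smooth_upto_mult: "smooth_upto k u \<Longrightarrow> smooth_upto k v \<Longrightarrow> smooth_upto k (\<lambda>x. u x * v x)"
proof (induction k arbitrary: u v)
  case (Suc k)
  note u = smooth_uptoD[OF Suc.prems(1)] and v = smooth_uptoD[OF Suc.prems(2)]
  have "smooth_upto k u" "smooth_upto k v" using Suc.prems by (auto elim: smooth_upto_le)
  then have "smooth_upto k (\<lambda>x. u x * cderiv v x + cderiv u x * v x)"
    by (intro smooth_upto_add Suc.IH u v)
  then show ?case
    by (rule smooth_uptoI[OF has_vector_derivative_mult[OF u(1) v(1)]])
qed (auto simp: smooth_upto_0)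

lemma smooth_upto_const: "smooth_upto k (\<lambda>x. c)"
proof (induction k arbitrary: c)
  case (Suc k)
  show ?case by (rule smooth_uptoI[OF has_vector_derivative_const Suc.IH])
qed (auto simp: smooth_upto_0)

lemma has_vector_derivative_affine:
  fixes u :: "real \<Rightarrow> complex"
  assumes "(u has_vector_derivative v) (at (c * x + d))"
  shows "((\<lambda>x. u (c * x + d)) has_vector_derivative of_real c * v) (at x)"
proof -
  have "((\<lambda>x. c * x + d) has_real_derivative c) (at x)"
    by (auto intro!: derivative_eq_intros)
  then show ?thesis
    using vector_diff_chain_at[where f = "\<lambda>x. c * x + d", OF _ assms, of c] unfolding has_real_derivative_iff_has_vector_derivative
    by (simp add: o_def scaleR_conv_of_real)
qed

lemma smooth_upto_affine: "smooth_upto k u \<Longrightarrow> smooth_upto k (\<lambda>x. u (c * x + d))"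
proof (induction k arbitrary: u)
  case 0
  then have "((\<lambda>x. u (c * x + d)) has_vector_derivative of_real c * cderiv u (c * x + d)) (at x)" for x
    by (intro has_vector_derivative_affine has_cderiv) (simp add: smooth_upto_0)
  then show ?case unfolding smooth_upto_0 using differentiableI_vector by blast
next
  case (Suc k)
  note u = smooth_uptoD[OF Suc.prems(1)]
  have "((\<lambda>x. u (c * x + d)) has_vector_derivative of_real c * cderiv u (c * x + d)) (at x)" for x
    by (rule has_vector_derivative_affine[OF u(1)])
  then show ?case
    by (rule smooth_uptoI) (intro smooth_upto_mult smooth_upto_const Suc.IH u)
qed

text \<open>The polynomial in 1/t makes the family closed under differentiation. The parameter
  \<open>\<epsilon>\<close> stays free because for p = 1 the function tends to the indicator of t >
  0 as \<open>\<epsilon>\<close> tends to 0.\<close>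

definition bump :: "real \<Rightarrow> real poly \<Rightarrow> real \<Rightarrow> real" where
  "bump \<epsilon> p t = (if t > 0 then poly p (1 / t) * exp (- \<epsilon> / t) else 0)"

lemma poly_exp_tendsto_0:
  fixes p :: "real poly"
  shows "\<epsilon> > 0 \<Longrightarrow> ((\<lambda>u. poly p u * exp (- \<epsilon> * u)) \<longlongrightarrow> 0) at_top"
proof (induction p arbitrary: \<epsilon>)
  case (pCons a q)
  \<comment> \<open>Half of the exponent controls the factor u, the other half goes to the induction
    hypothesis, which is available for every positive \<open>\<epsilon>\<close>.\<close>
  have "((\<lambda>u. a * exp (- \<epsilon> * u) + (u * exp (- (\<epsilon>/2) * u)) * (poly q u * exp (- (\<epsilon>/2) * u))) \<longlongrightarrow> a * 0 + 0 * 0) at_top"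
  proof (intro tendsto_add tendsto_mult tendsto_const pCons.IH)
    show "((\<lambda>u. exp (- \<epsilon> * u)) \<longlongrightarrow> 0) at_top" using pCons.prems by real_asymp
    show "((\<lambda>u. u * exp (- (\<epsilon>/2) * u)) \<longlongrightarrow> 0) at_top" using pCons.prems by real_asymp
  qed (use pCons.prems in simp)
  moreover have "(\<lambda>u. a * exp (- \<epsilon> * u) + (u * exp (- (\<epsilon>/2) * u)) * (poly q u * exp (- (\<epsilon>/2) * u)))
      = (\<lambda>u. poly (pCons a q) u * exp (- \<epsilon> * u))"
  proof
    fix u
    have "exp (- \<epsilon> * u) = exp (- (\<epsilon>/2) * u) * exp (- (\<epsilon>/2) * u)" by (simp flip: exp_add)
    then show "a * exp (- \<epsilon> * u) + (u * exp (- (\<epsilon>/2) * u)) * (poly q u * exp (- (\<epsilon>/2) * u))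
      = poly (pCons a q) u * exp (- \<epsilon> * u)" by (simp add: algebra_simps)
  qed
  ultimately show ?case by simp
qed simp

text \<open>For u = 1/t one has u' = -u^2, so p(u) exp(-\<epsilon>u) has the derivative u^2
  (\<epsilon>p - p')(u) exp(-\<epsilon>u). At t = 0 the exponential beats every polynomial in
  u.\<close>

lemma bump_has_derivative:
  assumes \<epsilon>: "\<epsilon> > 0"
  shows "(bump \<epsilon> p has_real_derivative bump \<epsilon> ([:0, 0, 1:] * (Polynomial.smult \<epsilon> p - pderiv p)) t) (at t)"
proof -
  consider "t > 0" | "t < 0" | "t = 0" by linarith
  then show ?thesis
  proof cases
    case 1
    have "((\<lambda>t. poly p (1 / t) * exp (- \<epsilon> / t)) has_real_derivative
        (poly (pderiv p) (1 / t) * (- (1 / t\<^sup>2)) * exp (- \<epsilon> / t) + poly p (1 / t) * (exp (- \<epsilon> / t) * (\<epsilon> / t\<^sup>2)))) (at t)"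
      using 1 by (auto intro!: derivative_eq_intros DERIV_chain2[OF poly_DERIV] simp: power2_eq_square field_simps)
    then have "(bump \<epsilon> p has_real_derivative
        (poly (pderiv p) (1 / t) * (- (1 / t\<^sup>2)) * exp (- \<epsilon> / t) + poly p (1 / t) * (exp (- \<epsilon> / t) * (\<epsilon> / t\<^sup>2)))) (at t)"
      by (rule has_field_derivative_transform_within_open[of _ _ _ "{0<..}"]) (use 1 in \<open>auto simp: bump_def\<close>)
    then show ?thesis
      by (rule DERIV_cong) (use 1 in \<open>simp add: bump_def power2_eq_square field_simps\<close>)
  next
    case 2
    have "(bump \<epsilon> p has_real_derivative 0) (at t)"
      by (rule has_field_derivative_transform_within_open[of "\<lambda>_. 0" _ _ "{..<0}"]) (use 2 in \<open>auto simp: bump_def\<close>)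
    then show ?thesis using 2 by (simp add: bump_def)
  next
    case 3
    have r: "((\<lambda>t. bump \<epsilon> p t / t) \<longlongrightarrow> 0) (at_right 0)"
    proof -
      have "((\<lambda>t. poly (pCons 0 p) (inverse t) * exp (- \<epsilon> * inverse t)) \<longlongrightarrow> 0) (at_right 0)"
        by (rule filterlim_compose[OF poly_exp_tendsto_0[OF \<epsilon>] filterlim_inverse_at_top_right])
      moreover have "\<forall>\<^sub>F t in at_right 0. poly (pCons 0 p) (inverse t) * exp (- \<epsilon> * inverse t) = bump \<epsilon> p t / t"
        using eventually_at_right_less[of "0::real"]
        by eventually_elim (auto simp: bump_def field_simps)
      ultimately show ?thesis by (rule Lim_transform_eventually)
    qed
    have l: "((\<lambda>t. bump \<epsilon> p t / t) \<longlongrightarrow> 0) (at_left 0)"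
    proof (rule Lim_transform_eventually[OF tendsto_const])
      show "\<forall>\<^sub>F t in at_left 0. 0 = bump \<epsilon> p t / t"
        by (simp add: bump_def eventually_at_filter)
    qed
    have "((\<lambda>t. bump \<epsilon> p t / t) \<longlongrightarrow> 0) (at 0)"
      using l r by (simp add: filterlim_split_at)
    then have "(bump \<epsilon> p has_real_derivative 0) (at 0)"
      by (simp add: DERIV_def bump_def)
    then show ?thesis using 3 by (simp add: bump_def)
  qed
qed

lemma smooth_upto_bump:
  assumes \<epsilon>: "\<epsilon> > 0"
  shows "smooth_upto k (\<lambda>x. complex_of_real (bump \<epsilon> p x))"
proof (induction k arbitrary: p)
  case 0
  then show ?case unfolding smooth_upto_0
    using has_vector_derivative_of_real[OF bump_has_derivative[OF \<epsilon>]] differentiableI_vector by blast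
next
  case (Suc k)
  show ?case
    by (rule smooth_uptoI[OF has_vector_derivative_of_real[OF bump_has_derivative[OF \<epsilon>]] Suc.IH])
qed

section \<open>Test functions and integration by parts against them\<close>

lemma test_functions_iff:
  "z \<in> test_functions \<longleftrightarrow> (\<forall>k. smooth_upto k z) \<and> (\<exists>c d. 0 < c \<and> c \<le> d \<and> d < 1 \<and> (\<forall>x. x \<notin> {c..d} \<longrightarrow> z x = 0))"
proof
  assume z: "z \<in> test_functions"
  then obtain K where K: "compact K" "K \<subseteq> {0<..<1}" "\<forall>x. x \<notin> K \<longrightarrow> z x = 0"
    by (auto simp: test_functions_def)
  have "\<exists>c d. 0 < c \<and> c \<le> d \<and> d < 1 \<and> (\<forall>x. x \<notin> {c..d} \<longrightarrow> z x = 0)"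
  proof (cases "K = {}")
    case True
    then show ?thesis using K by (intro exI[of _ "1/2"]) auto
  next
    case False
    obtain c where c: "c \<in> K" "\<And>x. x \<in> K \<Longrightarrow> c \<le> x" using compact_attains_inf[OF K(1) False] by auto
    obtain d where d: "d \<in> K" "\<And>x. x \<in> K \<Longrightarrow> x \<le> d" using compact_attains_sup[OF K(1) False] by auto
    show ?thesis
    proof (rule exI[of _ c], rule exI[of _ d], intro conjI)
      show "\<forall>x. x \<notin> {c..d} \<longrightarrow> z x = 0"
      proof (intro allI impI)
        fix x assume "x \<notin> {c..d}"
        then have "x \<notin> K" using c(2) d(2) by auto
        then show "z x = 0" using K(3) by blast
      qed
    qed (use c d K in auto)
  qed
  moreover have "smooth_upto k z" for k using z by (simp add: test_functions_def smooth_upto_def)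
  ultimately show "(\<forall>k. smooth_upto k z) \<and> (\<exists>c d. 0 < c \<and> c \<le> d \<and> d < 1 \<and> (\<forall>x. x \<notin> {c..d} \<longrightarrow> z x = 0))" by blast
next
  assume a: "(\<forall>k. smooth_upto k z) \<and> (\<exists>c d. 0 < c \<and> c \<le> d \<and> d < 1 \<and> (\<forall>x. x \<notin> {c..d} \<longrightarrow> z x = 0))"
  then obtain c d where cd: "0 < c" "c \<le> d" "d < 1" "\<forall>x. x \<notin> {c..d} \<longrightarrow> z x = 0" by blast
  have "\<exists>K. compact K \<and> K \<subseteq> {0<..<1} \<and> (\<forall>x. x \<notin> K \<longrightarrow> z x = 0)"
    by (rule exI[of _ "{c..d}"]) (use cd in auto)
  moreover have "(cderiv ^^ k) z differentiable (at x)" for k x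
    using a unfolding smooth_upto_def by blast
  ultimately show "z \<in> test_functions" by (simp add: test_functions_def)
qed

lemma test_smooth: "z \<in> test_functions \<Longrightarrow> smooth_upto k z"
  by (simp add: test_functions_iff)

lemma test_has_cderiv: "z \<in> test_functions \<Longrightarrow> (z has_vector_derivative cderiv z x) (at x)"
  using test_smooth[of z 1] smooth_uptoD(1)[of 0 z x] by simp

lemma test_continuous: "z \<in> test_functions \<Longrightarrow> continuous_on S z"
  by (intro continuous_at_imp_continuous_on ballI has_vector_derivative_continuous[OF test_has_cderiv])

lemma test_zero: "z \<in> test_functions \<Longrightarrow> x \<notin> {0<..<1} \<Longrightarrow> z x = 0"
  unfolding test_functions_def by auto

lemma test_cderiv:
  assumes z: "z \<in> test_functions"
  shows "cderiv z \<in> test_functions"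
proof -
  obtain c d where cd: "0 < c" "c \<le> d" "d < 1" "\<And>x. x \<notin> {c..d} \<Longrightarrow> z x = 0"
    using z unfolding test_functions_iff by blast
  have "cderiv z x = 0" if "x \<notin> {c..d}" for x
  proof -
    have "(z has_vector_derivative 0) (at x)"
      by (rule has_vector_derivative_transform_within_open[of "\<lambda>_. 0" _ _ "- {c..d}"])
        (use that cd(4) in \<open>auto intro!: derivative_eq_intros simp: open_Compl\<close>)
    then show ?thesis unfolding cderiv_def by (rule vector_derivative_at)
  qed
  then show ?thesis unfolding test_functions_iff
    using smooth_uptoD(2)[OF test_smooth[OF z]] cd(1-3) by blast
qed

lemma test_funpow: "z \<in> test_functions \<Longrightarrow> (cderiv ^^ k) z \<in> test_functions"
  by (induction k) (auto intro: test_cderiv)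

lemma test_acd:
  assumes z: "z \<in> test_functions"
  shows "acd z (cderiv z)"
proof (rule acdI[where c = "z 0"])
  show i: "integrable leb01 (cderiv z)"
    by (rule continuous_integrable_01[OF test_continuous[OF test_cderiv[OF z]]])
  fix x :: real assume x: "x \<in> {0..1}"
  have "(cderiv z has_integral z x - z 0) {0..x}"
    by (rule fundamental_theorem_of_calculus)
      (use x in \<open>auto intro: has_vector_derivative_at_within test_has_cderiv[OF z]\<close>)
  then show "z x = z 0 + primitive (cderiv z) x"
    using primitive_HK[OF i x] by (simp add: integral_unique)
qed

lemma test_integrable_mult:
  "integrable leb01 u \<Longrightarrow> z \<in> test_functions \<Longrightarrow> integrable leb01 (\<lambda>x. u x * z x)"
  using continuous_times_integrable[OF test_continuous, of z u] by (simp add: mult.commute)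

lemma test_by_parts:
  assumes u: "acd u v" and z: "z \<in> test_functions"
  shows "(LINT x|leb01. v x * z x) = - (LINT x|leb01. u x * cderiv z x)"
proof -
  note m = acd_mult[OF u test_acd[OF z]]
  have i1: "integrable leb01 (\<lambda>x. v x * z x)"
    by (rule test_integrable_mult[OF acd_integrable[OF u] z])
  have i2: "integrable leb01 (\<lambda>x. u x * cderiv z x)"
    by (rule test_integrable_mult[OF continuous_integrable_01[OF acd_continuous[OF u]] test_cderiv[OF z]])
  have "primitive (\<lambda>x. v x * z x + u x * cderiv z x) 1 = 0"
    using acdD[OF m, of 1] test_zero[OF z] by simp
  then show ?thesis unfolding primitive_1 using i1 i2 by (simp add: eq_neg_iff_add_eq_0)
qed

lemma test_lincomb:
  assumes "z \<in> test_functions" "w \<in> test_functions"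
  shows "(\<lambda>x. z x + c * w x) \<in> test_functions"
proof -
  obtain a b where ab: "0 < a" "a \<le> b" "b < 1" "\<And>x. x \<notin> {a..b} \<Longrightarrow> z x = 0"
    using assms(1) unfolding test_functions_iff by blast
  obtain a' b' where ab': "0 < a'" "a' \<le> b'" "b' < 1" "\<And>x. x \<notin> {a'..b'} \<Longrightarrow> w x = 0"
    using assms(2) unfolding test_functions_iff by blast
  have "\<exists>c d. 0 < c \<and> c \<le> d \<and> d < 1 \<and> (\<forall>x. x \<notin> {c..d} \<longrightarrow> z x + cc * w x = 0)" for cc
  proof (rule exI[of _ "min a a'"], rule exI[of _ "max b b'"], intro conjI allI impI)
    fix x assume "x \<notin> {min a a'..max b b'}"
    then have "x \<notin> {a..b}" "x \<notin> {a'..b'}" by auto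
    then show "z x + cc * w x = 0" using ab(4) ab'(4) by simp
  qed (use ab(1-3) ab'(1-3) in auto)
  moreover have "smooth_upto k (\<lambda>x. z x + c * w x)" for k
    by (intro smooth_upto_add smooth_upto_mult smooth_upto_const test_smooth assms)
  ultimately show ?thesis unfolding test_functions_iff by blast
qed

lemma cderiv_lincomb:
  assumes "z \<in> test_functions" "w \<in> test_functions"
  shows "(cderiv ^^ k) (\<lambda>x. z x + c * w x) = (\<lambda>x. (cderiv ^^ k) z x + c * (cderiv ^^ k) w x)"
proof (induction k)
  case (Suc k)
  have "cderiv (\<lambda>x. (cderiv ^^ k) z x + c * (cderiv ^^ k) w x)
      = (\<lambda>x. cderiv ((cderiv ^^ k) z) x + c * cderiv ((cderiv ^^ k) w) x)"
    by (rule cderivI)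
      (intro has_vector_derivative_add has_vector_derivative_mult_right test_has_cderiv test_funpow assms)
  then show ?case using Suc by simp
qed simp

text \<open>Values lie in [0,1], vanish off (a,b), and tend to 1 inside (a,b) as
  \<open>\<epsilon>\<close> tends to 0.\<close>

definition cutoff :: "real \<Rightarrow> real \<Rightarrow> real \<Rightarrow> real \<Rightarrow> complex" where
  "cutoff \<epsilon> a b x = complex_of_real (bump \<epsilon> 1 (x - a)) * complex_of_real (bump \<epsilon> 1 (b - x))"

lemma cutoff_test:
  assumes "\<epsilon> > 0" "0 < a" "a < b" "b < 1"
  shows "cutoff \<epsilon> a b \<in> test_functions"
proof -
  have "smooth_upto k (\<lambda>x. complex_of_real (bump \<epsilon> 1 (1 * x + - a)) * complex_of_real (bump \<epsilon> 1 ((-1) * x + b)))" for k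
    by (intro smooth_upto_mult smooth_upto_affine[of k "\<lambda>x. complex_of_real (bump \<epsilon> 1 x)"] smooth_upto_bump assms)
  then have "smooth_upto k (cutoff \<epsilon> a b)" for k
    by (simp add: cutoff_def[abs_def])
  moreover have "cutoff \<epsilon> a b x = 0" if "x \<notin> {a..b}" for x
    using that by (auto simp: cutoff_def bump_def)
  ultimately show ?thesis unfolding test_functions_iff using assms by (metis less_imp_le)
qed

text \<open>Testing with cutoffs and letting their parameter tend to 0 shows that the integral of
  \<open>u\<close> over each interval inside (0,1) vanishes. So the primitive is constant on (0,1),
  by continuity on [0,1], and it is 0 at 0.\<close>

lemma test_fundamental:
  assumes u: "integrable leb01 u"
    and z: "\<And>z. z \<in> test_functions \<Longrightarrow> (LINT x|leb01. u x * z x) = 0"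
  shows "aeq u (\<lambda>_. 0)"
proof -
  have eq: "primitive u a = primitive u b" if ab: "0 < a" "a < b" "b < 1" for a b
  proof -
    let ?f = "\<lambda>x. indicat_real {0..b} x *\<^sub>R u x - indicat_real {0..a} x *\<^sub>R u x"
    have fi: "integrable leb01 (\<lambda>x. indicat_real {0..b} x *\<^sub>R u x)" "integrable leb01 (\<lambda>x. indicat_real {0..a} x *\<^sub>R u x)"
      by (intro integrable_indicator_01[OF u]; use ab in auto)+
    \<comment> \<open>At b the limit \<open>?f\<close> takes the value u(b), but all cutoffs vanish
      there; the point is discarded.\<close>
    have ne: "AE x in leb01. x \<noteq> b"
      using AE_lborel_singleton[of b] by (simp add: AE_restrict_space_iff AE_completion_iff) (erule eventually_mono, simp)
    have lim: "(\<lambda>n. LINT x|leb01. u x * cutoff (1 / Suc n) a b x) \<longlonglongrightarrow> (LINT x|leb01. ?f x)"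
    proof (rule integral_dominated_convergence[where w = "\<lambda>x. norm (u x)"])
      show "?f \<in> borel_measurable leb01" using fi by auto
      show "integrable leb01 (\<lambda>x. norm (u x))" using u by auto
      show "(\<lambda>x. u x * cutoff (1 / Suc n) a b x) \<in> borel_measurable leb01" for n
        by (rule borel_measurable_integrable[OF test_integrable_mult[OF u cutoff_test]]) (use ab in auto)
      show "AE x in leb01. norm (u x * cutoff (1 / Suc n) a b x) \<le> norm (u x)" for n
      proof (rule AE_I2)
        fix x
        have "norm (cutoff (1 / Suc n) a b x) \<le> 1 * 1"
          unfolding cutoff_def norm_mult by (intro mult_mono) (auto simp: bump_def divide_nonneg_pos)
        then show "norm (u x * cutoff (1 / Suc n) a b x) \<le> norm (u x)"
          unfolding norm_mult by (intro mult_left_le) auto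
      qed
      show "AE x in leb01. (\<lambda>n. u x * cutoff (1 / Suc n) a b x) \<longlonglongrightarrow> ?f x"
        using ne AE_space
      proof eventually_elim
        case (elim x)
        show ?case
        proof (cases "a < x \<and> x < b")
          case True
          have "(\<lambda>n. exp (- (1 / real (Suc n)) / t)) \<longlonglongrightarrow> exp (- 0 / t)" if "t > 0" for t
            by (intro tendsto_exp tendsto_divide tendsto_minus tendsto_const) (use that LIMSEQ_Suc[OF lim_1_over_n] in auto)
          from tendsto_mult[OF this[of "x - a"] this[of "b - x"]] True
          have "(\<lambda>n. u x * (complex_of_real (exp (- (1 / real (Suc n)) / (x - a)) * exp (- (1 / real (Suc n)) / (b - x))))) \<longlonglongrightarrow> u x * complex_of_real 1"
            by (intro tendsto_mult tendsto_of_real tendsto_const) (simp add: o_def)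
          moreover have "?f x = u x * complex_of_real 1" using True ab by auto
          moreover have "u x * cutoff (1 / Suc n) a b x = u x * (complex_of_real (exp (- (1 / real (Suc n)) / (x - a)) * exp (- (1 / real (Suc n)) / (b - x))))" for n
            using True by (simp add: cutoff_def bump_def)
          ultimately show ?thesis by (simp only:)
        next
          case False
          then have c: "cutoff (1 / Suc n) a b x = 0" for n by (auto simp: cutoff_def bump_def)
          have f: "?f x = 0" using False elim ab by (auto simp: indicator_def)
          show ?thesis unfolding c f by simp
        qed
      qed
    qed
    have "(LINT x|leb01. u x * cutoff (1 / Suc n) a b x) = 0" for n
      by (rule z[OF cutoff_test]) (use ab in auto)
    then have "(LINT x|leb01. ?f x) = 0" using lim by (simp add: LIMSEQ_const_iff)
    then have "(LINT x|leb01. indicat_real {0..b} x *\<^sub>R u x) = (LINT x|leb01. indicat_real {0..a} x *\<^sub>R u x)"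
      using fi by simp
    then show ?thesis using primitive_indicator[of a u] primitive_indicator[of b u] ab by simp
  qed
  have "primitive u x = primitive u (1/2)" if "x \<in> {0<..<1}" for x
  proof (cases x "1/2::real" rule: linorder_cases)
    case less
    show ?thesis by (rule eq) (use less that in auto)
  next
    case greater
    show ?thesis by (rule eq[symmetric]) (use greater that in auto)
  next
    case equal
    then show ?thesis by (rule arg_cong)
  qed
  note h = this
  have c: "primitive u x = primitive u (1/2)" if "x \<in> {0..1}" for x
  proof (rule continuous_constant_on_closure[of "{0<..<1}" "primitive u"])
    show "continuous_on (closure {0<..<1}) (primitive u)" using continuous_primitive[OF u] by simp
    show "primitive u y = primitive u (1/2)" if "y \<in> {0<..<1}" for y by (rule h[OF that])
    show "x \<in> closure {0<..<1}" using that by simp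
  qed
  show ?thesis
  proof (rule primitive_zero_AE[OF u])
    fix x :: real assume "x \<in> {0..1}"
    then have "primitive u x = primitive u 0" using c[of x] c[of 0] by (metis atLeastAtMost_iff order_refl zero_le_one)
    then show "primitive u x = 0" by simp
  qed
qed

text \<open>Integration from 0 gives zero to the left of the support of \<open>\<phi>\<close>; the
  vanishing total integral gives zero to the right of it as well.\<close>

lemma test_antiderivative:
  assumes \<phi>: "\<phi> \<in> test_functions" and int0: "(LINT x|leb01. \<phi> x) = 0"
  obtains \<psi> where "\<psi> \<in> test_functions" "cderiv \<psi> = \<phi>"
proof -
  obtain c d where cd: "0 < c" "c \<le> d" "d < 1" "\<And>x. x \<notin> {c..d} \<Longrightarrow> \<phi> x = 0"
    using \<phi> unfolding test_functions_iff by blast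
  define \<psi> where "\<psi> = (\<lambda>x. integral {0..x} \<phi>)"
  have io: "\<phi> integrable_on {a..b}" for a b
    by (rule integrable_continuous_real[OF test_continuous[OF \<phi>]])
  have z: "integral {a..b} \<phi> = 0" if "\<And>x. x \<in> {a..b} \<Longrightarrow> x \<notin> {c..d}" for a b
  proof -
    have "integral {a..b} \<phi> = integral {a..b} (\<lambda>_. 0)"
      by (rule Henstock_Kurzweil_Integration.integral_cong) (use cd(4) that in blast)
    then show ?thesis by simp
  qed
  have tot: "integral {0..1} \<phi> = 0"
    using lebesgue_integral_eq_integral[of "{0..1}" \<phi>] int0 continuous_integrable_01[OF test_continuous[OF \<phi>]] by simp
  have \<psi>0: "\<psi> x = 0" if "x \<notin> {c..d}" for x
  proof -
    have "x < c \<or> (x > d \<and> x \<le> 1) \<or> x > 1" using that by auto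
    then consider "x < c" | "x > d" "x \<le> 1" | "x > 1" by blast
    then show ?thesis
    proof cases
      case 1
      then show ?thesis unfolding \<psi>_def by (intro z) auto
    next
      case 2
      have "integral {0..x} \<phi> + integral {x..1} \<phi> = integral {0..1} \<phi>"
        by (rule Henstock_Kurzweil_Integration.integral_combine) (use 2 cd io in auto)
      moreover have "integral {x..1} \<phi> = 0" by (rule z) (use 2 in auto)
      ultimately show ?thesis using tot by (simp add: \<psi>_def)
    next
      case 3
      have "integral {0..1} \<phi> + integral {1..x} \<phi> = integral {0..x} \<phi>"
        by (rule Henstock_Kurzweil_Integration.integral_combine) (use 3 io in auto)
      moreover have "integral {1..x} \<phi> = 0" by (rule z) (use 3 cd in auto)
      ultimately show ?thesis using tot by (simp add: \<psi>_def)
    qed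
  qed
  have d: "(\<psi> has_vector_derivative \<phi> x) (at x)" for x
  proof (cases "x \<in> {0<..<1}")
    case True
    have "(\<psi> has_vector_derivative \<phi> x) (at x within {0..1})"
      unfolding \<psi>_def by (rule integral_has_vector_derivative[OF test_continuous[OF \<phi>]]) (use True in auto)
    moreover have "at x within {0..1} = at x" by (rule at_within_interior) (use True in simp)
    ultimately show ?thesis by simp
  next
    case False
    then have x: "x \<notin> {c..d}" using cd by auto
    have "(\<psi> has_vector_derivative 0) (at x)"
      by (rule has_vector_derivative_transform_within_open[of "\<lambda>_. 0" _ _ "- {c..d}"])
        (use x \<psi>0 in \<open>auto intro!: derivative_eq_intros simp: open_Compl\<close>)
    then show ?thesis using cd(4)[OF x] by simp
  qed
  have sm: "smooth_upto k \<psi>" for k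
    by (rule smooth_upto_le[OF smooth_uptoI[OF d test_smooth[OF \<phi>, of k]]]) simp
  have "\<psi> \<in> test_functions" unfolding test_functions_iff using sm \<psi>0 cd(1-3) by blast
  then show ?thesis using that cderivI[OF d] by blast
qed

text \<open>If every test function had integral 0, the fundamental lemma would force the constant 1
  to vanish.\<close>

lemma test_unit_integral:
  obtains \<phi> where "\<phi> \<in> test_functions" "(LINT x|leb01. \<phi> x) = 1"
proof -
  have ex: "\<exists>z\<in>test_functions. (LINT x|leb01. z x) \<noteq> 0"
  proof (rule ccontr)
    assume "\<not> ?thesis"
    then have "(LINT x|leb01. 1 * z x) = 0" if "z \<in> test_functions" for z using that by auto
    from test_fundamental[OF _ this] have "aeq (\<lambda>_. 1) (\<lambda>_. 0)"
      using continuous_integrable_01[OF continuous_on_const] by blast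
    from continuous_aeq_eq[OF continuous_on_const continuous_on_const this, of 0]
    show False by simp
  qed
  then obtain z where z: "z \<in> test_functions" "(LINT x|leb01. z x) \<noteq> 0" by blast
  define I where "I = (LINT x|leb01. z x)"
  have "(\<lambda>x. z x + (1 / I - 1) * z x) \<in> test_functions" by (rule test_lincomb[OF z(1) z(1)])
  moreover have "(\<lambda>x. z x + (1 / I - 1) * z x) = (\<lambda>x. (1 / I) * z x)" by (rule ext) (simp add: algebra_simps)
  moreover have "(LINT x|leb01. (1 / I) * z x) = 1"
    using z(2) by (simp only: integral_mult_right_zero) (simp add: I_def)
  ultimately show ?thesis using that by metis
qed

text \<open>Iterated du Bois-Reymond lemma. The weak equation of order N is equivalent to a ladder
  of antiderivatives: each \<open>R (Suc b)\<close> absorbs \<open>u b\<close> together with the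
  previous remainder, and the last one has to coincide with \<open>u N\<close>. One step replaces
  \<open>u 0\<close> by a primitive and thereby lowers the order by one.\<close>

lemma distributional_chain:
  fixes u :: "nat \<Rightarrow> real \<Rightarrow> complex"
  assumes "\<And>b. b \<le> N \<Longrightarrow> integrable leb01 (u b)"
    and "\<And>z. z \<in> test_functions \<Longrightarrow> (\<Sum>b\<le>N. LINT x|leb01. u b x * (cderiv ^^ b) z x) = 0"
  shows "\<exists>R. aeq (R N) (u N) \<and> (\<forall>b<N. acd (R (Suc b)) (\<lambda>x. u b x - R b x)) \<and> R 0 = (\<lambda>_. 0)"
  using assms
proof (induction N arbitrary: u)
  case 0
  have "aeq (u 0) (\<lambda>_. 0)" by (rule test_fundamental) (use 0 in simp_all)
  then show ?case by (intro exI[of _ "\<lambda>_ _. 0"]) (auto elim: eventually_mono)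
next
  case (Suc N)
  note ui = Suc.prems(1)
  obtain \<phi>0 where \<phi>0: "\<phi>0 \<in> test_functions" "(LINT x|leb01. \<phi>0 x) = 1" by (rule test_unit_integral)
  define G where "G = primitive (u 0)"
  have G: "acd G (u 0)" unfolding G_def using acd_primitive[OF ui[of 0], of 0] by simp
  have Gi: "integrable leb01 G" by (rule continuous_integrable_01[OF acd_continuous[OF G]])
  \<comment> \<open>The functional left after moving one derivative off z: it vanishes on all
    derivatives of test functions, so it is a constant multiple of the integral.\<close>
  define T where "T = (\<lambda>z. (\<Sum>b\<le>N. LINT x|leb01. u (Suc b) x * (cderiv ^^ b) z x) - (LINT x|leb01. G x * z x))"
  have T0: "T (cderiv z) = 0" if z: "z \<in> test_functions" for z
  proof -
    have "(LINT x|leb01. u 0 x * z x) + (\<Sum>b\<le>N. LINT x|leb01. u (Suc b) x * (cderiv ^^ Suc b) z x) = 0"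
      using Suc.prems(2)[OF z] unfolding sum.atMost_Suc_shift by simp
    then show ?thesis using test_by_parts[OF G z] by (simp add: T_def funpow_swap1)
  qed
  have Tlin: "T (\<lambda>x. z x + c * w x) = T z + c * T w" if z: "z \<in> test_functions" and w: "w \<in> test_functions" for z w c
  proof -
    have l: "(LINT x|leb01. v x * (z' x + c * w' x)) = (LINT x|leb01. v x * z' x) + c * (LINT x|leb01. v x * w' x)"
      if "integrable leb01 v" "z' \<in> test_functions" "w' \<in> test_functions" for v z' w'
    proof -
      have "(LINT x|leb01. v x * (z' x + c * w' x)) = (LINT x|leb01. v x * z' x + c * (v x * w' x))"
        by (simp add: algebra_simps)
      then show ?thesis using test_integrable_mult[OF that(1,2)] test_integrable_mult[OF that(1,3)] by simp
    qed
    have "(\<Sum>b\<le>N. LINT x|leb01. u (Suc b) x * (cderiv ^^ b) (\<lambda>x. z x + c * w x) x)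
       = (\<Sum>b\<le>N. (LINT x|leb01. u (Suc b) x * (cderiv ^^ b) z x) + c * (LINT x|leb01. u (Suc b) x * (cderiv ^^ b) w x))"
      unfolding cderiv_lincomb[OF z w] by (intro sum.cong refl l ui test_funpow z w) simp
    then show ?thesis unfolding T_def l[OF Gi z w]
      by (simp add: sum.distrib sum_distrib_left algebra_simps)
  qed
  define c where "c = T \<phi>0"
  have TI: "T z = c * (LINT x|leb01. z x)" if z: "z \<in> test_functions" for z
  proof -
    define I where "I = (LINT x|leb01. z x)"
    have t: "(\<lambda>x. z x + (- I) * \<phi>0 x) \<in> test_functions" by (rule test_lincomb[OF z \<phi>0(1)])
    have i: "integrable leb01 z" "integrable leb01 \<phi>0"
      using z \<phi>0 by (auto intro!: continuous_integrable_01 test_continuous)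
    have "(LINT x|leb01. z x + (- I) * \<phi>0 x) = (LINT x|leb01. z x) + (- I) * (LINT x|leb01. \<phi>0 x)"
      using i by simp
    then have "(LINT x|leb01. z x + (- I) * \<phi>0 x) = 0" by (simp add: \<phi>0 I_def)
    then obtain \<psi> where "\<psi> \<in> test_functions" "cderiv \<psi> = (\<lambda>x. z x + (- I) * \<phi>0 x)"
      by (rule test_antiderivative[OF t])
    then have "T (\<lambda>x. z x + (- I) * \<phi>0 x) = 0" using T0 by metis
    then show ?thesis using Tlin[OF z \<phi>0(1), of "- I"] by (simp add: c_def I_def)
  qed
  \<comment> \<open>The constant c from the previous step is the integration constant of the
    primitive of \<open>u 0\<close>; with it the remaining functional vanishes on all test
    functions.\<close>
  define R1 where "R1 = (\<lambda>x. c + G x)"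
  have R1: "acd R1 (u 0)" unfolding R1_def G_def by (rule acd_primitive[OF ui]) simp
  have R1i: "integrable leb01 R1" by (rule continuous_integrable_01[OF acd_continuous[OF R1]])
  define u' where "u' = (\<lambda>b. if b = 0 then (\<lambda>x. u (Suc 0) x - R1 x) else u (Suc b))"
  have "\<exists>R. aeq (R N) (u' N) \<and> (\<forall>b<N. acd (R (Suc b)) (\<lambda>x. u' b x - R b x)) \<and> R 0 = (\<lambda>_. 0)"
  proof (rule Suc.IH)
    show "integrable leb01 (u' b)" if "b \<le> N" for b
      using ui[of "Suc b"] that R1i by (auto simp: u'_def)
    fix z assume z: "z \<in> test_functions"
    have "(LINT x|leb01. u' 0 x * z x) = (LINT x|leb01. u (Suc 0) x * z x - (c * z x + G x * z x))"
      by (simp add: u'_def R1_def algebra_simps)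
    also have "\<dots> = (LINT x|leb01. u (Suc 0) x * z x) - (c * (LINT x|leb01. z x) + (LINT x|leb01. G x * z x))"
      using test_integrable_mult[OF ui[of "Suc 0"] z] test_integrable_mult[OF Gi z]
        continuous_integrable_01[OF test_continuous[OF z]] by simp
    finally have e0: "(LINT x|leb01. u' 0 x * z x) = (LINT x|leb01. u (Suc 0) x * z x) - (c * (LINT x|leb01. z x) + (LINT x|leb01. G x * z x))" .
    have sp: "(\<Sum>b\<le>N. f b) = f 0 + (\<Sum>b<N. f (Suc b))" for f :: "nat \<Rightarrow> complex"
      by (simp add: sum.atMost_shift)
    have "(\<Sum>b\<le>N. LINT x|leb01. u' b x * (cderiv ^^ b) z x) = T z - c * (LINT x|leb01. z x)"
      unfolding T_def sp[of "\<lambda>b. LINT x|leb01. u' b x * (cderiv ^^ b) z x"]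
        sp[of "\<lambda>b. LINT x|leb01. u (Suc b) x * (cderiv ^^ b) z x"] using e0 by (simp add: u'_def)
    then show "(\<Sum>b\<le>N. LINT x|leb01. u' b x * (cderiv ^^ b) z x) = 0" using TI[OF z] by simp
  qed
  then obtain R where R: "aeq (R N) (u' N)" "\<And>b. b < N \<Longrightarrow> acd (R (Suc b)) (\<lambda>x. u' b x - R b x)" "R 0 = (\<lambda>_. 0)"
    by blast
  \<comment> \<open>The ladder for \<open>u'\<close> shifted by one. Index 1 is separate:
    \<open>R1\<close> has already been subtracted inside \<open>u' 0\<close>, where the shifted
    ladder has its zero entry.\<close>
  define S where "S = (\<lambda>b. if b = 0 then (\<lambda>_. 0) else if b = Suc 0 then R1 else R (b - 1))"
  have "aeq (S (Suc N)) (u (Suc N))"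
  proof (cases N)
    case 0
    have "aeq (\<lambda>_. 0) (\<lambda>x. u (Suc 0) x - R1 x)" using R(1) 0 R(3) by (simp add: u'_def)
    then show ?thesis using 0 by (simp add: S_def) (erule eventually_mono, simp)
  next
    case (Suc k)
    then show ?thesis using R(1) by (simp add: S_def u'_def)
  qed
  moreover have "acd (S (Suc b)) (\<lambda>x. u b x - S b x)" if "b < Suc N" for b
  proof -
    consider "b = 0" | "b = 1" | k where "b = Suc (Suc k)" by (metis One_nat_def not0_implies_Suc)
    then show ?thesis
    proof cases
      case 1
      then show ?thesis using R1 by (simp add: S_def)
    next
      case 2
      then show ?thesis using R(2)[of 0] that R(3) by (simp add: S_def u'_def)
    next
      case 3
      then show ?thesis using R(2)[of "Suc k"] that by (simp add: S_def u'_def)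
    qed
  qed
  moreover have "S 0 = (\<lambda>_. 0)" by (simp add: S_def)
  ultimately show ?case by blast
qed

section \<open>Quasi-derivatives as solutions of first-order systems\<close>

lemma aeq_sym: "aeq u v \<Longrightarrow> aeq v u"
  by (erule eventually_mono) simp

lemma aeq_trans:
  assumes "aeq u v" "aeq v w"
  shows "aeq u w"
  using assms by eventually_elim simp

lemma W11_iff: "u \<in> W11 \<longleftrightarrow> (\<exists>v. acd u v)"
  by (simp only: W11_def mem_Collect_eq Bex_def acd_def Lp01_1_iff primitive_def)

lemma has_sderiv_iff:
  "has_sderiv u v \<longleftrightarrow> integrable leb01 v \<and> (\<exists>c. aeq u (\<lambda>x. c + primitive v x))"
  unfolding has_sderiv_def Lp01_1_iff primitive_def ..

lemma acd_has_sderiv: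
  assumes "acd u v"
  shows "has_sderiv u v"
  unfolding has_sderiv_iff
proof (intro conjI exI)
  show "integrable leb01 v" by (rule acd_integrable[OF assms])
  show "aeq u (\<lambda>x. u 0 + primitive v x)" by (rule AE_I2, rule acdD[OF assms]) simp
qed

lemma has_sderiv_unique:
  assumes "has_sderiv u v" "has_sderiv u w"
  shows "aeq v w"
proof -
  obtain c d where c: "integrable leb01 v" "aeq u (\<lambda>x. c + primitive v x)"
    and d: "integrable leb01 w" "aeq u (\<lambda>x. d + primitive w x)"
    using assms unfolding has_sderiv_iff by blast
  have cc: "continuous_on {0..1} (\<lambda>x. c + primitive v x)" "continuous_on {0..1} (\<lambda>x. d + primitive w x)"
    by (intro continuous_on_add continuous_on_const continuous_primitive c d)+
  have "aeq (\<lambda>x. c + primitive v x) (\<lambda>x. d + primitive w x)"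
    using c(2) d(2) by eventually_elim simp
  then have "c + primitive v x = d + primitive w x" if "x \<in> {0..1}" for x
    using continuous_aeq_eq[OF cc _ that] by blast
  then have "acd (\<lambda>x. c + primitive v x) w" by (rule acdI[OF d(1)])
  then show ?thesis by (rule acd_unique[OF acd_primitive[OF c(1)]])
qed

lemma has_sderiv_cong:
  assumes "aeq u u'"
  shows "has_sderiv u v = has_sderiv u' v"
proof -
  have "aeq u (\<lambda>x. c + primitive v x) \<longleftrightarrow> aeq u' (\<lambda>x. c + primitive v x)" for c
    by (rule iffI) (erule aeq_trans[OF aeq_sym[OF assms]], erule aeq_trans[OF assms])
  then have "(\<exists>c. aeq u (\<lambda>x. c + primitive v x)) \<longleftrightarrow> (\<exists>c. aeq u' (\<lambda>x. c + primitive v x))"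
    by (rule arg_cong[where f = Ex, OF ext])
  then show ?thesis unfolding has_sderiv_iff by (rule arg_cong[where f = "\<lambda>P. integrable leb01 v \<and> P"])
qed

lemma sderiv_cong: "aeq u u' \<Longrightarrow> sderiv u = sderiv u'"
  unfolding sderiv_def using has_sderiv_cong by presburger

lemma sderiv_aeq:
  assumes "has_sderiv u v"
  shows "aeq (sderiv u) v"
proof -
  have "has_sderiv u (sderiv u)" unfolding sderiv_def by (rule someI[of _ v]) fact
  then show ?thesis by (rule has_sderiv_unique[OF _ assms])
qed

text \<open>A chosen derivative is known only up to null sets, but \<open>sderiv\<close> takes a.e.
  equal functions to literally the same function. Its iterates can therefore be followed along any
  chain of concrete derivatives.\<close>

lemma sderiv_funpow_aeq:
  assumes "aeq u (w 0)" "\<And>a. a < i \<Longrightarrow> acd (w a) (w (Suc a))"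
  shows "aeq ((sderiv ^^ i) u) (w i)"
  using assms(2)
proof (induction i)
  case 0
  then show ?case using assms(1) by simp
next
  case (Suc i)
  then have "aeq ((sderiv ^^ i) u) (w i)" by simp
  from sderiv_cong[OF this] have "(sderiv ^^ Suc i) u = sderiv (w i)" by simp
  then show ?case using sderiv_aeq[OF acd_has_sderiv[OF Suc.prems[of i]]] by simp
qed

lemma cont_rep_ex:
  assumes "continuous_on {0..1} u" "aeq u h"
  shows "continuous_on {0..1} (cont_rep h)" "aeq (cont_rep h) h"
proof -
  have ex: "\<exists>u. continuous_on {0..1} u \<and> aeq u h" using assms by blast
  then have "cont_rep h = (SOME u. continuous_on {0..1} u \<and> aeq u h)" unfolding cont_rep_def by (rule if_P)
  then show "continuous_on {0..1} (cont_rep h)" "aeq (cont_rep h) h" using someI_ex[OF ex] by auto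
qed

lemma cont_rep_aeq: "aeq (cont_rep h) h"
proof (cases "\<exists>u. continuous_on {0..1} u \<and> aeq u h")
  case True
  then show ?thesis using cont_rep_ex by blast
next
  case False
  then have "cont_rep h = h" unfolding cont_rep_def by (rule if_not_P)
  then show ?thesis by simp
qed

lemma cont_rep_eq:
  assumes "continuous_on {0..1} u" "aeq u h" "x \<in> {0..1}"
  shows "cont_rep h x = u x"
proof (rule continuous_aeq_eq[OF _ assms(1) _ assms(3)])
  note c = cont_rep_ex[OF assms(1,2)]
  show "continuous_on {0..1} (cont_rep h)" by (rule c)
  show "aeq (cont_rep h) u" using c(2) assms(2) by eventually_elim simp
qed

text \<open>Completeness of Lebesgue measure; it supplies measurability for functions that are
  described only up to null sets.\<close>

lemma aeq_measurable:
  assumes "aeq u v" "v \<in> borel_measurable leb01"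
  shows "u \<in> borel_measurable leb01"
proof -
  have v: "(\<lambda>x. if x \<in> {0..1} then v x else 0) \<in> borel_measurable lebesgue"
    by (rule borel_measurable_if_I[OF assms(2)]) simp
  have "AE x in lebesgue. (if x \<in> {0..1} then v x else 0) = (if x \<in> {0..1} then u x else 0)"
    using assms(1) by (simp add: AE_restrict_space_iff) (erule eventually_mono, auto)
  then have "(\<lambda>x. if x \<in> {0..1} then u x else 0) \<in> borel_measurable lebesgue"
    by (rule borel_measurable_AE[OF v])
  then show ?thesis by (rule borel_measurable_if_D)
qed

lemma acd_deriv_cong:
  assumes "acd u v" "aeq v w"
  shows "acd u w"
  by (rule acd_cong[OF assms(1) refl assms(2)])
    (rule aeq_measurable[OF aeq_sym[OF assms(2)] borel_measurable_integrable[OF acd_integrable[OF assms(1)]]])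

lemma Lp01_2_integrable:
  assumes "f \<in> Lp01 2"
  shows "integrable leb01 f"
proof (rule Bochner_Integration.integrable_bound)
  show "integrable leb01 (\<lambda>x. 1 + cmod (f x) ^ 2)"
    using assms by (auto simp: Lp01_def)
  show "f \<in> borel_measurable leb01" using assms by (simp add: Lp01_def)
  show "AE x in leb01. norm (f x) \<le> norm (1 + cmod (f x) ^ 2)"
  proof (rule AE_I2)
    fix x
    have "0 \<le> (cmod (f x) - 1/2)\<^sup>2" by simp
    then show "norm (f x) \<le> norm (1 + cmod (f x) ^ 2)" by (simp add: power2_eq_square algebra_simps)
  qed
qed

lemma Lp01_2_mult:
  assumes "f \<in> Lp01 2" "g \<in> Lp01 2"
  shows "integrable leb01 (\<lambda>x. f x * g x)"
proof (rule Bochner_Integration.integrable_bound)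
  show "integrable leb01 (\<lambda>x. cmod (f x) ^ 2 + cmod (g x) ^ 2)"
    using assms by (auto simp: Lp01_def)
  show "(\<lambda>x. f x * g x) \<in> borel_measurable leb01" using assms by (auto simp: Lp01_def)
  show "AE x in leb01. norm (f x * g x) \<le> norm (cmod (f x) ^ 2 + cmod (g x) ^ 2)"
  proof (rule AE_I2)
    fix x
    have "cmod (f x) * cmod (g x) \<le> 2 * cmod (f x) * cmod (g x)" by simp
    also have "\<dots> \<le> (cmod (f x))\<^sup>2 + (cmod (g x))\<^sup>2" by (rule sum_squares_bound)
    finally show "norm (f x * g x) \<le> norm (cmod (f x) ^ 2 + cmod (g x) ^ 2)"
      by (simp add: norm_mult)
  qed
qed

section \<open>First-order systems of companion form\<close>

definition system :: "nat \<Rightarrow> (nat \<Rightarrow> nat \<Rightarrow> real \<Rightarrow> complex) \<Rightarrow> (real \<Rightarrow> complex) \<Rightarrow> (nat \<Rightarrow> real \<Rightarrow> complex) \<Rightarrow> bool" where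
  "system n A f Y \<longleftrightarrow>
     (\<forall>k<n. acd (Y k) (\<lambda>x. (\<Sum>j<n. A k j x * Y j x) + (if Suc k = n then f x else 0)))"

text \<open>Indices start from 0: the component \<open>k\<close> belongs to \<open>y\<^sup>[\<^sup>k\<^sup>]\<close>, so the matrix entry \<open>f\<^sub>k\<^sub>,\<^sub>j\<close> becomes
  \<open>B (k - 1) (j - 1)\<close>.\<close>

definition companion :: "nat \<Rightarrow> nat \<Rightarrow> (nat \<Rightarrow> nat \<Rightarrow> real \<Rightarrow> complex) \<Rightarrow> nat \<Rightarrow> nat \<Rightarrow> real \<Rightarrow> complex" where
  "companion m s B k j x =
     (if j = Suc k then 1 else if m + s \<le> Suc k \<and> j \<le> m \<and> j \<le> k then B k j x else 0)"

lemma companion_sum: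
  assumes "k < n"
  shows "(\<Sum>j<n. companion m s B k j x * Y j x) =
    (if Suc k < n then Y (Suc k) x else 0) +
    (\<Sum>j\<le>k. (if m + s \<le> Suc k \<and> j \<le> m then B k j x else 0) * Y j x)"
proof -
  have 1: "(\<Sum>j\<in>{..<n} - {..k}. companion m s B k j x * Y j x) = (if Suc k < n then Y (Suc k) x else 0)"
  proof (cases "Suc k < n")
    case True
    then show ?thesis
      by (subst sum.mono_neutral_right[of "{..<n} - {..k}" "{Suc k}"]) (auto simp: companion_def)
  next
    case False
    then have "{..<n} - {..k} = {}" by auto
    then show ?thesis using False by (simp only: sum.empty if_False)
  qed
  have "(\<Sum>j<n. companion m s B k j x * Y j x) = (\<Sum>j\<in>{..<n} - {..k}. companion m s B k j x * Y j x) + (\<Sum>j\<le>k. companion m s B k j x * Y j x)"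
    by (rule sum.subset_diff) (use assms in auto)
  also have "(\<Sum>j\<le>k. companion m s B k j x * Y j x) = (\<Sum>j\<le>k. (if m + s \<le> Suc k \<and> j \<le> m then B k j x else 0) * Y j x)"
    by (intro sum.cong) (auto simp: companion_def)
  finally show ?thesis unfolding 1 .
qed

lemma system_acd:
  "system n A f Y \<Longrightarrow> k < n \<Longrightarrow> acd (Y k) (\<lambda>x. (\<Sum>j<n. A k j x * Y j x) + (if Suc k = n then f x else 0))"
  unfolding system_def by blast

lemma system_companion_acd:
  assumes "system n (companion m s B) f Y" "k < n"
  shows "acd (Y k) (\<lambda>x. (if Suc k < n then Y (Suc k) x else f x) +
      (\<Sum>j\<le>k. (if m + s \<le> Suc k \<and> j \<le> m then B k j x else 0) * Y j x))"
proof -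
  have "(\<lambda>x. (\<Sum>j<n. companion m s B k j x * Y j x) + (if Suc k = n then f x else 0))
       = (\<lambda>x. (if Suc k < n then Y (Suc k) x else f x) +
      (\<Sum>j\<le>k. (if m + s \<le> Suc k \<and> j \<le> m then B k j x else 0) * Y j x))"
    unfolding companion_sum[OF assms(2)] using assms(2) by (intro ext) auto
  then show ?thesis using system_acd[OF assms] by (simp only:)
qed

definition assoc_entries :: "matfun \<Rightarrow> nat \<Rightarrow> nat \<Rightarrow> real \<Rightarrow> complex" where
  "assoc_entries F k j = F (Suc k) (Suc j)"

locale order_params =
  fixes m s n :: nat
  assumes m: "1 \<le> m" and s: "s \<in> {0, 1}" and n: "n = 2 * m + s"
begin

lemma entries_integrable:
  assumes F: "F \<in> matfun_class m s" and "k < n" "m + s \<le> Suc k" "j \<le> m" "j \<le> k"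
  shows "integrable leb01 (assoc_entries F k j)"
proof (cases "s = 0")
  case True
  have F': "\<And>k j. k \<in> {m+1..n} \<Longrightarrow> j \<in> {1..m} \<Longrightarrow> F k j \<in> Lp01 1"
      "\<And>j. j \<in> {1..m} \<Longrightarrow> F m j \<in> Lp01 2" "\<And>k. k \<in> {m+1..n} \<Longrightarrow> F k (m+1) \<in> Lp01 2"
    using F True m unfolding matfun_class_def Let_def n by force+
  consider "Suc k = m" | "Suc k > m" "j < m" | "Suc k > m" "j = m" using assms True by linarith
  then show ?thesis
  proof cases
    case 1
    then show ?thesis using F'(2)[of "Suc j"] assms by (simp add: assoc_entries_def Lp01_2_integrable)
  next
    case 2
    then show ?thesis using F'(1)[of "Suc k" "Suc j"] assms by (simp add: assoc_entries_def Lp01_1_iff[unfolded One_nat_def])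
  next
    case 3
    then show ?thesis using F'(3)[of "Suc k"] assms by (simp add: assoc_entries_def Lp01_2_integrable)
  qed
next
  case False
  then have "s = 1" using s by auto
  then have "\<forall>k \<in> {m+1..n}. \<forall>j \<in> {1..m+1}. F k j \<in> Lp01 1"
    using F unfolding matfun_class_def Let_def n by simp
  then show ?thesis using assms \<open>s = 1\<close> by (simp add: assoc_entries_def Lp01_1_iff[unfolded One_nat_def])
qed

lemma entries_zero:
  assumes F: "F \<in> matfun_class m s" and "k < n" "j < n" "\<not> (m + s \<le> Suc k \<and> j \<le> m)"
  shows "aeq (assoc_entries F k j) (\<lambda>_. 0)"
proof -
  have "\<forall>k \<in> {1..n}. \<forall>j \<in> {1..n}. k < m + s \<or> j > m + 1 \<longrightarrow> aeq (F k j) (\<lambda>_. 0)"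
    using F s unfolding matfun_class_def Let_def n by (cases "s = 0") auto
  then have "Suc k < m + s \<or> Suc j > m + 1 \<longrightarrow> aeq (F (Suc k) (Suc j)) (\<lambda>_. 0)" using assms(2,3) by auto
  then show ?thesis using assms(4) unfolding assoc_entries_def by linarith
qed

lemma companion_integrable:
  assumes "F \<in> matfun_class m s" "k < n" "j < n"
  shows "integrable leb01 (companion m s (assoc_entries F) k j)"
proof -
  consider "j = Suc k" | "j \<noteq> Suc k" "m + s \<le> Suc k \<and> j \<le> m \<and> j \<le> k" | "j \<noteq> Suc k" "\<not> (m + s \<le> Suc k \<and> j \<le> m \<and> j \<le> k)" by blast
  then show ?thesis
  proof cases
    case 1
    then have "companion m s (assoc_entries F) k j = (\<lambda>_. 1)" by (auto simp: companion_def)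
    then show ?thesis using continuous_integrable_01[OF continuous_on_const] by simp
  next
    case 2
    then have "companion m s (assoc_entries F) k j = assoc_entries F k j" by (auto simp: companion_def)
    then show ?thesis using entries_integrable[of F k j] assms 2 by simp
  next
    case 3
    then have "companion m s (assoc_entries F) k j = (\<lambda>_. 0)" by (auto simp: companion_def)
    then show ?thesis by simp
  qed
qed

text \<open>The matrix class prescribes its zeros only almost everywhere, while
  \<open>companion\<close> has literal zeros; this reconciles the two.\<close>

lemma quasi_sum_aeq:
  assumes F: "F \<in> matfun_class m s" and k: "k < n"
  shows "aeq (\<lambda>x. \<Sum>j\<in>{1..Suc k}. F (Suc k) j x * q (j - 1) x)
     (\<lambda>x. \<Sum>j\<le>k. (if m + s \<le> Suc k \<and> j \<le> m then assoc_entries F k j x else 0) * q j x)"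
proof -
  have "AE x in leb01. \<forall>j\<in>{..k}. assoc_entries F k j x = (if m + s \<le> Suc k \<and> j \<le> m then assoc_entries F k j x else 0)"
  proof (rule AE_finite_allI)
    fix j assume "j \<in> {..k}"
    then have "j < n" using k by simp
    then show "AE x in leb01. assoc_entries F k j x = (if m + s \<le> Suc k \<and> j \<le> m then assoc_entries F k j x else 0)"
      using entries_zero[OF F k] by (cases "m + s \<le> Suc k \<and> j \<le> m") auto
  qed simp
  then show ?thesis
  proof eventually_elim
    case (elim x)
    have "(\<Sum>j\<in>{1..Suc k}. F (Suc k) j x * q (j - 1) x) = (\<Sum>j\<le>k. assoc_entries F k j x * q j x)"
      unfolding assoc_entries_def by (rule sum.reindex_bij_witness[of _ Suc "\<lambda>j. j - 1"]) auto
    also have "\<dots> = (\<Sum>j\<le>k. (if m + s \<le> Suc k \<and> j \<le> m then assoc_entries F k j x else 0) * q j x)"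
      using elim by (intro sum.cong refl) (metis atMost_iff)
    finally show ?case .
  qed
qed

lemma entries_sum_measurable:
  assumes F: "F \<in> matfun_class m s" and k: "k < n" and q: "\<And>j. j \<le> k \<Longrightarrow> continuous_on {0..1} (q j)"
  shows "integrable leb01 (\<lambda>x. \<Sum>j\<le>k. (if m + s \<le> Suc k \<and> j \<le> m then assoc_entries F k j x else 0) * q j x)"
proof (rule Bochner_Integration.integrable_sum)
  fix j assume j: "j \<in> {..k}"
  show "integrable leb01 (\<lambda>x. (if m + s \<le> Suc k \<and> j \<le> m then assoc_entries F k j x else 0) * q j x)"
  proof (cases "m + s \<le> Suc k \<and> j \<le> m")
    case True
    then have "integrable leb01 (\<lambda>x. q j x * assoc_entries F k j x)"
      using j by (intro continuous_times_integrable q entries_integrable F k) auto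
    then show ?thesis using True by (simp add: mult.commute)
  next
    case False
    then have "(\<lambda>x. (if m + s \<le> Suc k \<and> j \<le> m then assoc_entries F k j x else 0) * q j x) = (\<lambda>_. 0)" by auto
    then show ?thesis by simp
  qed
qed

text \<open>Solving the definition of y^[k+1] for the derivative of y^[k] gives row k. The last
  quasi-derivative is merely integrable and becomes the inhomogeneity.\<close>

lemma qdomain_system:
  assumes F: "F \<in> matfun_class m s" and y: "y \<in> qdomain n F"
  shows "integrable leb01 (quasi F y n)"
    "system n (companion m s (assoc_entries F)) (quasi F y n) (quasi F y)"
proof -
  let ?S = "\<lambda>k x. \<Sum>j\<le>k. (if m + s \<le> Suc k \<and> j \<le> m then assoc_entries F k j x else 0) * quasi F y j x"
  have W: "\<exists>v. acd (quasi F y k) v" if "k < n" for k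
    using y that unfolding qdomain_def W11_iff by blast
  then have co: "continuous_on {0..1} (quasi F y k)" if "k < n" for k
    using acd_continuous that by blast
  have S: "integrable leb01 (?S k)" if "k < n" for k
    using entries_sum_measurable[OF F that, of "quasi F y"] co that by simp
  have step: "aeq (quasi F y (Suc k)) (\<lambda>x. v x - ?S k x)" if k: "k < n" and v: "acd (quasi F y k) v" for k v
    using cont_rep_aeq[of "\<lambda>x. sderiv (quasi F y k) x - (\<Sum>j\<in>{1..Suc k}. F (Suc k) j x * quasi F y (j - 1) x)"]
      sderiv_aeq[OF acd_has_sderiv[OF v]] quasi_sum_aeq[OF F k, of "quasi F y"]
    unfolding quasi.simps by eventually_elim simp
  have q: "integrable leb01 (quasi F y (Suc k))" if k: "k < n" for k
  proof -
    obtain v where v: "acd (quasi F y k) v" using W[OF k] by blast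
    have i: "integrable leb01 (\<lambda>x. v x - ?S k x)"
      by (rule Bochner_Integration.integrable_diff[OF acd_integrable[OF v] S[OF k]])
    note mm = aeq_measurable[OF step[OF k v] borel_measurable_integrable[OF i]]
    show ?thesis using integrable_cong_AE[OF mm borel_measurable_integrable[OF i] step[OF k v]] i by simp
  qed
  have "n \<noteq> 0" using n m by simp
  then obtain n' where n': "n = Suc n'" by (rule not0_implies_Suc[THEN exE])
  show "integrable leb01 (quasi F y n)" using q[of n'] n' by simp
  show "system n (companion m s (assoc_entries F)) (quasi F y n) (quasi F y)"
    unfolding system_def
  proof (intro allI impI)
    fix k assume k: "k < n"
    obtain v where v: "acd (quasi F y k) v" using W[OF k] by blast
    have e: "(\<lambda>x. (\<Sum>j<n. companion m s (assoc_entries F) k j x * quasi F y j x) + (if Suc k = n then quasi F y n x else 0))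
       = (\<lambda>x. quasi F y (Suc k) x + ?S k x)"
      unfolding companion_sum[OF k] using k by (rule_tac ext) (auto simp del: quasi.simps)
    show "acd (quasi F y k) (\<lambda>x. (\<Sum>j<n. companion m s (assoc_entries F) k j x * quasi F y j x) + (if Suc k = n then quasi F y n x else 0))"
      unfolding e
    proof (rule acd_deriv_cong[OF v])
      show "aeq v (\<lambda>x. quasi F y (Suc k) x + ?S k x)" using step[OF k v] by eventually_elim simp
    qed
  qed
qed

text \<open>Converse of the previous translation. Each quasi-derivative is a continuous
  representative, so the induction has to identify it with \<open>Y k\<close> at every point of
  [0,1] and not just almost everywhere. Only the values of \<open>y\<close> on [0,1] are
  given.\<close>

lemma system_qdomain:
  assumes F: "F \<in> matfun_class m s"
    and Y: "system n (companion m s (assoc_entries F)) f Y" and y: "\<And>x. x \<in> {0..1} \<Longrightarrow> y x = Y 0 x"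
  shows "y \<in> qdomain n F" "\<And>k x. k < n \<Longrightarrow> x \<in> {0..1} \<Longrightarrow> quasi F y k x = Y k x" "aeq (quasi F y n) f"
proof -
  let ?S = "\<lambda>q k x. \<Sum>j\<le>k. (if m + s \<le> Suc k \<and> j \<le> m then assoc_entries F k j x else 0) * q j x"
  let ?h = "\<lambda>k x. sderiv (quasi F y k) x - (\<Sum>j\<in>{1..Suc k}. F (Suc k) j x * quasi F y (j - 1) x)"
  have Yk: "acd (Y k) (\<lambda>x. (if Suc k < n then Y (Suc k) x else f x) + ?S Y k x)" if k: "k < n" for k
    by (rule system_companion_acd[OF Y k])
  have step: "aeq (?h k) (\<lambda>x. if Suc k < n then Y (Suc k) x else f x)"
    if k: "k < n" and q: "\<And>j x. j \<le> k \<Longrightarrow> x \<in> {0..1} \<Longrightarrow> quasi F y j x = Y j x" for k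
  proof -
    have "aeq (quasi F y k) (Y k)" by (rule AE_I2) (use q in simp)
    then have "has_sderiv (quasi F y k) (\<lambda>x. (if Suc k < n then Y (Suc k) x else f x) + ?S Y k x)"
      using has_sderiv_cong acd_has_sderiv[OF Yk[OF k]] by blast
    from sderiv_aeq[OF this] quasi_sum_aeq[OF F k, of "quasi F y"] AE_space
    show ?thesis
    proof eventually_elim
      case (elim x)
      have "?S (quasi F y) k x = ?S Y k x" by (intro sum.cong refl) (use q elim(3) in auto)
      then show ?case using elim(1,2) by simp
    qed
  qed
  have main: "\<forall>j\<le>k. j < n \<longrightarrow> (\<forall>x\<in>{0..1}. quasi F y j x = Y j x)" for k
  proof (induction k)
    case 0
    then show ?case using y by simp
  next
    case (Suc k)
    show ?case
    proof (intro allI impI ballI)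
      fix j and x :: real assume j: "j \<le> Suc k" "j < n" and x: "x \<in> {0..1}"
      show "quasi F y j x = Y j x"
      proof (cases "j = Suc k")
        case True
        have st: "aeq (?h k) (Y (Suc k))"
          using step[of k] Suc.IH True j by simp
        have "cont_rep (?h k) x = Y (Suc k) x"
        proof (rule cont_rep_eq[OF _ _ x])
          show "continuous_on {0..1} (Y (Suc k))" using acd_continuous[OF Yk] True j by simp
          show "aeq (Y (Suc k)) (?h k)" using st by eventually_elim simp
        qed
        then show ?thesis using True by simp
      qed (use Suc.IH j x in simp)
    qed
  qed
  then show q: "quasi F y k x = Y k x" if "k < n" "x \<in> {0..1}" for k x using that by blast
  show "y \<in> qdomain n F" unfolding qdomain_def W11_iff mem_Collect_eq
  proof (intro allI impI)
    fix k assume k: "k < n"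
    have "acd (quasi F y k) (\<lambda>x. (if Suc k < n then Y (Suc k) x else f x) + ?S Y k x)"
      by (rule acd_cong[OF Yk[OF k]]) (use q[OF k] acd_integrable[OF Yk[OF k]] in auto)
    then show "\<exists>v. acd (quasi F y k) v" by blast
  qed
  have "n \<noteq> 0" using n m by simp
  then obtain n' where n': "n = Suc n'" by (rule not0_implies_Suc[THEN exE])
  have "aeq (?h n') f" using step[of n'] q n' by simp
  then show "aeq (quasi F y n) f" unfolding n' quasi.simps
    using cont_rep_aeq[of "?h n'"] by eventually_elim simp
qed

end

section \<open>The differential expression as a bilinear form\<close>

lemma Lp01_zero: "(\<lambda>_. 0) \<in> Lp01 p"
  by (cases p) (auto simp: Lp01_def continuous_integrable_01[OF continuous_on_const]
    intro!: finite_measure.integrable_const finite_measure_lebesgue_on)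

lemma Lp01_cmult: "f \<in> Lp01 p \<Longrightarrow> (\<lambda>x. c * f x) \<in> Lp01 p"
  by (auto simp: Lp01_def norm_mult power_mult_distrib)

lemma Lp01_1_add: "f \<in> Lp01 1 \<Longrightarrow> g \<in> Lp01 1 \<Longrightarrow> (\<lambda>x. f x + g x) \<in> Lp01 1"
  unfolding Lp01_1_iff by (rule Bochner_Integration.integrable_add)

lemma Lp01_2_add:
  assumes "f \<in> Lp01 2" "g \<in> Lp01 2"
  shows "(\<lambda>x. f x + g x) \<in> Lp01 2"
proof -
  have m: "(\<lambda>x. f x + g x) \<in> borel_measurable leb01" using assms by (auto simp: Lp01_def)
  have "integrable leb01 (\<lambda>x. cmod (f x + g x) ^ 2)"
  proof (rule Bochner_Integration.integrable_bound)
    show "integrable leb01 (\<lambda>x. 2 * (cmod (f x) ^ 2 + cmod (g x) ^ 2))" using assms by (auto simp: Lp01_def)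
    show "(\<lambda>x. cmod (f x + g x) ^ 2) \<in> borel_measurable leb01" using m by auto
    show "AE x in leb01. norm (cmod (f x + g x) ^ 2) \<le> norm (2 * (cmod (f x) ^ 2 + cmod (g x) ^ 2))"
    proof (rule AE_I2)
      fix x
      have "cmod (f x + g x) ^ 2 \<le> (cmod (f x) + cmod (g x)) ^ 2" by (intro power_mono norm_triangle_ineq) simp
      also have "\<dots> \<le> 2 * (cmod (f x) ^ 2 + cmod (g x) ^ 2)"
        using sum_squares_bound[of "cmod (f x)" "cmod (g x)"] by (simp add: power2_sum)
      finally show "norm (cmod (f x + g x) ^ 2) \<le> norm (2 * (cmod (f x) ^ 2 + cmod (g x) ^ 2))" by simp
    qed
  qed
  then show ?thesis using m by (simp add: Lp01_def)
qed

text \<open>The antiderivative \<sigma> is fixed once for \<tau>, before g and z. This is what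
  allows one set of form coefficients to serve all functions y.\<close>

lemma distrib_mult_eq:
  assumes "\<tau> \<in> W_neg p i"
  obtains \<sigma> where "\<sigma> \<in> Lp01 p"
    "\<And>g z. z \<in> test_functions \<Longrightarrow> distrib_mult p i \<tau> g z = (- 1) ^ i * (LINT x|leb01. \<sigma> x * (sderiv ^^ i) (\<lambda>t. g t * z t) x)"
proof -
  define \<sigma> where "\<sigma> = (SOME \<sigma>. \<sigma> \<in> Lp01 p \<and> \<tau> = distrib_deriv i (regular_distrib \<sigma>))"
  have "\<exists>\<sigma>. \<sigma> \<in> Lp01 p \<and> \<tau> = distrib_deriv i (regular_distrib \<sigma>)"
    using assms unfolding W_neg_def by blast
  from someI_ex[OF this] have "\<sigma> \<in> Lp01 p" unfolding \<sigma>_def by blast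
  then show ?thesis by (rule that) (simp add: distrib_mult_def Let_def \<sigma>_def)
qed

text \<open>Pascal's rule, as needed in the induction step of the Leibniz formula.\<close>

lemma leibniz_sum:
  fixes p q :: "nat \<Rightarrow> complex"
  shows "(\<Sum>l\<le>j. of_nat (j choose l) * (p (Suc l) * q (j - l) + p l * q (Suc (j - l))))
    = (\<Sum>l\<le>Suc j. of_nat (Suc j choose l) * (p l * q (Suc j - l)))"
proof -
  define f where "f = (\<lambda>l. p l * q (Suc j - l))"
  have "(\<Sum>l\<le>Suc j. of_nat (Suc j choose l) * f l) = f 0 + (\<Sum>l\<le>j. of_nat (Suc j choose Suc l) * f (Suc l))"
    by (simp only: sum.atMost_Suc_shift) simp
  also have "\<dots> = (f 0 + (\<Sum>l\<le>j. of_nat (j choose Suc l) * f (Suc l))) + (\<Sum>l\<le>j. of_nat (j choose l) * f (Suc l))"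
    by (simp add: sum.distrib algebra_simps)
  also have "f 0 + (\<Sum>l\<le>j. of_nat (j choose Suc l) * f (Suc l)) = (\<Sum>l\<le>Suc j. of_nat (j choose l) * f l)"
    by (simp only: sum.atMost_Suc_shift) simp
  also have "\<dots> = (\<Sum>l\<le>j. of_nat (j choose l) * f l)" by simp
  also have "\<dots> + (\<Sum>l\<le>j. of_nat (j choose l) * f (Suc l))
     = (\<Sum>l\<le>j. of_nat (j choose l) * (p (Suc l) * q (j - l) + p l * q (Suc (j - l))))"
    unfolding sum.distrib[symmetric]
    by (intro sum.cong refl) (auto simp: f_def Suc_diff_le algebra_simps)
  finally show ?thesis by (simp add: f_def)
qed

text \<open>\<open>w a\<close> is the \<open>a\<close>-th derivative of \<open>w 0\<close>. The last one is only required to have integrable products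
  with the antiderivatives of the coefficients, which covers \<open>L\<^sub>2\<close> (even order) as well as continuous
  functions (odd order).\<close>

definition jet :: "nat \<Rightarrow> nat \<Rightarrow> (nat \<Rightarrow> real \<Rightarrow> complex) \<Rightarrow> bool" where
  "jet m s w \<longleftrightarrow> (\<forall>a<m. acd (w a) (w (Suc a))) \<and>
     (\<forall>a\<le>m. \<forall>\<sigma>\<in>Lp01 (2 - s). integrable leb01 (\<lambda>x. \<sigma> x * w a x))"

text \<open>The Leibniz sums form a chain of derivatives. The bound k + i <= m ensures that the last
  member of the jet, which need not be differentiable, is never differentiated.\<close>

lemma jet_leibniz:
  assumes w: "jet m s w" and ki: "k + i \<le> m" and g: "aeq g (w k)" and z: "z \<in> test_functions"
  shows "aeq ((sderiv ^^ i) (\<lambda>t. g t * z t))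
     (\<lambda>x. \<Sum>l\<le>i. of_nat (i choose l) * (w (k + l) x * (cderiv ^^ (i - l)) z x))"
proof (rule sderiv_funpow_aeq[where w = "\<lambda>i x. \<Sum>l\<le>i. of_nat (i choose l) * (w (k + l) x * (cderiv ^^ (i - l)) z x)"])
  show "aeq (\<lambda>t. g t * z t) (\<lambda>x. \<Sum>l\<le>0. of_nat (0 choose l) * (w (k + l) x * (cderiv ^^ (0 - l)) z x))"
    using g by eventually_elim simp
  fix j assume j: "j < i"
  have "acd (\<lambda>x. \<Sum>l\<le>j. of_nat (j choose l) * (w (k + l) x * (cderiv ^^ (j - l)) z x))
     (\<lambda>x. \<Sum>l\<le>j. of_nat (j choose l) * (w (Suc (k + l)) x * (cderiv ^^ (j - l)) z x + w (k + l) x * cderiv ((cderiv ^^ (j - l)) z) x))"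
  proof (rule acd_sum, rule acd_cmult, rule acd_mult)
    fix l assume "l \<in> {..j}"
    then show "acd (w (k + l)) (w (Suc (k + l)))" using w j ki by (simp add: jet_def)
    show "acd ((cderiv ^^ (j - l)) z) (cderiv ((cderiv ^^ (j - l)) z))" by (rule test_acd[OF test_funpow[OF z]])
  qed
  moreover have "(\<Sum>l\<le>j. of_nat (j choose l) * (w (Suc (k + l)) x * (cderiv ^^ (j - l)) z x + w (k + l) x * cderiv ((cderiv ^^ (j - l)) z) x))
     = (\<Sum>l\<le>Suc j. of_nat (Suc j choose l) * (w (k + l) x * (cderiv ^^ (Suc j - l)) z x))" for x
    using leibniz_sum[of j "\<lambda>l. w (k + l) x" "\<lambda>i. (cderiv ^^ i) z x"] by simp
  ultimately show "acd (\<lambda>x. \<Sum>l\<le>j. of_nat (j choose l) * (w (k + l) x * (cderiv ^^ (j - l)) z x))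
     (\<lambda>x. \<Sum>l\<le>Suc j. of_nat (Suc j choose l) * (w (k + l) x * (cderiv ^^ (Suc j - l)) z x))" by (simp only:)
qed

definition form_value :: "nat \<Rightarrow> (nat \<Rightarrow> nat \<Rightarrow> real \<Rightarrow> complex) \<Rightarrow> (nat \<Rightarrow> real \<Rightarrow> complex) \<Rightarrow> (real \<Rightarrow> complex) \<Rightarrow> complex" where
  "form_value m c w z = (\<Sum>b\<le>m. \<Sum>a\<le>m. LINT x|leb01. c a b x * w a x * (cderiv ^^ b) z x)"

text \<open>In even order a term with y^(m) and z^(m) would put y^(m) on both sides of the relation
  between y^(m) and the canonical component \<open>Z m\<close>. Its absence makes that relation
  explicitly solvable for y^(m).\<close>

definition form_coeffs :: "nat \<Rightarrow> nat \<Rightarrow> (nat \<Rightarrow> nat \<Rightarrow> real \<Rightarrow> complex) \<Rightarrow> bool" where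
  "form_coeffs m s c \<longleftrightarrow> (\<forall>a b. c a b \<in> Lp01 (2 - s)) \<and> (s = 0 \<longrightarrow> c m m = (\<lambda>_. 0))"

text \<open>The coefficients of the forms are never computed: the class of forms is closed under linear
  combinations, and \<open>s = 0 \<longrightarrow> c m m = 0\<close> is all that is needed about them.\<close>

definition lower_form :: "nat \<Rightarrow> nat \<Rightarrow> ((nat \<Rightarrow> real \<Rightarrow> complex) \<Rightarrow> (real \<Rightarrow> complex) \<Rightarrow> complex) \<Rightarrow> bool" where
  "lower_form m s T \<longleftrightarrow> (\<exists>c. form_coeffs m s c \<and>
     (\<forall>w z. jet m s w \<longrightarrow> z \<in> test_functions \<longrightarrow> T w z = form_value m c w z))"

context order_params
begin

lemma Lp01_add: "f \<in> Lp01 (2 - s) \<Longrightarrow> g \<in> Lp01 (2 - s) \<Longrightarrow> (\<lambda>x. f x + g x) \<in> Lp01 (2 - s)"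
  using s Lp01_1_add Lp01_2_add by (cases "s = 0") (auto simp: numeral_2_eq_2)

lemma Lp01_integrable: "f \<in> Lp01 (2 - s) \<Longrightarrow> integrable leb01 f"
  using s Lp01_1_iff[of f] Lp01_2_integrable[of f] by (cases "s = 0") (auto simp: numeral_2_eq_2)

lemma form_term_integrable:
  assumes "jet m s w" "z \<in> test_functions" "\<sigma> \<in> Lp01 (2 - s)" "a \<le> m"
  shows "integrable leb01 (\<lambda>x. \<sigma> x * w a x * (cderiv ^^ b) z x)"
  by (rule test_integrable_mult[OF _ test_funpow[OF assms(2)]]) (use assms in \<open>simp add: jet_def\<close>)

lemma lower_form_single:
  assumes \<sigma>: "\<sigma> \<in> Lp01 (2 - s)" and ab: "a \<le> m" "b \<le> m" "s = 0 \<Longrightarrow> a < m \<or> b < m"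
  shows "lower_form m s (\<lambda>w z. LINT x|leb01. \<sigma> x * w a x * (cderiv ^^ b) z x)"
proof -
  define c where "c = (\<lambda>a' b'. if a' = a \<and> b' = b then \<sigma> else (\<lambda>_. 0))"
  have "form_coeffs m s c" unfolding form_coeffs_def c_def using \<sigma> ab Lp01_zero by auto
  moreover have "(LINT x|leb01. \<sigma> x * w a x * (cderiv ^^ b) z x) = form_value m c w z" for w z
  proof -
    let ?I = "LINT x|leb01. \<sigma> x * w a x * (cderiv ^^ b) z x"
    have "(LINT x|leb01. c a' b' x * w a' x * (cderiv ^^ b') z x) = (if a' = a then if b' = b then ?I else 0 else 0)" for a' b'
      by (simp add: c_def)
    then have "form_value m c w z = (\<Sum>b'\<le>m. \<Sum>a'\<le>m. if a' = a then if b' = b then ?I else 0 else 0)"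
      unfolding form_value_def by (simp only:)
    then show ?thesis using ab by simp
  qed
  ultimately show ?thesis unfolding lower_form_def by blast
qed

lemma lower_form_zero: "lower_form m s (\<lambda>w z. 0)"
  unfolding lower_form_def
  by (rule exI[of _ "\<lambda>_ _ _. 0"]) (simp add: form_coeffs_def form_value_def Lp01_zero)

lemma lower_form_add:
  assumes "lower_form m s T" "lower_form m s U"
  shows "lower_form m s (\<lambda>w z. T w z + U w z)"
proof -
  obtain c where c: "form_coeffs m s c" "\<And>w z. jet m s w \<Longrightarrow> z \<in> test_functions \<Longrightarrow> T w z = form_value m c w z"
    using assms(1) unfolding lower_form_def by blast
  obtain d where d: "form_coeffs m s d" "\<And>w z. jet m s w \<Longrightarrow> z \<in> test_functions \<Longrightarrow> U w z = form_value m d w z"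
    using assms(2) unfolding lower_form_def by blast
  have "form_coeffs m s (\<lambda>a b x. c a b x + d a b x)"
    using c(1) d(1) Lp01_add unfolding form_coeffs_def by simp
  moreover have "T w z + U w z = form_value m (\<lambda>a b x. c a b x + d a b x) w z"
    if w: "jet m s w" and z: "z \<in> test_functions" for w z
  proof -
    have "(LINT x|leb01. (c a b x + d a b x) * w a x * (cderiv ^^ b) z x)
      = (LINT x|leb01. c a b x * w a x * (cderiv ^^ b) z x) + (LINT x|leb01. d a b x * w a x * (cderiv ^^ b) z x)"
      if "a \<le> m" for a b
      using form_term_integrable[OF w z _ that, of "c a b" b] form_term_integrable[OF w z _ that, of "d a b" b] c(1) d(1)
      by (simp add: form_coeffs_def distrib_right)
    then show ?thesis unfolding c(2)[OF w z] d(2)[OF w z] form_value_def by (simp add: sum.distrib)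
  qed
  ultimately show ?thesis unfolding lower_form_def by blast
qed

lemma lower_form_cmult:
  assumes "lower_form m s T"
  shows "lower_form m s (\<lambda>w z. r * T w z)"
proof -
  obtain c where c: "form_coeffs m s c" "\<And>w z. jet m s w \<Longrightarrow> z \<in> test_functions \<Longrightarrow> T w z = form_value m c w z"
    using assms(1) unfolding lower_form_def by blast
  have "form_coeffs m s (\<lambda>a b x. r * c a b x)"
    using c(1) Lp01_cmult unfolding form_coeffs_def by simp
  moreover have "r * T w z = form_value m (\<lambda>a b x. r * c a b x) w z"
    if "jet m s w" "z \<in> test_functions" for w z
    unfolding c(2)[OF that] form_value_def sum_distrib_left by (simp add: mult.assoc)
  ultimately show ?thesis unfolding lower_form_def by blast
qed

lemma lower_form_sum:
  assumes "\<And>i. i \<in> I \<Longrightarrow> lower_form m s (T i)"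
  shows "lower_form m s (\<lambda>w z. \<Sum>i\<in>I. T i w z)"
  using assms by (induction I rule: infinite_finite_induct) (simp_all add: lower_form_zero lower_form_add)

lemma lower_form_cong:
  assumes "lower_form m s T" "\<And>w z. jet m s w \<Longrightarrow> z \<in> test_functions \<Longrightarrow> U w z = T w z"
  shows "lower_form m s U"
  using assms unfolding lower_form_def by metis

text \<open>The Leibniz terms have order k + l in y and i - l + k' in z. Order m in y forces l = i
  and k + i = m, and then the order in z is k'; the last hypothesis is therefore what excludes the
  pair (m, m).\<close>

lemma lower_form_product:
  assumes \<sigma>: "\<sigma> \<in> Lp01 (2 - s)" and k: "k + i \<le> m" "k' + i \<le> m" "s = 0 \<Longrightarrow> k + i < m \<or> k' < m"
  shows "lower_form m s (\<lambda>w z. LINT x|leb01. \<sigma> x * (sderiv ^^ i) (\<lambda>t. (sderiv ^^ k) (w 0) t * (cderiv ^^ k') z t) x)"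
proof (rule lower_form_cong)
  show "lower_form m s (\<lambda>w z. \<Sum>l\<le>i. of_nat (i choose l) * (LINT x|leb01. \<sigma> x * w (k + l) x * (cderiv ^^ (i - l + k')) z x))"
    by (intro lower_form_sum lower_form_cmult lower_form_single \<sigma>) (use k in auto)
  fix w z assume w: "jet m s w" and z: "z \<in> test_functions"
  have "aeq ((sderiv ^^ k) (w 0)) (w k)"
    by (rule sderiv_funpow_aeq) (use w k in \<open>auto simp: jet_def\<close>)
  from jet_leibniz[OF w k(1) this test_funpow[OF z, of k']]
  have ae: "aeq (\<lambda>x. \<sigma> x * (sderiv ^^ i) (\<lambda>t. (sderiv ^^ k) (w 0) t * (cderiv ^^ k') z t) x)
     (\<lambda>x. \<Sum>l\<le>i. of_nat (i choose l) * (\<sigma> x * w (k + l) x * (cderiv ^^ (i - l + k')) z x))"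
    by eventually_elim (simp only: funpow_add comp_def sum_distrib_left mult.assoc mult.left_commute)
  have i: "integrable leb01 (\<lambda>x. \<sigma> x * w (k + l) x * (cderiv ^^ (i - l + k')) z x)" if "l \<le> i" for l
    by (rule form_term_integrable[OF w z \<sigma>]) (use k that in auto)
  have i2: "integrable leb01 (\<lambda>x. \<Sum>l\<le>i. of_nat (i choose l) * (\<sigma> x * w (k + l) x * (cderiv ^^ (i - l + k')) z x))"
    by (intro Bochner_Integration.integrable_sum integrable_mult_right i) auto
  note mb = borel_measurable_integrable[OF i2]
  have "(LINT x|leb01. \<sigma> x * (sderiv ^^ i) (\<lambda>t. (sderiv ^^ k) (w 0) t * (cderiv ^^ k') z t) x)
     = (LINT x|leb01. (\<Sum>l\<le>i. of_nat (i choose l) * (\<sigma> x * w (k + l) x * (cderiv ^^ (i - l + k')) z x)))"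
    by (rule integral_cong_AE[OF aeq_measurable[OF ae mb] mb ae])
  also have "\<dots> = (\<Sum>l\<le>i. LINT x|leb01. of_nat (i choose l) * (\<sigma> x * w (k + l) x * (cderiv ^^ (i - l + k')) z x))"
    by (rule Bochner_Integration.integral_sum) (use i in auto)
  also have "\<dots> = (\<Sum>l\<le>i. of_nat (i choose l) * (LINT x|leb01. \<sigma> x * w (k + l) x * (cderiv ^^ (i - l + k')) z x))"
    by simp
  finally show "(LINT x|leb01. \<sigma> x * (sderiv ^^ i) (\<lambda>t. (sderiv ^^ k) (w 0) t * (cderiv ^^ k') z t) x)
     = (\<Sum>l\<le>i. of_nat (i choose l) * (LINT x|leb01. \<sigma> x * w (k + l) x * (cderiv ^^ (i - l + k')) z x))" .
qed

lemma lower_form_distrib_term: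
  assumes \<tau>: "\<tau> \<in> W_neg (2 - s) i" and k: "k + i \<le> m" "k' + i \<le> m" "s = 0 \<Longrightarrow> k + i < m \<or> k' < m"
  shows "lower_form m s (\<lambda>w. distrib_deriv k' (distrib_mult (2 - s) i \<tau> ((sderiv ^^ k) (w 0))))"
proof -
  obtain \<sigma> where \<sigma>: "\<sigma> \<in> Lp01 (2 - s)"
    "\<And>g z. z \<in> test_functions \<Longrightarrow> distrib_mult (2 - s) i \<tau> g z = (- 1) ^ i * (LINT x|leb01. \<sigma> x * (sderiv ^^ i) (\<lambda>t. g t * z t) x)"
    using distrib_mult_eq[OF \<tau>] by blast
  show ?thesis
  proof (rule lower_form_cong)
    show "lower_form m s (\<lambda>w z. (- 1) ^ k' * ((- 1) ^ i * (LINT x|leb01. \<sigma> x * (sderiv ^^ i) (\<lambda>t. (sderiv ^^ k) (w 0) t * (cderiv ^^ k') z t) x)))"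
      by (intro lower_form_cmult lower_form_product \<sigma>(1) k)
    fix w :: "nat \<Rightarrow> real \<Rightarrow> complex" and z assume z: "z \<in> test_functions"
    show "distrib_deriv k' (distrib_mult (2 - s) i \<tau> ((sderiv ^^ k) (w 0))) z
      = (- 1) ^ k' * ((- 1) ^ i * (LINT x|leb01. \<sigma> x * (sderiv ^^ i) (\<lambda>t. (sderiv ^^ k) (w 0) t * (cderiv ^^ k') z t) x))"
      using z \<sigma>(2)[OF test_funpow[OF z]] by (simp add: distrib_deriv_def)
  qed
qed

text \<open>The singularity order of a coefficient plus the larger number of derivatives on either
  side of it is m: k + (m - k) for even indices and (k + 1) + (m - k - 1) for odd ones. So no order
  above m arises outside the leading term.\<close>

lemma diff_expr_form:
  assumes \<tau>: "\<tau> \<in> coeffs_class m s"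
  obtains c where "form_coeffs m s c"
    "\<And>w z. jet m s w \<Longrightarrow> z \<in> test_functions \<Longrightarrow>
       diff_expr m s \<tau> (w 0) z = (- 1) ^ n * (LINT x|leb01. w 0 x * (cderiv ^^ n) z x) + form_value m c w z"
proof -
  let ?P = "\<lambda>\<nu> g. distrib_mult (2 - s) (sing_order m \<nu>) (\<tau> \<nu>) g"
  let ?T = "\<lambda>w z. (\<Sum>k<m + s. (- 1) ^ k * distrib_deriv k (?P (2 * k) ((sderiv ^^ k) (w 0))) z)
        + (\<Sum>k<m. (- 1) ^ (k + 1) *
             (distrib_deriv (k + 1) (?P (2 * k + 1) ((sderiv ^^ k) (w 0))) z
              + distrib_deriv k (?P (2 * k + 1) ((sderiv ^^ (k + 1)) (w 0))) z))"
  have W: "\<tau> \<nu> \<in> W_neg (2 - s) (sing_order m \<nu>)" if "\<nu> < n" for \<nu>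
    using \<tau> that unfolding coeffs_class_def n by blast
  have so: "sing_order m (2 * k) = m - k" "sing_order m (2 * k + 1) = m - k - 1" for k
    by (simp_all add: sing_order_def)
  have "lower_form m s ?T"
  proof (intro lower_form_add lower_form_sum lower_form_cmult lower_form_distrib_term W)
    fix k assume "k \<in> {..<m + s}"
    then have k: "k < m + s" by simp
    have "k \<le> m" using k s by auto
    then show "k + sing_order m (2 * k) \<le> m" "k + sing_order m (2 * k) \<le> m" by (simp_all add: so)
    show "2 * k < n" using k s n by auto
    show "k + sing_order m (2 * k) < m \<or> k < m" if "s = 0" using that k by simp
  next
    fix k assume "k \<in> {..<m}"
    then have k: "k < m" by simp
    then show "2 * k + 1 < n" "2 * k + 1 < n" using n by auto
    show "k + sing_order m (2 * k + 1) \<le> m" "k + 1 + sing_order m (2 * k + 1) \<le> m"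
      "k + 1 + sing_order m (2 * k + 1) \<le> m" "k + sing_order m (2 * k + 1) \<le> m"
      "k + sing_order m (2 * k + 1) < m \<or> k + 1 < m" "k + 1 + sing_order m (2 * k + 1) < m \<or> k < m"
      using k unfolding so by auto
  qed
  then obtain c where c: "form_coeffs m s c" "\<And>w z. jet m s w \<Longrightarrow> z \<in> test_functions \<Longrightarrow> ?T w z = form_value m c w z"
    unfolding lower_form_def by blast
  show ?thesis
  proof (rule that[OF c(1)])
    fix w z assume w: "jet m s w" and z: "z \<in> test_functions"
    have "diff_expr m s \<tau> (w 0) z = distrib_deriv n (regular_distrib (w 0)) z + ?T w z"
      using z by (simp add: diff_expr_def Let_def n add.assoc)
    also have "distrib_deriv n (regular_distrib (w 0)) z = (- 1) ^ n * (LINT x|leb01. w 0 x * (cderiv ^^ n) z x)"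
      using z test_funpow[OF z] by (simp add: distrib_deriv_def regular_distrib_def)
    finally show "diff_expr m s \<tau> (w 0) z = (- 1) ^ n * (LINT x|leb01. w 0 x * (cderiv ^^ n) z x) + form_value m c w z"
      unfolding c(2)[OF w z] .
  qed
qed

end

section \<open>The canonical system of a differential expression\<close>

text \<open>With \<open>e\<close> the signed coefficients of the form, one regularization step reads
  \<open>Z\<^sub>k' = Z\<^sub>k\<^sub>+\<^sub>1 + (\<Sum>j\<le>m. e k j * y\<^sup>(\<^sup>j\<^sup>))\<close>. For even order \<open>y\<^sup>(\<^sup>m\<^sup>)\<close> is not a component of \<open>Z\<close>; the products
  arise from replacing it by \<open>Z\<^sub>m + (\<Sum>j<m. e (m - 1) j * Z\<^sub>j)\<close>.\<close>

definition canonical_entries :: "nat \<Rightarrow> nat \<Rightarrow> (nat \<Rightarrow> nat \<Rightarrow> real \<Rightarrow> complex) \<Rightarrow> nat \<Rightarrow> nat \<Rightarrow> real \<Rightarrow> complex" where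
  "canonical_entries m s c k j x =
     (let n = 2 * m + s; e = (\<lambda>k j. (- 1) ^ (n - k) * c j (n - 1 - k) x)
      in e k j + (if s = 0 \<and> j < m then e k m * e (m - 1) j else 0))"

context order_params
begin

text \<open>Products of two coefficients occur only in even order, where both factors are square
  integrable.\<close>

lemma canonical_integrable:
  assumes c: "form_coeffs m s c" and k: "k < n" "j < n"
  shows "integrable leb01 (companion m s (canonical_entries m s c) k j)"
proof -
  define e where "e = (\<lambda>k j x. (- 1) ^ (n - k) * c j (n - 1 - k) x)"
  have eL: "e k j \<in> Lp01 (2 - s)" for k j
    unfolding e_def using c by (intro Lp01_cmult) (simp add: form_coeffs_def)
  have B: "canonical_entries m s c k j = (\<lambda>x. e k j x + (if s = 0 \<and> j < m then e k m x * e (m - 1) j x else 0))"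
    by (rule ext) (simp add: canonical_entries_def Let_def e_def n)
  have "integrable leb01 (canonical_entries m s c k j)"
  proof (cases "s = 0 \<and> j < m")
    case True
    then have "integrable leb01 (\<lambda>x. e k m x * e (m - 1) j x)"
      using Lp01_2_mult eL by (simp add: numeral_2_eq_2)
    then show ?thesis unfolding B using True Lp01_integrable[OF eL] by simp
  next
    case False
    have "canonical_entries m s c k j = e k j" unfolding B by (rule ext) (use False in auto)
    then show ?thesis using Lp01_integrable[OF eL] by simp
  qed
  moreover have "companion m s (canonical_entries m s c) k j = (\<lambda>_. 1) \<or>
     companion m s (canonical_entries m s c) k j = (\<lambda>_. 0) \<or>
     companion m s (canonical_entries m s c) k j = canonical_entries m s c k j"
    by (auto simp: companion_def fun_eq_iff)
  ultimately show ?thesis using continuous_integrable_01[OF continuous_on_const] by (elim disjE) simp_all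
qed

text \<open>Collecting the weak equation by the order of the derivative of z puts it into the form
  of \<open>distributional_chain\<close>. The ladder obtained there, read from the top down and with
  alternating signs, is the canonical vector \<open>Z\<close>.\<close>

lemma weak_form_system:
  assumes c: "form_coeffs m s c" and w: "jet m s w" and f: "integrable leb01 f"
    and weak: "\<And>z. z \<in> test_functions \<Longrightarrow>
      (- 1) ^ n * (LINT x|leb01. w 0 x * (cderiv ^^ n) z x) + form_value m c w z = (LINT x|leb01. f x * z x)"
  shows "\<exists>Z. system n (companion m s (canonical_entries m s c)) f Z \<and> (\<forall>x\<in>{0..1}. Z 0 x = w 0 x)"
proof -
  have mn: "0 < m" "m < n" "0 < n" using m n by auto
  have wa: "\<And>a. a < m \<Longrightarrow> acd (w a) (w (Suc a))" using w by (simp add: jet_def)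
  have wc: "\<And>a. a < m \<Longrightarrow> continuous_on {0..1} (w a)" using acd_continuous[OF wa] .
  define S where "S = (\<lambda>b x. \<Sum>a\<le>m. c a b x * w a x)"
  have cw: "integrable leb01 (\<lambda>x. c a b x * w a x)" if "a \<le> m" for a b
    using w c that by (simp add: jet_def form_coeffs_def)
  have Si: "integrable leb01 (S b)" for b
    unfolding S_def by (rule Bochner_Integration.integrable_sum) (use cw in auto)
  \<comment> \<open>The three pieces are the leading term at order n, the bilinear form at orders up
    to m, and the right-hand side at order 0. Since m < n, the leading term never meets the
    form.\<close>
  define u1 where "u1 = (\<lambda>(b :: nat) x. if b = n then (- 1) ^ n * w 0 x else 0)"
  define u2 where "u2 = (\<lambda>b x. if b \<le> m then S b x else 0)"
  define u3 where "u3 = (\<lambda>(b :: nat) x. if b = 0 then - f x else 0 :: complex)"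
  have ui: "integrable leb01 (u1 b)" "integrable leb01 (u2 b)" "integrable leb01 (u3 b)" for b
  proof -
    show "integrable leb01 (u1 b)"
      using continuous_integrable_01[OF wc[OF mn(1)]] by (cases "b = n") (simp_all add: u1_def)
    show "integrable leb01 (u2 b)" using Si[of b] by (cases "b \<le> m") (simp_all add: u2_def)
    show "integrable leb01 (u3 b)" using f by (cases "b = 0") (simp_all add: u3_def)
  qed
  define u where "u = (\<lambda>b x. u1 b x + u2 b x + u3 b x)"
  have uint: "integrable leb01 (u b)" for b unfolding u_def using ui by simp
  have "\<exists>R. aeq (R n) (u n) \<and> (\<forall>b<n. acd (R (Suc b)) (\<lambda>x. u b x - R b x)) \<and> R 0 = (\<lambda>_. 0)"
  proof (rule distributional_chain[OF uint])
    fix z assume z: "z \<in> test_functions"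
    have tz: "(cderiv ^^ b) z \<in> test_functions" for b by (rule test_funpow[OF z])
    have "(LINT x|leb01. u b x * (cderiv ^^ b) z x) = (LINT x|leb01. u1 b x * (cderiv ^^ b) z x)
       + (LINT x|leb01. u2 b x * (cderiv ^^ b) z x) + (LINT x|leb01. u3 b x * (cderiv ^^ b) z x)" for b
      using test_integrable_mult[OF ui(1) tz] test_integrable_mult[OF ui(2) tz] test_integrable_mult[OF ui(3) tz]
      unfolding u_def distrib_right by simp
    then have "(\<Sum>b\<le>n. LINT x|leb01. u b x * (cderiv ^^ b) z x) = (\<Sum>b\<le>n. LINT x|leb01. u1 b x * (cderiv ^^ b) z x)
       + (\<Sum>b\<le>n. LINT x|leb01. u2 b x * (cderiv ^^ b) z x) + (\<Sum>b\<le>n. LINT x|leb01. u3 b x * (cderiv ^^ b) z x)"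
      by (simp add: sum.distrib)
    moreover have "(\<Sum>b\<le>n. LINT x|leb01. u1 b x * (cderiv ^^ b) z x) = (- 1) ^ n * (LINT x|leb01. w 0 x * (cderiv ^^ n) z x)"
      by (subst sum.mono_neutral_right[of "{..n}" "{n}"]) (auto simp: u1_def mult.assoc)
    moreover have "(\<Sum>b\<le>n. LINT x|leb01. u3 b x * (cderiv ^^ b) z x) = - (LINT x|leb01. f x * z x)"
      by (subst sum.mono_neutral_right[of "{..n}" "{0}"]) (auto simp: u3_def)
    moreover have "(\<Sum>b\<le>n. LINT x|leb01. u2 b x * (cderiv ^^ b) z x) = form_value m c w z"
    proof -
      have "(\<Sum>b\<le>n. LINT x|leb01. u2 b x * (cderiv ^^ b) z x) = (\<Sum>b\<le>m. LINT x|leb01. S b x * (cderiv ^^ b) z x)"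
        by (subst sum.mono_neutral_right[of "{..n}" "{..m}"]) (use mn in \<open>auto simp: u2_def\<close>)
      also have "\<dots> = (\<Sum>b\<le>m. \<Sum>a\<le>m. LINT x|leb01. c a b x * w a x * (cderiv ^^ b) z x)"
      proof (rule sum.cong[OF refl])
        fix b
        show "(LINT x|leb01. S b x * (cderiv ^^ b) z x) = (\<Sum>a\<le>m. LINT x|leb01. c a b x * w a x * (cderiv ^^ b) z x)"
          unfolding S_def sum_distrib_right
          by (rule Bochner_Integration.integral_sum) (use test_integrable_mult[OF cw tz] in auto)
      qed
      finally show ?thesis by (simp add: form_value_def)
    qed
    ultimately show "(\<Sum>b\<le>n. LINT x|leb01. u b x * (cderiv ^^ b) z x) = 0"
      using weak[OF z] by simp
  qed
  then obtain R where R: "aeq (R n) (u n)" "\<And>b. b < n \<Longrightarrow> acd (R (Suc b)) (\<lambda>x. u b x - R b x)" "R 0 = (\<lambda>_. 0)"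
    by blast
  \<comment> \<open>R_(b+1)' = u_b - R_b with n = k + b + 1 becomes Z_k' = Z_(k+1) + (-1)^(n-k) u_b;
    the sign turns -R_b into +Z_(k+1) and, in the last row, -f into +f.\<close>
  define Z where "Z = (\<lambda>k x. (- 1) ^ (n - k) * R (n - k) x)"
  define e where "e = (\<lambda>k j x. (- 1) ^ (n - k) * c j (n - 1 - k) x)"
  have Zk: "acd (Z k) (\<lambda>x. (if Suc k < n then Z (Suc k) x else f x) + (if m + s \<le> Suc k then (\<Sum>a\<le>m. e k a x * w a x) else 0))"
    if k: "k < n" for k
  proof -
    obtain b where b: "n = Suc (k + b)" using k less_imp_Suc_add by blast
    have "acd (\<lambda>x. (- 1) ^ (n - k) * R (Suc b) x) (\<lambda>x. (- 1) ^ (n - k) * (u b x - R b x))"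
      by (rule acd_cmult[OF R(2)]) (use b in simp)
    moreover have "(\<lambda>x. (- 1) ^ (n - k) * R (Suc b) x) = Z k"
      using b by (simp add: Z_def)
    moreover have "(\<lambda>x. (- 1) ^ (n - k) * (u b x - R b x)) =
        (\<lambda>x. (if Suc k < n then Z (Suc k) x else f x) + (if m + s \<le> Suc k then (\<Sum>a\<le>m. e k a x * w a x) else 0))"
    proof
      fix x
      have nk: "n - k = Suc b" "n - Suc k = b" "n - 1 - k = b" using b by auto
      have bm: "b \<le> m \<longleftrightarrow> m + s \<le> Suc k" using b n by auto
      have 1: "(- 1) ^ (n - k) * u2 b x = (if m + s \<le> Suc k then (\<Sum>a\<le>m. e k a x * w a x) else 0)"
        unfolding u2_def S_def e_def nk using bm by (simp add: sum_distrib_left mult.assoc sum_negf)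
      have 2: "(- 1) ^ (n - k) * (u3 b x - R b x) = (if Suc k < n then Z (Suc k) x else f x)"
      proof (cases "b = 0")
        case True
        then show ?thesis using b R(3) by (simp add: u3_def nk)
      next
        case False
        then show ?thesis using b by (simp add: u3_def Z_def nk)
      qed
      have "u1 b x = 0" using b by (simp add: u1_def)
      then have "(- 1) ^ (n - k) * (u b x - R b x) = (- 1) ^ (n - k) * u2 b x + (- 1) ^ (n - k) * (u3 b x - R b x)"
        by (simp add: u_def algebra_simps)
      then show "(- 1) ^ (n - k) * (u b x - R b x) =
        (if Suc k < n then Z (Suc k) x else f x) + (if m + s \<le> Suc k then (\<Sum>a\<le>m. e k a x * w a x) else 0)"
        unfolding 1 2 by simp
    qed
    ultimately show ?thesis by (simp only:)
  qed
  have Zc: "continuous_on {0..1} (Z k)" if "k < n" for k by (rule acd_continuous[OF Zk[OF that]])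
  \<comment> \<open>Rows with k + 1 < m + s carry no coefficients, so the first m components are
    plain derivatives of y.\<close>
  have Zw: "\<forall>x\<in>{0..1}. Z a x = w a x" if "a < m" for a
    using that
  proof (induction a)
    case 0
    have "aeq (Z 0) (w 0)"
      using R(1)
    proof eventually_elim
      case (elim x)
      have "u n x = (- 1) ^ n * w 0 x" using mn by (simp add: u_def u1_def u2_def u3_def)
      then show ?case using elim by (simp add: Z_def flip: mult.assoc power_add)
    qed
    then show ?case using continuous_aeq_eq[OF Zc[OF mn(3)] wc[OF mn(1)]] by blast
  next
    case (Suc a)
    then have a: "a < m" "a < n" "Suc a < n" "\<not> m + s \<le> Suc a" using mn by auto
    have "acd (Z a) (w (Suc a))"
      by (rule acd_cong[OF wa[OF a(1)]]) (use Suc acd_integrable[OF wa[OF a(1)]] in auto)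
    from acd_unique[OF Zk[OF a(2)] this] have "aeq (Z (Suc a)) (w (Suc a))" using a by simp
    then show ?case using continuous_aeq_eq[OF Zc[OF a(3)] wc[OF Suc.prems]] by blast
  qed
  \<comment> \<open>The first place where the parities differ: y^(m) is \<open>Z m\<close> in odd
    order, but in even order row m - 1 already contributes coefficients.\<close>
  have wm: "aeq (w m) (\<lambda>x. Z m x + (if s = 0 then (\<Sum>a\<le>m. e (m - 1) a x * w a x) else 0))"
  proof -
    have a: "m - 1 < m" "m - 1 < n" "Suc (m - 1) = m" using mn by auto
    have "acd (Z (m - 1)) (w m)"
      by (rule acd_cong[OF wa[OF a(1)]]) (use Zw[OF a(1)] acd_integrable[OF wa[OF a(1)]] a in auto)
    from acd_unique[OF this Zk[OF a(2)]] show ?thesis unfolding a(3) using mn s by (cases "s = 0") auto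
  qed
  have em: "e (m - 1) m x = 0" if "s = 0" for x
    using c that m by (simp add: e_def form_coeffs_def n)
  have key: "aeq (\<lambda>x. if m + s \<le> Suc k then (\<Sum>a\<le>m. e k a x * w a x) else 0)
      (\<lambda>x. \<Sum>j\<le>k. (if m + s \<le> Suc k \<and> j \<le> m then canonical_entries m s c k j x else 0) * Z j x)"
    if k: "k < n" for k
    using wm AE_space
  proof eventually_elim
    case (elim x)
    have x: "x \<in> {0..1}" using elim by simp
    have ce: "canonical_entries m s c k j x = e k j x + (if s = 0 \<and> j < m then e k m x * e (m - 1) j x else 0)" for k j
      by (simp add: canonical_entries_def Let_def e_def n)
    have split: "(\<Sum>a\<le>m. g a) = (\<Sum>a<m. g a) + g m" for g :: "nat \<Rightarrow> complex"
      by (simp add: lessThan_Suc_atMost[symmetric])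
    show ?case
    proof (cases "m + s \<le> Suc k")
      case False
      then show ?thesis by simp
    next
      case True
      have low: "(\<Sum>a<m. g a * w a x) = (\<Sum>a<m. g a * Z a x)" for g
        by (intro sum.cong refl) (use Zw x in auto)
      \<comment> \<open>Row m - 1 has coefficients only in even order. There the companion shape
        cuts the sum at j = m - 1, and \<open>em\<close> disposes of the missing term j = m.\<close>
      consider "m \<le> k" | "s = 0" "Suc k = m" using True s by fastforce
      then show ?thesis
      proof cases
        case 1
        have "(\<Sum>j\<le>k. (if m + s \<le> Suc k \<and> j \<le> m then canonical_entries m s c k j x else 0) * Z j x)
          = (\<Sum>j\<le>m. canonical_entries m s c k j x * Z j x)"
          by (subst sum.mono_neutral_right[of "{..k}" "{..m}"]) (use 1 True in \<open>auto intro!: sum.cong\<close>)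
        also have "\<dots> = (\<Sum>a<m. e k a x * Z a x) + (if s = 0 then e k m x * (\<Sum>a<m. e (m - 1) a x * Z a x) else 0) + e k m x * Z m x"
          unfolding split ce by (cases "s = 0") (simp_all add: distrib_right sum.distrib sum_distrib_left mult.assoc)
        also have "\<dots> = (\<Sum>a<m. e k a x * w a x) + e k m x * w m x"
        proof (cases "s = 0")
          case s0: True
          have "w m x = Z m x + (\<Sum>a<m. e (m - 1) a x * Z a x)"
            using elim(1) em[OF s0] s0 low[of "\<lambda>a. e (m - 1) a x"] unfolding split by simp
          then show ?thesis using s0 low[of "\<lambda>a. e k a x"] by (simp add: algebra_simps)
        next
          case False
          then show ?thesis using elim(1) low[of "\<lambda>a. e k a x"] by simp
        qed
        finally show ?thesis using True unfolding split by simp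
      next
        case 2
        have km: "k = m - 1" "{..k} = {..<m}" using 2 by auto
        have "(\<Sum>j\<le>k. (if m + s \<le> Suc k \<and> j \<le> m then canonical_entries m s c k j x else 0) * Z j x)
          = (\<Sum>j<m. e k j x * Z j x)"
        proof -
          have "canonical_entries m s c k j x = e k j x" for j
            unfolding ce km(1) em[OF 2(1)] by simp
          then show ?thesis unfolding km(2) using True by (intro sum.cong refl) simp
        qed
        then show ?thesis using True em[OF 2(1)] km(1) low[of "\<lambda>a. e k a x"] unfolding split by simp
      qed
    qed
  qed
  have "system n (companion m s (canonical_entries m s c)) f Z"
    unfolding system_def
  proof (intro allI impI)
    fix k assume k: "k < n"
    let ?g = "\<lambda>x. (if Suc k < n then Z (Suc k) x else f x) + (\<Sum>j\<le>k. (if m + s \<le> Suc k \<and> j \<le> m then canonical_entries m s c k j x else 0) * Z j x)"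
    have e: "(\<lambda>x. (\<Sum>j<n. companion m s (canonical_entries m s c) k j x * Z j x) + (if Suc k = n then f x else 0)) = ?g"
      unfolding companion_sum[OF k] using k by (intro ext) auto
    have ae: "aeq ?g (\<lambda>x. (if Suc k < n then Z (Suc k) x else f x) + (if m + s \<le> Suc k then (\<Sum>a\<le>m. e k a x * w a x) else 0))"
      using key[OF k] by eventually_elim simp
    show "acd (Z k) (\<lambda>x. (\<Sum>j<n. companion m s (canonical_entries m s c) k j x * Z j x) + (if Suc k = n then f x else 0))"
      unfolding e
      by (rule acd_deriv_cong[OF Zk[OF k] aeq_sym[OF ae]])
  qed
  then show ?thesis using Zw[OF mn(1)] by blast
qed

text \<open>The derivative y^(m) is recovered as y^[m] plus the coefficient sum of row m. In even
  order these coefficients lie in L_2 and multiply continuous functions, so products with L_2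
  functions are integrable; in odd order the sum vanishes and y^(m) is continuous.\<close>

lemma quasi_jet:
  assumes F: "F \<in> matfun_class m s" and y: "y \<in> qdomain n F"
  obtains w where "jet m s w" "w 0 = y"
proof -
  note sys = qdomain_system[OF F y]
  let ?Y = "quasi F y"
  have mn: "0 < m" "m < n" using m n by auto
  have co: "continuous_on {0..1} (?Y k)" if "k < n" for k
    by (rule acd_continuous[OF system_acd[OF sys(2) that]])
  let ?S = "\<lambda>k x. \<Sum>j\<le>k. (if m + s \<le> Suc k \<and> j \<le> m then assoc_entries F k j x else 0) * ?Y j x"
  define v where "v = (\<lambda>x. ?Y m x + ?S (m - 1) x)"
  have last: "acd (?Y (m - 1)) v"
  proof -
    have "m - 1 < n" "Suc (m - 1) = m" using mn by auto
    then show ?thesis using system_companion_acd[OF sys(2), of "m - 1"] mn unfolding v_def by simp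
  qed
  define w where "w = (\<lambda>a. if a = m then v else ?Y a)"
  have "acd (w a) (w (Suc a))" if a: "a < m" for a
  proof (cases "Suc a = m")
    case True
    then show ?thesis using last by (auto simp: w_def)
  next
    case False
    then have "a < n" "Suc a < n" "\<not> m + s \<le> Suc a" using a mn by auto
    then have "acd (?Y a) (?Y (Suc a))" using system_companion_acd[OF sys(2), of a] by (simp del: quasi.simps)
    then show ?thesis using a False by (simp add: w_def del: quasi.simps)
  qed
  moreover have "integrable leb01 (\<lambda>x. \<sigma> x * w a x)" if a: "a \<le> m" and \<sigma>: "\<sigma> \<in> Lp01 (2 - s)" for a \<sigma>
  proof (cases "a = m")
    case False
    then show ?thesis using continuous_times_integrable[OF co Lp01_integrable[OF \<sigma>], of a] a mn
      by (simp add: w_def mult.commute)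
  next
    case True
    have Ym: "integrable leb01 (\<lambda>x. \<sigma> x * ?Y m x)"
      using continuous_times_integrable[OF co Lp01_integrable[OF \<sigma>], of m] mn by (simp add: mult.commute)
    have "integrable leb01 (\<lambda>x. \<sigma> x * ?S (m - 1) x)"
      unfolding sum_distrib_left
    proof (rule Bochner_Integration.integrable_sum)
      fix j assume j: "j \<in> {..m - 1}"
      show "integrable leb01 (\<lambda>x. \<sigma> x * ((if m + s \<le> Suc (m - 1) \<and> j \<le> m then assoc_entries F (m - 1) j x else 0) * ?Y j x))"
      proof (cases "s = 0")
        case s0: True
        have "\<forall>k \<in> {m+1..n}. \<forall>j \<in> {1..m}. F m j \<in> Lp01 2"
          using F s0 unfolding matfun_class_def Let_def n by simp
        \<comment> \<open>The L_2 condition on row m stands under a quantifier over k, so an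
          instance of k has to be supplied.\<close>
        moreover have "m + 1 \<in> {m+1..n}" "Suc j \<in> {1..m}" using mn j by auto
        ultimately have "F m (Suc j) \<in> Lp01 2" by blast
        then have "integrable leb01 (\<lambda>x. \<sigma> x * F m (Suc j) x)" using \<sigma> s0 by (intro Lp01_2_mult) (simp_all add: numeral_2_eq_2)
        from continuous_times_integrable[OF co this, of j] j mn
        have "integrable leb01 (\<lambda>x. ?Y j x * (\<sigma> x * F m (Suc j) x))" by simp
        moreover have "(\<lambda>x. \<sigma> x * ((if m + s \<le> Suc (m - 1) \<and> j \<le> m then assoc_entries F (m - 1) j x else 0) * ?Y j x))
           = (\<lambda>x. ?Y j x * (\<sigma> x * F m (Suc j) x))"
          using s0 j mn by (intro ext) (simp add: assoc_entries_def)
        ultimately show ?thesis by (simp only:)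
      next
        case False
        then have "\<not> m + s \<le> Suc (m - 1)" using mn by simp
        then show ?thesis by simp
      qed
    qed
    from Bochner_Integration.integrable_add[OF Ym this] True show ?thesis
      by (simp add: w_def v_def distrib_left)
  qed
  ultimately have "jet m s w" unfolding jet_def by blast
  moreover have "w 0 = y" using mn by (simp add: w_def)
  ultimately show ?thesis by (rule that)
qed

text \<open>The form, hence \<open>B\<close>, is chosen before the matrix and the function: it
  depends on the coefficients \<open>\<tau>\<close> alone.\<close>

lemma canonical_system:
  assumes \<tau>: "\<tau> \<in> coeffs_class m s"
  obtains B where "\<And>k j. k < n \<Longrightarrow> j < n \<Longrightarrow> integrable leb01 (companion m s B k j)"
    "\<And>F y. F \<in> associated m s \<tau> \<Longrightarrow> y \<in> qdomain n F \<Longrightarrow>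
      \<exists>Z. system n (companion m s B) (quasi F y n) Z \<and> (\<forall>x\<in>{0..1}. Z 0 x = y x)"
proof -
  obtain c where c: "form_coeffs m s c"
    "\<And>w z. jet m s w \<Longrightarrow> z \<in> test_functions \<Longrightarrow>
       diff_expr m s \<tau> (w 0) z = (- 1) ^ n * (LINT x|leb01. w 0 x * (cderiv ^^ n) z x) + form_value m c w z"
    by (rule diff_expr_form[OF \<tau>]) blast
  show ?thesis
  proof (rule that[of "canonical_entries m s c"])
    show "integrable leb01 (companion m s (canonical_entries m s c) k j)" if "k < n" "j < n" for k j
      by (rule canonical_integrable[OF c(1) that])
    fix F y assume F: "F \<in> associated m s \<tau>" and y: "y \<in> qdomain n F"
    have Fc: "F \<in> matfun_class m s" and eq: "diff_expr m s \<tau> y = regular_distrib (quasi F y n)"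
      using F y by (auto simp: associated_def n)
    obtain w where w: "jet m s w" "w 0 = y" by (rule quasi_jet[OF Fc y])
    have "\<exists>Z. system n (companion m s (canonical_entries m s c)) (quasi F y n) Z \<and> (\<forall>x\<in>{0..1}. Z 0 x = w 0 x)"
    proof (rule weak_form_system[OF c(1) w(1) qdomain_system(1)[OF Fc y]])
      fix z assume z: "z \<in> test_functions"
      show "(- 1) ^ n * (LINT x|leb01. w 0 x * (cderiv ^^ n) z x) + form_value m c w z = (LINT x|leb01. quasi F y n x * z x)"
        using c(2)[OF w(1) z] z unfolding w(2) eq by (simp add: regular_distrib_def)
    qed
    then show "\<exists>Z. system n (companion m s (canonical_entries m s c)) (quasi F y n) Z \<and> (\<forall>x\<in>{0..1}. Z 0 x = y x)"
      unfolding w(2) .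
  qed
qed

end

section \<open>Intertwining two companion systems\<close>

lemma acd_constant_deriv:
  assumes "acd u v" "\<And>x. x \<in> {0..1} \<Longrightarrow> u x = c"
  shows "aeq v (\<lambda>_. 0)"
proof -
  have "acd u (\<lambda>_. 0)"
    by (rule acd_cong[OF acd_const[of c]]) (use assms(2) in auto)
  then show ?thesis by (rule acd_unique[OF assms(1)])
qed

lemma sum_delta_right:
  fixes f :: "nat \<Rightarrow> complex"
  assumes "k < n"
  shows "(\<Sum>i<n. (if k = i then 1 else 0) * f i) = f k"
  using assms by (subst sum.mono_neutral_right[of "{..<n}" "{k}"]) auto

text \<open>The second conjunct is membership of V(x) in \<open>L_class n m\<close> with indices
  from 0: the bound j <= n - m on rows becomes k < n - m, and k > m on columns becomes m <=
  j.\<close>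

definition intertwines :: "nat \<Rightarrow> nat \<Rightarrow> (nat \<Rightarrow> nat \<Rightarrow> real \<Rightarrow> complex) \<Rightarrow> (nat \<Rightarrow> nat \<Rightarrow> real \<Rightarrow> complex) \<Rightarrow> (nat \<Rightarrow> nat \<Rightarrow> real \<Rightarrow> complex) \<Rightarrow> bool" where
  "intertwines m n A A' V \<longleftrightarrow>
     (\<forall>k<n. \<forall>j<n. acd (V k j) (\<lambda>x. (\<Sum>i<n. A' k i x * V i j x) - (\<Sum>i<n. V k i x * A i j x))) \<and>
     (\<forall>k<n. \<forall>j<n. k < n - m \<or> m \<le> j \<longrightarrow> (\<forall>x\<in>{0..1}. V k j x = (if k = j then 1 else 0)))"

text \<open>(VY)' = (A'V - VA)Y + VAY + f V e_n, and V e_n = e_n because the last column has index n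
  - 1 >= m.\<close>

lemma intertwines_system:
  assumes V: "intertwines m n A A' V" and Y: "system n A f Y" and mn: "m < n"
  shows "system n A' f (\<lambda>k x. \<Sum>j<n. V k j x * Y j x)"
  unfolding system_def
proof (intro allI impI)
  fix k assume k: "k < n"
  define VA where "VA = (\<lambda>j x. \<Sum>i<n. V k i x * A i j x)"
  define AV where "AV = (\<lambda>j x. \<Sum>i<n. A' k i x * V i j x)"
  define AY where "AY = (\<lambda>j x. \<Sum>i<n. A j i x * Y i x)"
  have a: "acd (\<lambda>x. \<Sum>j<n. V k j x * Y j x)
     (\<lambda>x. \<Sum>j<n. (AV j x - VA j x) * Y j x + V k j x * (AY j x + (if Suc j = n then f x else 0)))"
    unfolding AV_def VA_def AY_def
    by (rule acd_sum, rule acd_mult) (use V Y k in \<open>simp_all add: intertwines_def system_def\<close>)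
  have eq: "(\<Sum>j<n. (AV j x - VA j x) * Y j x + V k j x * (AY j x + (if Suc j = n then f x else 0)))
     = (\<Sum>i<n. A' k i x * (\<Sum>j<n. V i j x * Y j x)) + (if Suc k = n then f x else 0)" if x: "x \<in> {0..1}" for x
  proof -
    have 1: "(\<Sum>j<n. AV j x * Y j x) = (\<Sum>i<n. A' k i x * (\<Sum>j<n. V i j x * Y j x))"
      unfolding AV_def sum_distrib_left sum_distrib_right by (subst sum.swap) (simp add: mult.assoc)
    have 2: "(\<Sum>j<n. VA j x * Y j x) = (\<Sum>j<n. V k j x * AY j x)"
      unfolding VA_def AY_def sum_distrib_left sum_distrib_right by (subst sum.swap) (simp add: mult.assoc)
    have 3: "(\<Sum>j<n. V k j x * (if Suc j = n then f x else 0)) = (if Suc k = n then f x else 0)"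
    proof -
      have "n - 1 < n" "m \<le> n - 1" using mn by auto
      then have "V k (n - 1) x = (if k = n - 1 then 1 else 0)" using V k x unfolding intertwines_def by blast
      moreover have "(\<Sum>j<n. V k j x * (if Suc j = n then f x else 0)) = V k (n - 1) x * f x"
        using mn by (subst sum.mono_neutral_right[of "{..<n}" "{n - 1}"]) auto
      ultimately show ?thesis using mn by auto
    qed
    have "(\<Sum>j<n. (AV j x - VA j x) * Y j x + V k j x * (AY j x + (if Suc j = n then f x else 0)))
      = (\<Sum>j<n. AV j x * Y j x) - (\<Sum>j<n. VA j x * Y j x) + (\<Sum>j<n. V k j x * AY j x) + (\<Sum>j<n. V k j x * (if Suc j = n then f x else 0))"
      by (simp only: left_diff_distrib distrib_left sum.distrib sum_subtractf) (simp only: add.assoc)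
    then show ?thesis unfolding 1 2 3 by simp
  qed
  show "acd (\<lambda>x. \<Sum>j<n. V k j x * Y j x)
     (\<lambda>x. (\<Sum>i<n. A' k i x * (\<Sum>j<n. V i j x * Y j x)) + (if Suc k = n then f x else 0))"
    (is "acd ?u ?v")
  proof -
    have ae: "aeq ?v (\<lambda>x. \<Sum>j<n. (AV j x - VA j x) * Y j x + V k j x * (AY j x + (if Suc j = n then f x else 0)))"
      by (rule AE_I2) (use eq in simp)
    show ?thesis
      by (rule acd_deriv_cong[OF a aeq_sym[OF ae]])
  qed
qed

lemma intertwines_apply:
  assumes V: "intertwines m n A A' V" and mn: "m \<le> n - m" and k: "k < n" and x: "x \<in> {0..1}"
  shows "(\<Sum>j<n. V k j x * y j) = y k + (if n - m \<le> k then (\<Sum>j<m. V k j x * y j) else 0)"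
proof (cases "n - m \<le> k")
  case False
  then have "V k j x = (if k = j then 1 else 0)" if "j < n" for j
    using V k x that unfolding intertwines_def by auto
  then have "(\<Sum>j<n. V k j x * y j) = (\<Sum>j<n. (if k = j then 1 else 0) * y j)" by (intro sum.cong) auto
  then show ?thesis using False sum_delta_right[OF k] by simp
next
  case True
  have hi: "V k j x = (if k = j then 1 else 0)" if "j < n" "m \<le> j" for j
    using V k x that unfolding intertwines_def by auto
  have "(\<Sum>j<n. V k j x * y j) = (\<Sum>j<m. V k j x * y j) + (\<Sum>j\<in>{m..<n}. V k j x * y j)"
    using sum.atLeastLessThan_concat[of 0 m n "\<lambda>j. V k j x * y j"] mn by (simp add: lessThan_atLeast0)
  also have "(\<Sum>j\<in>{m..<n}. V k j x * y j) = (\<Sum>j\<in>{m..<n}. (if k = j then 1 else 0) * y j)"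
    by (intro sum.cong) (use hi in auto)
  also have "\<dots> = y k"
    using True mn k by (subst sum.mono_neutral_right[of "{m..<n}" "{k}"]) auto
  finally show ?thesis using True by simp
qed

context order_params
begin

text \<open>Only the first row of V is known at the outset. The upper rows follow because there both
  matrices are pure shifts. The columns from m on follow because the matrix of \<open>B\<close> is a
  pure shift in the columns beyond m, so that V_(k,j)' = V_(k+1,j) - V_(k,j-1) for j > m.\<close>

lemma intertwines_exists:
  assumes A: "\<And>k j. k < n \<Longrightarrow> j < n \<Longrightarrow> integrable leb01 (companion m s B k j)"
    and dom: "\<And>Y. system n (companion m s B) (\<lambda>_. 0) Y \<Longrightarrow>
      \<exists>Z. system n (companion m s B') (\<lambda>_. 0) Z \<and> (\<forall>x\<in>{0..1}. Z 0 x = Y 0 x)"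
  shows "\<exists>V. intertwines m n (companion m s B) (companion m s B') V"
proof -
  let ?A = "companion m s B" and ?A' = "companion m s B'"
  have mn: "0 < m" "m < n" "n - m = m + s" "m + s < n" using m n by auto
  obtain C D where C: "\<And>i j. i < n \<Longrightarrow> j < n \<Longrightarrow> acd (C i j) (\<lambda>x. \<Sum>l<n. ?A i l x * C l j x)"
    and "\<And>i j. i < n \<Longrightarrow> j < n \<Longrightarrow> C i j 0 = (if i = j then 1 else 0)"
    and D: "\<And>i j. i < n \<Longrightarrow> j < n \<Longrightarrow> acd (D i j) (\<lambda>x. \<Sum>l<n. - ?A l j x * D i l x)"
    and "\<And>i j. i < n \<Longrightarrow> j < n \<Longrightarrow> D i j 0 = (if i = j then 1 else 0)"
    and CD: "\<And>i j x. i < n \<Longrightarrow> j < n \<Longrightarrow> x \<in> {0..1} \<Longrightarrow> (\<Sum>l<n. C i l x * D l j x) = (if i = j then 1 else 0)"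
    by (rule fundamental_matrix[of n ?A, OF A]) (assumption+, rule that, assumption+)
  have "\<exists>Z. system n ?A' (\<lambda>_. 0) Z \<and> (\<forall>x\<in>{0..1}. Z 0 x = C 0 p x)" if "p < n" for p
    using dom[of "\<lambda>i. C i p"] C that by (simp add: system_def)
  then have "\<forall>p\<in>{..<n}. \<exists>Z. system n ?A' (\<lambda>_. 0) Z \<and> (\<forall>x\<in>{0..1}. Z 0 x = C 0 p x)" by simp
  from bchoice[OF this] obtain Z where Z: "\<forall>p\<in>{..<n}. system n ?A' (\<lambda>_. 0) (Z p) \<and> (\<forall>x\<in>{0..1}. Z p 0 x = C 0 p x)" by blast
  define V where "V = (\<lambda>k j x. \<Sum>p<n. Z p k x * D p j x)"
  define G where "G = (\<lambda>k j x. (\<Sum>i<n. ?A' k i x * V i j x) - (\<Sum>i<n. V k i x * ?A i j x))"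
  have V: "acd (V k j) (G k j)" if kj: "k < n" "j < n" for k j
  proof -
    have Zp: "acd (Z p k) (\<lambda>x. \<Sum>i<n. ?A' k i x * Z p i x)" if "p < n" for p
      using system_acd[of n ?A' "\<lambda>_. 0" "Z p" k] Z kj that by auto
    have "acd (V k j) (\<lambda>x. \<Sum>p<n. (\<Sum>i<n. ?A' k i x * Z p i x) * D p j x + Z p k x * (\<Sum>l<n. - ?A l j x * D p l x))"
      unfolding V_def by (rule acd_sum, rule acd_mult) (use Zp D kj in auto)
    moreover have "(\<Sum>p<n. (\<Sum>i<n. ?A' k i x * Z p i x) * D p j x + Z p k x * (\<Sum>l<n. - ?A l j x * D p l x)) = G k j x" for x
    proof -
      have 1: "(\<Sum>p<n. (\<Sum>i<n. ?A' k i x * Z p i x) * D p j x) = (\<Sum>i<n. ?A' k i x * V i j x)"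
        unfolding V_def sum_distrib_left sum_distrib_right by (subst sum.swap) (simp add: mult.assoc)
      have 2: "(\<Sum>p<n. Z p k x * (\<Sum>l<n. - ?A l j x * D p l x)) = - (\<Sum>i<n. V k i x * ?A i j x)"
        unfolding V_def sum_distrib_left sum_distrib_right sum_negf[symmetric]
        by (subst sum.swap) (simp add: algebra_simps)
      show ?thesis unfolding sum.distrib 1 2 G_def by simp
    qed
    ultimately show ?thesis by (simp only:)
  qed
  have Vc: "continuous_on {0..1} (V k j)" if "k < n" "j < n" for k j
    by (rule acd_continuous[OF V[OF that]])
  have left: "(\<Sum>i<n. ?A' k i x * V i j x) = (if Suc k < n then V (Suc k) j x else 0) +
      (\<Sum>i\<le>k. (if m + s \<le> Suc k \<and> i \<le> m then B' k i x else 0) * V i j x)" if "k < n" for k j x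
    using companion_sum[OF that, where Y = "\<lambda>i. V i j"] .
  have row_id: "(\<Sum>i<n. V k i x * ?A i j x) = ?A k j x"
    if "k < n" "\<And>i. i < n \<Longrightarrow> V k i x = (if k = i then 1 else 0)" for k j x
  proof -
    have "(\<Sum>i<n. V k i x * ?A i j x) = (\<Sum>i<n. (if k = i then 1 else 0) * ?A i j x)"
      by (intro sum.cong) (use that in auto)
    then show ?thesis using sum_delta_right[OF that(1)] by simp
  qed
  text \<open>The rows of \<open>V\<close> are determined successively by \<open>V' = A' V - V A\<close>: whenever an entry is
    constant, the equation expresses the entry below it.\<close>
  have next_row: "V (Suc k) j x = r"
    if k: "Suc k < n" "j < n" and const: "\<And>x. x \<in> {0..1} \<Longrightarrow> V k j x = c"
      and G: "\<And>x. x \<in> {0..1} \<Longrightarrow> G k j x = V (Suc k) j x - r" and x: "x \<in> {0..1}" for k j c r x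
  proof -
    have "k < n" using k by simp
    from acd_constant_deriv[OF V[OF this k(2)] const] have "aeq (G k j) (\<lambda>_. 0)" .
    then have "aeq (V (Suc k) j) (\<lambda>_. r)" using AE_space
      by eventually_elim (use G in auto)
    then show ?thesis using continuous_aeq_eq[OF Vc[OF k] continuous_on_const _ x] by blast
  qed
  have top: "\<forall>j<n. \<forall>x\<in>{0..1}. V k j x = (if k = j then 1 else 0)" if "k < m + s" for k
    using that
  proof (induction k)
    case 0
    show ?case
    proof (intro allI impI ballI)
      fix j and x :: real assume j: "j < n" and x: "x \<in> {0..1}"
      have "V 0 j x = (\<Sum>p<n. C 0 p x * D p j x)"
        unfolding V_def by (intro sum.cong) (use Z x in auto)
      then show "V 0 j x = (if 0 = j then 1 else 0)" using CD[OF _ j x] mn by simp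
    qed
  next
    case (Suc k)
    then have IH: "\<And>j x. j < n \<Longrightarrow> x \<in> {0..1} \<Longrightarrow> V k j x = (if k = j then 1 else 0)" by simp
    have k: "k < n" "Suc k < n" "\<not> m + s \<le> Suc k" using Suc.prems mn by auto
    show ?case
    proof (intro allI impI ballI)
      fix j and x :: real assume j: "j < n" and x: "x \<in> {0..1}"
      show "V (Suc k) j x = (if Suc k = j then 1 else 0)"
      proof (rule next_row[OF k(2) j IH[OF j] _ x])
        fix x :: real assume x: "x \<in> {0..1}"
        show "G k j x = V (Suc k) j x - (if Suc k = j then 1 else 0)"
          unfolding G_def left[OF k(1)] row_id[OF k(1) IH[OF _ x], of j, simplified]
          using k by (auto simp: companion_def)
      qed
    qed
  qed
  \<comment> \<open>In even order the rows of \<open>top\<close> stop at m - 1. Row m - 1 has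
    coefficients, but they meet only entries of V that vanish in columns j >= m, so row m is still
    reached there.\<close>
  have up_to_m: "V k j x = (if k = j then 1 else 0)"
    if k: "k \<le> m" and j: "m \<le> j" "j < n" and x: "x \<in> {0..1}" for k j x
  proof (cases "k < m + s")
    case True
    then show ?thesis using top j x by blast
  next
    case False
    then have ks: "k = m" "s = 0" using k by auto
    have k': "m - 1 < n" "Suc (m - 1) = m" "Suc (m - 1) < n" "m - 1 < m + s" using mn by auto
    have IH: "\<And>j x. j < n \<Longrightarrow> x \<in> {0..1} \<Longrightarrow> V (m - 1) j x = (if m - 1 = j then 1 else 0)"
      using top[OF k'(4)] by blast
    have "V (Suc (m - 1)) j x = (if m = j then 1 else 0)"
    proof (rule next_row[OF k'(3) j(2) IH[OF j(2)] _ x])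
      fix x :: real assume x: "x \<in> {0..1}"
      have "(\<Sum>i\<le>m - 1. (if m + s \<le> Suc (m - 1) \<and> i \<le> m then B' (m - 1) i x else 0) * V i j x) = 0"
      proof (rule sum.neutral, rule ballI)
        fix i assume "i \<in> {..m - 1}"
        then have "i < m + s" "i \<noteq> j" using mn j by auto
        then show "(if m + s \<le> Suc (m - 1) \<and> i \<le> m then B' (m - 1) i x else 0) * V i j x = 0"
          using top[of i] j x by simp
      qed
      moreover have "(\<Sum>i<n. V (m - 1) i x * ?A i j x) = ?A (m - 1) j x"
        by (rule row_id[OF k'(1) IH[OF _ x]])
      moreover have "?A (m - 1) j x = (if m = j then 1 else 0)"
        using k' j by (auto simp: companion_def)
      ultimately show "G (m - 1) j x = V (Suc (m - 1)) j x - (if m = j then 1 else 0)"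
        unfolding G_def left[OF k'(1)] using k'(3) by simp
    qed
    then show ?thesis using ks k'(2) by simp
  qed
  \<comment> \<open>For j > m the coefficients of \<open>B'\<close> multiply V_(i,j) with i <= m <
    j, which is zero, and column j of the other matrix has its only entry in row j - 1.\<close>
  have G_right: "G k j x = (if Suc k < n then V (Suc k) j x else 0) - V k (j - 1) x"
    if k: "k < n" and j: "m < j" "j < n" and x: "x \<in> {0..1}" for k j x
  proof -
    have "(\<Sum>i\<le>k. (if m + s \<le> Suc k \<and> i \<le> m then B' k i x else 0) * V i j x) = 0"
      by (rule sum.neutral) (use up_to_m j x in auto)
    moreover have "(\<Sum>i<n. V k i x * ?A i j x) = V k (j - 1) x"
      using j by (subst sum.mono_neutral_right[of "{..<n}" "{j - 1}"]) (auto simp: companion_def)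
    ultimately show ?thesis unfolding G_def left[OF k] by simp
  qed
  \<comment> \<open>Descending row by row: an entry on or above the diagonal in row k + 1 inherits
    the value of its upper left neighbour.\<close>
  have upper: "\<forall>j x. k \<le> j \<longrightarrow> m \<le> j \<longrightarrow> j < n \<longrightarrow> x \<in> {0..1} \<longrightarrow> V k j x = (if k = j then 1 else 0)" if "k < n" for k
    using that
  proof (induction k)
    case 0
    then show ?case using up_to_m by simp
  next
    case (Suc k)
    show ?case
    proof (cases "Suc k \<le> m")
      case True
      then show ?thesis using up_to_m by blast
    next
      case False
      show ?thesis
      proof (intro allI impI)
        fix j and x :: real assume j: "Suc k \<le> j" "m \<le> j" "j < n" and x: "x \<in> {0..1}"
        have IH: "V k j x = (if k = j then 1 else 0)" if "k \<le> j" "m \<le> j" "j < n" "x \<in> {0..1}" for j x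
          using Suc that by simp
        show "V (Suc k) j x = (if Suc k = j then 1 else 0)"
        proof (rule next_row[OF Suc.prems j(3) IH _ x])
          fix x :: real assume x: "x \<in> {0..1}"
          have "V k (j - 1) x = (if Suc k = j then 1 else 0)"
            using IH[of "j - 1" x] j False x by auto
          then show "G k j x = V (Suc k) j x - (if Suc k = j then 1 else 0)"
            using G_right[of k j x] j False x Suc.prems by simp
        qed (use j in auto)
      qed
    qed
  qed
  \<comment> \<open>Induction on the distance d below the diagonal: constancy along one subdiagonal
    makes the entries of the next one equal to their lower right neighbours.\<close>
  have lower: "\<forall>j x. m \<le> j \<longrightarrow> j + d < n \<longrightarrow> x \<in> {0..1} \<longrightarrow> V (j + d) j x = (if d = 0 then 1 else 0)" for d
  proof (induction d)
    case 0
    then show ?case using upper by simp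
  next
    case (Suc d)
    have rec: "V (j + Suc d) j x = (if Suc (j + Suc d) < n then V (Suc (j + Suc d)) (Suc j) x else 0)"
      if j: "m \<le> j" "j + Suc d < n" and x: "x \<in> {0..1}" for j x
    proof -
      let ?k = "j + Suc d"
      have const: "V ?k (Suc j) x = (if d = 0 then 1 else 0)" if "x \<in> {0..1}" for x
        using Suc.IH[rule_format, of "Suc j" x] j that by simp
      have js: "Suc j < n" using j by simp
      from acd_constant_deriv[OF V[OF j(2) js] const] have "aeq (G ?k (Suc j)) (\<lambda>_. 0)" .
      then have "aeq (V ?k j) (\<lambda>x. if Suc ?k < n then V (Suc ?k) (Suc j) x else 0)"
        using AE_space by eventually_elim (use G_right[of ?k "Suc j"] j in auto)
      moreover have "continuous_on {0..1} (\<lambda>x. if Suc ?k < n then V (Suc ?k) (Suc j) x else 0)"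
        using Vc[of "Suc ?k" "Suc j"] j by (cases "Suc ?k < n") auto
      moreover have "continuous_on {0..1} (V ?k j)" using Vc j by simp
      ultimately show ?thesis using continuous_aeq_eq x by blast
    qed
    have "V (j + Suc d) j x = 0" if "m \<le> j" "j + Suc d < n" "x \<in> {0..1}" for j x
      using that
    \<comment> \<open>This equality is followed from the last row upwards, where the neighbour below
      is absent and the entry must vanish.\<close>
    proof (induction "n - j" arbitrary: j rule: less_induct)
      case less
      show ?case
      proof (cases "Suc (j + Suc d) < n")
        case True
        have "V (Suc j + Suc d) (Suc j) x = 0"
          by (rule less.hyps) (use True less.prems in auto)
        then show ?thesis using rec[OF less.prems] True by simp
      next
        case False
        then show ?thesis using rec[OF less.prems] by simp
      qed
    qed
    then show ?case by simp
  qed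
  have right: "V k j x = (if k = j then 1 else 0)" if "k < n" "j < n" "m \<le> j" "x \<in> {0..1}" for k j x
  proof (cases "k \<le> j")
    case True
    then show ?thesis using upper[OF that(1)] that by blast
  next
    case False
    then show ?thesis using lower[of "k - j", rule_format, of j x] that by simp
  qed
  have "intertwines m n ?A ?A' V"
    unfolding intertwines_def mn(3) using V[unfolded G_def[abs_def]] top right by blast
  then show ?thesis by blast
qed

end

section \<open>Weyl--Yurko matrices\<close>

context order_params
begin

section \<open>Eigenvalue equations and the transfer of their solutions\<close>

abbreviation assoc_matrix :: "matfun \<Rightarrow> nat \<Rightarrow> nat \<Rightarrow> real \<Rightarrow> complex" where
  "assoc_matrix F \<equiv> companion m s (assoc_entries F)"

text \<open>The term \<mu> y is absorbed into the lower left corner of the coefficient matrix, so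
  existence and uniqueness for homogeneous systems apply.\<close>

lemma spectral_homogeneous:
  defines "P \<equiv> \<lambda>A \<mu> k j x. A k j x + (if Suc k = n \<and> j = 0 then \<mu> else 0)"
  shows "system n A (\<lambda>x. \<mu> * Y 0 x) Y \<longleftrightarrow> (\<forall>k<n. acd (Y k) (\<lambda>x. \<Sum>j<n. P A \<mu> k j x * Y j x))"
proof -
  have n0: "0 < n" using n m by simp
  have "(\<Sum>j<n. P A \<mu> k j x * Y j x) = (\<Sum>j<n. A k j x * Y j x) + (if Suc k = n then \<mu> * Y 0 x else 0)" for k x
  proof -
    have "(\<Sum>j<n. (if Suc k = n \<and> j = 0 then \<mu> else 0) * Y j x) = (if Suc k = n then \<mu> * Y 0 x else 0)"
      using n0 by (subst sum.mono_neutral_right[of "{..<n}" "{0}"]) auto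
    then show ?thesis unfolding P_def distrib_right sum.distrib by simp
  qed
  then show ?thesis unfolding system_def by (simp only:)
qed

lemma spectral_integrable:
  fixes A :: "nat \<Rightarrow> nat \<Rightarrow> real \<Rightarrow> complex"
  assumes "\<And>k j. k < n \<Longrightarrow> j < n \<Longrightarrow> integrable leb01 (A k j)" "k < n" "j < n"
  shows "integrable leb01 (\<lambda>x. A k j x + (if Suc k = n \<and> j = 0 then \<mu> else 0))"
  by (rule Bochner_Integration.integrable_add[OF assms(1)[OF assms(2,3)] continuous_integrable_01[OF continuous_on_const]])

lemma spectral_exists:
  fixes A :: "nat \<Rightarrow> nat \<Rightarrow> real \<Rightarrow> complex"
  assumes A: "\<And>k j. k < n \<Longrightarrow> j < n \<Longrightarrow> integrable leb01 (A k j)"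
  obtains Y where "system n A (\<lambda>x. \<mu> * Y 0 x) Y" "\<And>k. k < n \<Longrightarrow> Y k 0 = c k"
proof -
  have i: "integrable leb01 (\<lambda>x. A k j x + (if Suc k = n \<and> j = 0 then \<mu> else 0))" if "k < n" "j < n" for k j
    by (rule spectral_integrable) (use A that in auto)
  obtain Y where "\<And>k. k < n \<Longrightarrow> acd (Y k) (\<lambda>x. \<Sum>j<n. (A k j x + (if Suc k = n \<and> j = 0 then \<mu> else 0)) * Y j x)"
    "\<And>k. k < n \<Longrightarrow> Y k 0 = c k"
    by (rule linear_ode_exists[of n "\<lambda>k j x. A k j x + (if Suc k = n \<and> j = 0 then \<mu> else 0)" c, OF i])
      (assumption+, rule that, assumption+)
  then show ?thesis by (intro that[of Y]) (auto simp: spectral_homogeneous)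
qed

lemma spectral_unique:
  fixes A :: "nat \<Rightarrow> nat \<Rightarrow> real \<Rightarrow> complex"
  assumes A: "\<And>k j. k < n \<Longrightarrow> j < n \<Longrightarrow> integrable leb01 (A k j)"
    and Y: "system n A (\<lambda>x. \<mu> * Y 0 x) Y" and Z: "system n A (\<lambda>x. \<mu> * Z 0 x) Z"
    and YZ: "\<And>k. k < n \<Longrightarrow> Y k 0 = Z k 0" and "k < n" "x \<in> {0..1}"
  shows "Y k x = Z k x"
proof (rule linear_ode_unique[of n "\<lambda>k j x. A k j x + (if Suc k = n \<and> j = 0 then \<mu> else 0)" Y Z])
  show "integrable leb01 (\<lambda>x. A k j x + (if Suc k = n \<and> j = 0 then \<mu> else 0))" if "k < n" "j < n" for k j
    by (rule spectral_integrable) (use A that in auto)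
  show "acd (Y k) (\<lambda>x. \<Sum>j<n. (A k j x + (if Suc k = n \<and> j = 0 then \<mu> else 0)) * Y j x)" if "k < n" for k
    using Y that unfolding spectral_homogeneous by blast
  show "acd (Z k) (\<lambda>x. \<Sum>j<n. (A k j x + (if Suc k = n \<and> j = 0 then \<mu> else 0)) * Z j x)" if "k < n" for k
    using Z that unfolding spectral_homogeneous by blast
qed (use assms in auto)

lemma associated_class: "F \<in> associated m s \<tau> \<Longrightarrow> F \<in> matfun_class m s"
  by (simp add: associated_def)

text \<open>The function h witnessing a solution and y^[n] define the same distribution, hence agree
  a.e. by the fundamental lemma.\<close>

lemma solution_system:
  assumes F: "F \<in> associated m s \<tau>" and y: "is_solution m s \<tau> F \<mu> y"
  shows "y \<in> qdomain n F"
    "system n (assoc_matrix F) (\<lambda>x. \<mu> * quasi F y 0 x) (quasi F y)"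
    "aeq (quasi F y n) (\<lambda>x. \<mu> * y x)"
proof -
  obtain h where q: "y \<in> qdomain n F" and hL: "h \<in> Lp01 1"
    and hd: "diff_expr m s \<tau> y = regular_distrib h" and ha: "aeq h (\<lambda>x. \<mu> * y x)"
    using y unfolding is_solution_def n[symmetric] by (elim conjE bexE) (rule that)
  note h = hL[unfolded Lp01_1_iff] hd ha
  show "y \<in> qdomain n F" by (rule q)
  note sys = qdomain_system[OF associated_class[OF F] q]
  have eq: "regular_distrib h = regular_distrib (quasi F y n)"
    using F q h(2) unfolding associated_def n[symmetric] by auto
  have "aeq (\<lambda>x. h x - quasi F y n x) (\<lambda>_. 0)"
  proof (rule test_fundamental)
    show "integrable leb01 (\<lambda>x. h x - quasi F y n x)" using h(1) sys(1) by simp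
    fix z assume z: "z \<in> test_functions"
    have "(LINT x|leb01. h x * z x) = (LINT x|leb01. quasi F y n x * z x)"
      using fun_cong[OF eq, of z] z by (simp add: regular_distrib_def)
    then show "(LINT x|leb01. (h x - quasi F y n x) * z x) = 0"
      using test_integrable_mult[OF h(1) z] test_integrable_mult[OF sys(1) z] by (simp add: left_diff_distrib)
  qed
  then have "aeq (quasi F y n) h" by eventually_elim simp
  from aeq_trans[OF this h(3)] show ae: "aeq (quasi F y n) (\<lambda>x. \<mu> * y x)" .
  have "aeq (\<lambda>x. (\<Sum>j<n. assoc_matrix F k j x * quasi F y j x) + (if Suc k = n then quasi F y n x else 0))
      (\<lambda>x. (\<Sum>j<n. assoc_matrix F k j x * quasi F y j x) + (if Suc k = n then \<mu> * quasi F y 0 x else 0))" for k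
    using ae by eventually_elim (simp del: quasi.simps add: quasi.simps(1))
  note ae' = this
  show "system n (assoc_matrix F) (\<lambda>x. \<mu> * quasi F y 0 x) (quasi F y)"
    unfolding system_def
  proof (intro allI impI)
    fix k assume k: "k < n"
    note a = system_acd[OF sys(2) k]
    show "acd (quasi F y k) (\<lambda>x. (\<Sum>j<n. assoc_matrix F k j x * quasi F y j x) + (if Suc k = n then \<mu> * quasi F y 0 x else 0))"
      by (rule acd_deriv_cong[OF a ae'])
  qed
qed

lemma system_solution:
  assumes F: "F \<in> associated m s \<tau>"
    and Y: "system n (assoc_matrix F) (\<lambda>x. \<mu> * Y 0 x) Y"
    and y: "\<And>x. x \<in> {0..1} \<Longrightarrow> y x = Y 0 x"
  shows "is_solution m s \<tau> F \<mu> y" "\<And>k x. k < n \<Longrightarrow> x \<in> {0..1} \<Longrightarrow> quasi F y k x = Y k x"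
proof -
  note q = system_qdomain[OF associated_class[OF F] Y y]
  show "\<And>k x. k < n \<Longrightarrow> x \<in> {0..1} \<Longrightarrow> quasi F y k x = Y k x" by (rule q(2))
  have "aeq (\<lambda>x. \<mu> * Y 0 x) (\<lambda>x. \<mu> * y x)" by (rule AE_I2) (use y in simp)
  with q(3) have ae: "aeq (quasi F y n) (\<lambda>x. \<mu> * y x)" by (rule aeq_trans)
  have i: "integrable leb01 (quasi F y n)" by (rule qdomain_system(1)[OF associated_class[OF F] q(1)])
  have "diff_expr m s \<tau> y = regular_distrib (quasi F y n)"
    using F q(1) unfolding associated_def n[symmetric] by blast
  then show "is_solution m s \<tau> F \<mu> y"
    unfolding is_solution_def n[symmetric]
    by (intro conjI bexI[of _ "quasi F y n"] q(1) ae i[folded Lp01_1_iff])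
qed

text \<open>Chosen solutions are unconstrained outside [0,1], and uniqueness of Weyl solutions is
  stated on [0,1] only; quasi-derivatives do not see the difference.\<close>

lemma solution_cong:
  assumes F: "F \<in> associated m s \<tau>" and y: "is_solution m s \<tau> F \<mu> y" and eq: "\<And>x. x \<in> {0..1} \<Longrightarrow> y' x = y x"
    and "k < n" "x \<in> {0..1}"
  shows "quasi F y' k x = quasi F y k x"
  by (rule system_solution(2)[OF F solution_system(2)[OF F y]]) (use assms in auto)

text \<open>It is not known in advance that y lies in the domain of \<open>F'\<close>. A solution
  for \<open>F'\<close> is constructed with matching initial values instead, and uniqueness in the
  canonical system forces its first component to be y.\<close>

lemma solution_transfer:
  assumes \<tau>: "\<tau> \<in> coeffs_class m s" and F: "F \<in> associated m s \<tau>" and F': "F' \<in> associated m s \<tau>"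
  obtains H where "\<And>\<mu> y. is_solution m s \<tau> F \<mu> y \<Longrightarrow> is_solution m s \<tau> F' \<mu> y"
    "\<And>\<mu> y k x. is_solution m s \<tau> F \<mu> y \<Longrightarrow> k < n \<Longrightarrow> x \<in> {0..1} \<Longrightarrow>
       quasi F' y k x = quasi F y k x + (if n - m \<le> k then (\<Sum>j<m. H k j x * quasi F y j x) else 0)"
proof -
  have mn: "m < n" "m \<le> n - m" "0 < n" "0 < n - m" using m n by auto
  obtain B where B: "\<And>k j. k < n \<Longrightarrow> j < n \<Longrightarrow> integrable leb01 (companion m s B k j)"
    "\<And>F y. F \<in> associated m s \<tau> \<Longrightarrow> y \<in> qdomain n F \<Longrightarrow>
      \<exists>Z. system n (companion m s B) (quasi F y n) Z \<and> (\<forall>x\<in>{0..1}. Z 0 x = y x)"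
    by (rule canonical_system[OF \<tau>]) blast
  let ?A0 = "companion m s B"
  have ex: "\<exists>V. intertwines m n (assoc_matrix F) ?A0 V" if F: "F \<in> associated m s \<tau>" for F
  proof (rule intertwines_exists)
    show "integrable leb01 (assoc_matrix F k j)" if "k < n" "j < n" for k j
      by (rule companion_integrable[OF associated_class[OF F] that])
    fix Y assume Y: "system n (assoc_matrix F) (\<lambda>_. 0) Y"
    \<comment> \<open>Homogeneous solutions are solutions at spectral parameter 0, which places them
      in the domain of F.\<close>
    have Y0: "system n (assoc_matrix F) (\<lambda>x. 0 * Y 0 x) Y" using Y by simp
    have sol: "is_solution m s \<tau> F 0 (Y 0)" by (rule system_solution(1)[OF F Y0 refl])
    note ss = solution_system[OF F sol]
    obtain Z where Z: "system n ?A0 (quasi F (Y 0) n) Z" "\<forall>x\<in>{0..1}. Z 0 x = Y 0 x"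
      using B(2)[OF F ss(1)] by blast
    have "system n ?A0 (\<lambda>_. 0) Z"
      unfolding system_def
    proof (intro allI impI)
      fix k assume k: "k < n"
      note a = system_acd[OF Z(1) k]
      have ae: "aeq (\<lambda>x. (\<Sum>j<n. ?A0 k j x * Z j x) + (if Suc k = n then quasi F (Y 0) n x else 0))
         (\<lambda>x. (\<Sum>j<n. ?A0 k j x * Z j x) + (if Suc k = n then 0 else 0))"
        using ss(3) by eventually_elim simp
      show "acd (Z k) (\<lambda>x. (\<Sum>j<n. ?A0 k j x * Z j x) + (if Suc k = n then 0 else 0))"
        by (rule acd_deriv_cong[OF a ae])
    qed
    then show "\<exists>Z. system n ?A0 (\<lambda>_. 0) Z \<and> (\<forall>x\<in>{0..1}. Z 0 x = Y 0 x)" using Z(2) by blast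
  qed
  obtain V where V: "intertwines m n (assoc_matrix F) ?A0 V" using ex[OF F] by blast
  obtain V' where V': "intertwines m n (assoc_matrix F') ?A0 V'" using ex[OF F'] by blast
  \<comment> \<open>The off-identity blocks of V and V' annihilate each other in products, so the
    quotient of the two matrices is the identity plus the difference of the blocks.\<close>
  define H where "H = (\<lambda>k j x. V k j x - V' k j x)"
  have main: "is_solution m s \<tau> F' \<mu> y \<and> (\<forall>k<n. \<forall>x\<in>{0..1}.
       quasi F' y k x = quasi F y k x + (if n - m \<le> k then (\<Sum>j<m. H k j x * quasi F y j x) else 0))"
    if y: "is_solution m s \<tau> F \<mu> y" for \<mu> y
  proof -
    let ?Y = "quasi F y"
    let ?c = "\<lambda>k x. ?Y k x + (if n - m \<le> k then (\<Sum>j<m. H k j x * ?Y j x) else 0)"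
    note ap = intertwines_apply[OF V mn(2)] and ap' = intertwines_apply[OF V' mn(2)]
    \<comment> \<open>These initial values are those for which V'Y' = VY holds at 0.\<close>
    obtain Y' where Y': "system n (assoc_matrix F') (\<lambda>x. \<mu> * Y' 0 x) Y'" "\<And>k. k < n \<Longrightarrow> Y' k 0 = ?c k 0"
      by (rule spectral_exists[of "assoc_matrix F'" \<mu> "\<lambda>k. ?c k 0", OF companion_integrable[OF associated_class[OF F']]])
        (assumption+, rule that, assumption+)
    define U where "U = (\<lambda>k x. \<Sum>j<n. V k j x * ?Y j x)"
    define U' where "U' = (\<lambda>k x. \<Sum>j<n. V' k j x * Y' j x)"
    have U0: "U 0 x = ?Y 0 x" if "x \<in> {0..1}" for x
      using ap[OF mn(3) that, of "\<lambda>j. ?Y j x"] mn(4) by (simp add: U_def)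
    have U'0: "U' 0 x = Y' 0 x" if "x \<in> {0..1}" for x
      using ap'[OF mn(3) that, of "\<lambda>j. Y' j x"] mn(4) by (simp add: U'_def)
    have cong0: "system n ?A0 (\<lambda>x. \<mu> * W 0 x) W"
      if W: "system n ?A0 (\<lambda>x. \<mu> * W0 x) W" and e: "\<And>x. x \<in> {0..1} \<Longrightarrow> W 0 x = W0 x" for W W0
      unfolding system_def
    proof (intro allI impI)
      fix k assume k: "k < n"
      note a = system_acd[OF W k]
      have ae: "aeq (\<lambda>x. (\<Sum>j<n. ?A0 k j x * W j x) + (if Suc k = n then \<mu> * W0 x else 0))
         (\<lambda>x. (\<Sum>j<n. ?A0 k j x * W j x) + (if Suc k = n then \<mu> * W 0 x else 0))"
        by (rule AE_I2) (use e in simp)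
      show "acd (W k) (\<lambda>x. (\<Sum>j<n. ?A0 k j x * W j x) + (if Suc k = n then \<mu> * W 0 x else 0))"
        by (rule acd_deriv_cong[OF a ae])
    qed
    have sU: "system n ?A0 (\<lambda>x. \<mu> * U 0 x) U"
      by (rule cong0[where W = U, OF _ U0]) (use intertwines_system[OF V solution_system(2)[OF F y] mn(1)] in \<open>simp add: U_def\<close>)
    have sU': "system n ?A0 (\<lambda>x. \<mu> * U' 0 x) U'"
      by (rule cong0[where W = U', OF _ U'0]) (use intertwines_system[OF V' Y'(1) mn(1)] in \<open>simp add: U'_def\<close>)
    \<comment> \<open>Both matrices leave the components below n - m alone, and the blocks act only
      on components below m <= n - m. So the low components agree and the high ones can be read
      off.\<close>
    have solve: "(\<forall>k<n. U' k x = U k x) \<longleftrightarrow> (\<forall>k<n. Y' k x = ?c k x)" if x: "x \<in> {0..1}" for x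
    proof
      assume e: "\<forall>k<n. U' k x = U k x"
      have lo: "Y' k x = ?Y k x" if "k < n - m" for k
        using e[rule_format, of k] ap[of k x "\<lambda>j. ?Y j x"] ap'[of k x "\<lambda>j. Y' j x"] that x by (simp add: U_def U'_def)
      show "\<forall>k<n. Y' k x = ?c k x"
      proof (intro allI impI)
        fix k assume k: "k < n"
        have "(\<Sum>j<m. V' k j x * Y' j x) = (\<Sum>j<m. V' k j x * ?Y j x)"
          by (intro sum.cong refl) (use lo mn in auto)
        then show "Y' k x = ?c k x"
          using e[rule_format, OF k] ap[OF k x, of "\<lambda>j. ?Y j x"] ap'[OF k x, of "\<lambda>j. Y' j x"]
          by (simp add: U_def U'_def H_def left_diff_distrib sum_subtractf algebra_simps split: if_splits)
      qed
    next
      assume e: "\<forall>k<n. Y' k x = ?c k x"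
      show "\<forall>k<n. U' k x = U k x"
      proof (intro allI impI)
        fix k assume k: "k < n"
        have "(\<Sum>j<m. V' k j x * Y' j x) = (\<Sum>j<m. V' k j x * ?Y j x)"
          by (intro sum.cong refl) (use e mn in auto)
        then show "U' k x = U k x"
          using e[rule_format, OF k] ap[OF k x, of "\<lambda>j. ?Y j x"] ap'[OF k x, of "\<lambda>j. Y' j x"]
          by (simp add: U_def U'_def H_def left_diff_distrib sum_subtractf algebra_simps split: if_splits)
      qed
    qed
    have init: "U' k 0 = U k 0" if "k < n" for k using solve[of 0] Y'(2) that by simp
    have "U' k x = U k x" if "k < n" "x \<in> {0..1}" for k x
      by (rule spectral_unique[OF B(1) sU' sU init that])
    then have Yc: "Y' k x = ?c k x" if "k < n" "x \<in> {0..1}" for k x using solve that by blast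
    have "y x = Y' 0 x" if "x \<in> {0..1}" for x using Yc[OF mn(3) that] mn(4) by simp
    note ss = system_solution[OF F' Y'(1) this]
    show ?thesis using ss(1) ss(2) Yc by (simp del: quasi.simps)
  qed
  show ?thesis by (rule that[of H]) (use main in blast)+
qed

section \<open>The Weyl solutions and their matrix\<close>

lemma C_sol_is_C:
  assumes F: "F \<in> associated m s \<tau>"
  shows "is_C m s \<tau> F k \<mu> (C_sol m s \<tau> F k \<mu>)"
proof -
  obtain Y where Y: "system n (assoc_matrix F) (\<lambda>x. \<mu> * Y 0 x) Y"
    "\<And>j. j < n \<Longrightarrow> Y j 0 = (if k = Suc j then 1 else 0)"
    by (rule spectral_exists[of "assoc_matrix F" \<mu> "\<lambda>j. if k = Suc j then 1 else 0", OF companion_integrable[OF associated_class[OF F]]])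
      (assumption+, rule that, assumption+)
  note ss = system_solution[OF F Y(1) refl]
  have "is_C m s \<tau> F k \<mu> (Y 0)"
    unfolding is_C_def n[symmetric]
  proof (intro conjI ballI ss(1))
    fix j assume j: "j \<in> {1..n}"
    then have "j - 1 < n" "Suc (j - 1) = j" by auto
    then show "quasi F (Y 0) (j - 1) 0 = (if k = j then 1 else 0)"
      using ss(2)[of "j - 1" 0] Y(2)[of "j - 1"] by simp
  qed
  then show ?thesis unfolding C_sol_def by (rule someI[of "is_C m s \<tau> F k \<mu>"])
qed

lemma Phi_sol_is_Phi:
  assumes "\<mu> \<notin> exceptional m s \<tau> F" "k \<in> {1..n}"
  shows "is_Phi m s \<tau> F k \<mu> (Phi_sol m s \<tau> F k \<mu>)"
proof -
  have "\<exists>y. is_Phi m s \<tau> F k \<mu> y" using assms unfolding exceptional_def n[symmetric] by blast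
  then show ?thesis unfolding Phi_sol_def by (rule someI_ex)
qed

text \<open>C(0) is the identity, so M can only be \<Phi>(0). That this choice works at every x is
  uniqueness of the initial value problem, column by column.\<close>

lemma weyl_yurko_at_0:
  assumes F: "F \<in> associated m s \<tau>" and \<mu>: "\<mu> \<notin> exceptional m s \<tau> F"
  shows "weyl_yurko m s \<tau> F \<mu> = Phi_mat m s \<tau> F \<mu> 0"
proof -
  let ?\<Phi> = "\<lambda>k. Phi_sol m s \<tau> F (k + 1) \<mu>" and ?C = "\<lambda>k. C_sol m s \<tau> F (k + 1) \<mu>"
  have \<Phi>: "is_solution m s \<tau> F \<mu> (?\<Phi> k)" if "k < n" for k
    using Phi_sol_is_Phi[OF \<mu>, of "k + 1"] that by (simp add: is_Phi_def)
  have C: "is_solution m s \<tau> F \<mu> (?C k)" for k using C_sol_is_C[OF F] by (simp add: is_C_def)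
  have C0: "quasi F (?C k) j 0 = (if j = k then 1 else 0)" if "j < n" for j k
  proof -
    have "Suc j \<in> {1..n}" using that by simp
    then have "quasi F (?C k) (Suc j - 1) 0 = (if k + 1 = Suc j then 1 else 0)"
      using C_sol_is_C[OF F, of "k + 1" \<mu>] unfolding is_C_def n[symmetric] by blast
    then show ?thesis by (simp add: eq_commute)
  qed
  have C0': "C_mat m s \<tau> F \<mu> 0 = 1\<^sub>m n"
    using C0 by (intro eq_matI) (auto simp: C_mat_def n[symmetric])
  have col: "quasi F (?\<Phi> k) j x = (\<Sum>l<n. quasi F (?C l) j x * quasi F (?\<Phi> k) l 0)"
    if "k < n" "j < n" "x \<in> {0..1}" for j k x
  proof (rule spectral_unique[OF companion_integrable[OF associated_class[OF F]] solution_system(2)[OF F \<Phi>[OF that(1)]] _ _ that(2,3)])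
    let ?A = "assoc_matrix F"
    let ?Z = "\<lambda>j x. \<Sum>l<n. quasi F (?C l) j x * quasi F (?\<Phi> k) l 0"
    show "system n ?A (\<lambda>x. \<mu> * ?Z 0 x) ?Z"
      unfolding system_def
    proof (intro allI impI)
      fix i assume i: "i < n"
      have "acd (\<lambda>x. \<Sum>l<n. quasi F (?\<Phi> k) l 0 * quasi F (?C l) i x)
         (\<lambda>x. \<Sum>l<n. quasi F (?\<Phi> k) l 0 * ((\<Sum>j<n. ?A i j x * quasi F (?C l) j x) + (if Suc i = n then \<mu> * quasi F (?C l) 0 x else 0)))"
        by (rule acd_sum, rule acd_cmult, rule system_acd[OF solution_system(2)[OF F C] i])
      moreover have "(\<Sum>l<n. quasi F (?\<Phi> k) l 0 * ((\<Sum>j<n. ?A i j x * quasi F (?C l) j x) + (if Suc i = n then \<mu> * quasi F (?C l) 0 x else 0)))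
         = (\<Sum>j<n. ?A i j x * ?Z j x) + (if Suc i = n then \<mu> * ?Z 0 x else 0)" for x
      proof -
        have "(\<Sum>l<n. quasi F (?\<Phi> k) l 0 * (\<Sum>j<n. ?A i j x * quasi F (?C l) j x)) = (\<Sum>j<n. ?A i j x * ?Z j x)"
          unfolding sum_distrib_left by (subst sum.swap) (simp add: algebra_simps del: quasi.simps)
        moreover have "(\<Sum>l<n. quasi F (?\<Phi> k) l 0 * (if Suc i = n then \<mu> * quasi F (?C l) 0 x else 0)) = (if Suc i = n then \<mu> * ?Z 0 x else 0)"
          by (cases "Suc i = n") (simp_all add: sum_distrib_left algebra_simps del: quasi.simps)
        ultimately show ?thesis unfolding distrib_left sum.distrib by (simp only:)
      qed
      ultimately show "acd (?Z i) (\<lambda>x. (\<Sum>j<n. ?A i j x * ?Z j x) + (if Suc i = n then \<mu> * ?Z 0 x else 0))"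
        by (simp only: mult.commute[of _ "quasi F (?\<Phi> k) _ 0"])
    qed
    fix i assume i: "i < n"
    show "quasi F (?\<Phi> k) i 0 = ?Z i 0"
      using sum_delta_right[OF i, of "\<lambda>l. quasi F (?\<Phi> k) l 0"] C0[OF i] by (simp del: quasi.simps)
  qed
  have prod: "Phi_mat m s \<tau> F \<mu> x = C_mat m s \<tau> F \<mu> x * Phi_mat m s \<tau> F \<mu> 0" if "x \<in> {0..1}" for x
    by (rule eq_matI)
      (use col[OF _ _ that] in \<open>auto simp: Phi_mat_def C_mat_def n[symmetric] scalar_prod_def atLeast0LessThan\<close>)
  have zero_in: "(0 :: real) \<in> {0..1}" by simp
  have cM: "Phi_mat m s \<tau> F \<mu> 0 \<in> carrier_mat n n" by (simp add: Phi_mat_def n)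
  show ?thesis
    unfolding weyl_yurko_def n[symmetric]
  proof (rule the_equality)
    show "Phi_mat m s \<tau> F \<mu> 0 \<in> carrier_mat n n \<and>
      (\<forall>x\<in>{0..1}. Phi_mat m s \<tau> F \<mu> x = C_mat m s \<tau> F \<mu> x * Phi_mat m s \<tau> F \<mu> 0)"
      using cM prod by blast
    fix M assume M: "M \<in> carrier_mat n n \<and> (\<forall>x\<in>{0..1}. Phi_mat m s \<tau> F \<mu> x = C_mat m s \<tau> F \<mu> x * M)"
    then have "Phi_mat m s \<tau> F \<mu> 0 = C_mat m s \<tau> F \<mu> 0 * M" using zero_in by blast
    moreover have "1\<^sub>m n * M = M" by (rule left_mult_one_mat) (use M in blast)
    ultimately show "M = Phi_mat m s \<tau> F \<mu> 0" unfolding C0' by (simp only:)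
  qed
qed

lemma weyl_yurko_transfer:
  assumes \<tau>: "\<tau> \<in> coeffs_class m s" and F: "F \<in> associated m s \<tau>" and F': "F' \<in> associated m s \<tau>"
  shows "\<exists>L \<in> L_class n m. \<forall>\<mu>. \<mu> \<notin> exceptional m s \<tau> F \<and> \<mu> \<notin> exceptional m s \<tau> F' \<longrightarrow>
           weyl_yurko m s \<tau> F \<mu> = L * weyl_yurko m s \<tau> F' \<mu>"
proof -
  have mn: "m < n" "m \<le> n - m" using m n by auto
  \<comment> \<open>The transfer runs from \<open>F'\<close> to \<open>F\<close>: quasi-derivatives
    for \<open>F\<close> are expressed through those for \<open>F'\<close>, which puts the factor on
    the left of the matrix for \<open>F'\<close>.\<close>
  obtain H where H: "\<And>\<mu> y. is_solution m s \<tau> F' \<mu> y \<Longrightarrow> is_solution m s \<tau> F \<mu> y"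
    "\<And>\<mu> y k x. is_solution m s \<tau> F' \<mu> y \<Longrightarrow> k < n \<Longrightarrow> x \<in> {0..1} \<Longrightarrow>
       quasi F y k x = quasi F' y k x + (if n - m \<le> k then (\<Sum>j<m. H k j x * quasi F' y j x) else 0)"
    by (rule solution_transfer[OF \<tau> F' F]) blast
  \<comment> \<open>\<open>H\<close> does not depend on the spectral parameter, so its value at x =
    0 yields a constant matrix.\<close>
  define L where "L = mat n n (\<lambda>(k, j). (if k = j then 1 else 0) + (if n - m \<le> k \<and> j < m then H k j 0 else 0))"
  have "L \<in> L_class n m"
    unfolding L_class_def
  proof (intro CollectI conjI ballI impI)
    show "L \<in> carrier_mat n n" by (simp add: L_def)
    fix j k assume j: "j \<in> {1..n}" and k: "k \<in> {1..n}" and jk: "j \<le> n - m \<or> k > m"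
    have "\<not> (n - m \<le> j - 1 \<and> k - 1 < m)" "(j - 1 = k - 1) = (j = k)" "j - 1 < n" "k - 1 < n"
      using j k jk by auto
    then show "L $$ (j - 1, k - 1) = (if j = k then 1 else 0)" by (auto simp: L_def)
  qed
  moreover have "weyl_yurko m s \<tau> F \<mu> = L * weyl_yurko m s \<tau> F' \<mu>"
    if \<mu>: "\<mu> \<notin> exceptional m s \<tau> F" and \<mu>': "\<mu> \<notin> exceptional m s \<tau> F'" for \<mu>
  proof -
    let ?\<Phi> = "\<lambda>k. Phi_sol m s \<tau> F (k + 1) \<mu>" and ?\<Phi>' = "\<lambda>k. Phi_sol m s \<tau> F' (k + 1) \<mu>"
    have entry: "quasi F (?\<Phi> k) j 0 = quasi F' (?\<Phi>' k) j 0 + (if n - m \<le> j then (\<Sum>i<m. H j i 0 * quasi F' (?\<Phi>' k) i 0) else 0)"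
      if k: "k < n" and j: "j < n" for k j
    proof -
      have k1: "k + 1 \<in> {1..n}" using k by simp
      have P: "is_Phi m s \<tau> F (k + 1) \<mu> (?\<Phi> k)" by (rule Phi_sol_is_Phi[OF \<mu> k1])
      have P': "is_Phi m s \<tau> F' (k + 1) \<mu> (?\<Phi>' k)" by (rule Phi_sol_is_Phi[OF \<mu>' k1])
      have sol': "is_solution m s \<tau> F' \<mu> (?\<Phi>' k)" using P' by (simp add: is_Phi_def)
      have at0: "quasi F' (?\<Phi>' k) i 0 = (if k = i then 1 else 0)" if "i \<le> k" for i
      proof -
        have "Suc i \<in> {1..k + 1}" using that by simp
        then have "quasi F' (?\<Phi>' k) (Suc i - 1) 0 = (if k + 1 = Suc i then 1 else 0)"
          using P' unfolding is_Phi_def by blast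
        then show ?thesis by simp
      qed
      have at1: "quasi F' (?\<Phi>' k) i 1 = 0" if "i + k + 1 < n" for i
      proof -
        have "n - i \<in> {k + 1 + 1..n}" "n - (n - i) = i" using that by auto
        then show ?thesis using P' unfolding is_Phi_def n[symmetric] by metis
      qed
      have "is_Phi m s \<tau> F (k + 1) \<mu> (?\<Phi>' k)"
        unfolding is_Phi_def n[symmetric]
      proof (intro conjI ballI H(1)[OF sol'])
        fix i assume i: "i \<in> {1..k + 1}"
        have "(if n - m \<le> i - 1 then (\<Sum>j<m. H (i - 1) j 0 * quasi F' (?\<Phi>' k) j 0) else 0) = 0"
        proof (cases "n - m \<le> i - 1")
          case True
          \<comment> \<open>The corrected row satisfies i - 1 >= n - m >= m > j, and i - 1 <= k, so
            j < k and the prescribed initial value of index j is 0.\<close>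
          have "H (i - 1) j 0 * quasi F' (?\<Phi>' k) j 0 = 0" if "j < m" for j
          proof -
            have "j < k" using True that mn i by auto
            then show ?thesis using at0[of j] by simp
          qed
          then show ?thesis by (simp add: sum.neutral)
        qed simp
        moreover have "i - 1 \<le> k" "i - 1 < n" "(k + 1 = i) = (k = i - 1)" using i k by auto
        ultimately show "quasi F (?\<Phi>' k) (i - 1) 0 = (if k + 1 = i then 1 else 0)"
          using H(2)[OF sol', of "i - 1" 0] at0[of "i - 1"] by simp
      next
        fix r assume r: "r \<in> {k + 1 + 1..n}"
        have "(if n - m \<le> n - r then (\<Sum>j<m. H (n - r) j 1 * quasi F' (?\<Phi>' k) j 1) else 0) = 0"
        proof (cases "n - m \<le> n - r")
          case True
          \<comment> \<open>Here n - r >= n - m >= m > j, so index j lies below an index already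
            required to vanish at 1.\<close>
          have "H (n - r) j 1 * quasi F' (?\<Phi>' k) j 1 = 0" if "j < m" for j
          proof -
            have "j + k + 1 < n" using True that mn r by auto
            then show ?thesis using at1[of j] by simp
          qed
          then show ?thesis by (simp add: sum.neutral)
        qed simp
        moreover have "n - r < n" "n - r + k + 1 < n" using r by auto
        ultimately show "quasi F (?\<Phi>' k) (n - r) 1 = 0"
          using H(2)[OF sol', of "n - r" 1] at1[of "n - r"] by simp
      qed
      \<comment> \<open>The Weyl solution for \<open>F'\<close> meets all conditions for
        \<open>F\<close>, and off the exceptional set of \<open>F\<close> there is only one such
        function on [0,1].\<close>
      then have eq: "\<forall>x\<in>{0..1}. ?\<Phi> k x = ?\<Phi>' k x"
        using \<mu> k1 P unfolding exceptional_def n[symmetric] by blast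
      have "quasi F (?\<Phi> k) j 0 = quasi F (?\<Phi>' k) j 0"
        by (rule solution_cong[OF F H(1)[OF sol'] _ j]) (use eq in auto)
      then show ?thesis using H(2)[OF sol' j, of 0] by simp
    qed
    have "Phi_mat m s \<tau> F \<mu> 0 = L * Phi_mat m s \<tau> F' \<mu> 0"
    proof (rule eq_matI)
      fix j k assume "j < dim_row (L * Phi_mat m s \<tau> F' \<mu> 0)" "k < dim_col (L * Phi_mat m s \<tau> F' \<mu> 0)"
      then have jk: "j < n" "k < n" by (auto simp: L_def Phi_mat_def n)
      let ?q = "\<lambda>i. quasi F' (?\<Phi>' k) i 0"
      have "(L * Phi_mat m s \<tau> F' \<mu> 0) $$ (j, k)
         = (\<Sum>i<n. ((if j = i then 1 else 0) + (if n - m \<le> j \<and> i < m then H j i 0 else 0)) * ?q i)"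
        using jk by (simp add: L_def Phi_mat_def n[symmetric] scalar_prod_def atLeast0LessThan)
      also have "\<dots> = ?q j + (\<Sum>i<n. (if n - m \<le> j \<and> i < m then H j i 0 else 0) * ?q i)"
        unfolding distrib_right sum.distrib sum_delta_right[OF jk(1)] ..
      also have "(\<Sum>i<n. (if n - m \<le> j \<and> i < m then H j i 0 else 0) * ?q i) = (if n - m \<le> j then (\<Sum>i<m. H j i 0 * ?q i) else 0)"
      proof (cases "n - m \<le> j")
        case True
        then show ?thesis using mn
          by (subst sum.mono_neutral_right[of "{..<n}" "{..<m}"]) auto
      qed simp
      finally show "Phi_mat m s \<tau> F \<mu> 0 $$ (j, k) = (L * Phi_mat m s \<tau> F' \<mu> 0) $$ (j, k)"
        using entry[OF jk(2,1)] jk by (simp add: Phi_mat_def n[symmetric])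
    qed (auto simp: L_def Phi_mat_def n)
    then show ?thesis
      unfolding weyl_yurko_at_0[OF F \<mu>] weyl_yurko_at_0[OF F' \<mu>'] .
  qed
  ultimately show ?thesis by blast
qed

end

theorem theorem4p1:
  fixes m s n :: nat and \<tau> :: "nat \<Rightarrow> distrib" and F F' :: matfun
  assumes "m \<ge> 1" and "s \<in> {0, 1}" and "n = 2 * m + s"
    and "\<tau> \<in> coeffs_class0 m s"
    and "F \<in> associated m s \<tau>" and "F' \<in> associated m s \<tau>"
  shows "\<exists>L \<in> L_class n m. \<forall>\<mu>. \<mu> \<notin> exceptional m s \<tau> F \<and> \<mu> \<notin> exceptional m s \<tau> F' \<longrightarrow>
           weyl_yurko m s \<tau> F \<mu> = L * weyl_yurko m s \<tau> F' \<mu>"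
proof -
  interpret order_params m s n by standard fact+
  have "\<tau> \<in> coeffs_class m s" using assms(4) by (simp add: coeffs_class0_def)
  then show ?thesis using assms(5,6) by (rule weyl_yurko_transfer)
qed

end
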